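(* $\operatorname{Aut}\mathbb{E}=G$, where $$G=\{L_\upsilon R_\chi F^\nu:\ \upsilon,\chi\in\operatorname{Aut}\mathbb{D},\ \nu=0\text{ or }1\}.$$
   Context: $\mathbb{D}$ is the open unit disc in $\mathbb{C}$, and the tetrablock is the domain $$\mathbb{E}=\{(x_1,x_2,x_3)\in\mathbb{C}^3: 1-x_1z-x_2w+x_3zw\neq 0 \text{ for all } z,w\in\mathbb{C} \text{ with } |z|\leq 1,\ |w|\leq 1\},$$ with closure $\overline{\mathbb{E}}$. For a domain $\Omega$, $\operatorname{Aut}\Omega$ is the group (under composition) of automorphisms of $\Omega$, i.e. analytic bijective self-maps of $\Omega$ with analytic inverse. For $x=(x_1,x_2,x_3)\in\mathbb{C}^3$ let $\Psi(z,x)=\dfrac{x_3z-x_1}{x_2z-1}$. For $x,y\in\mathbb{C}^3$ with $x_2y_1\neq 1$ define $$x\diamond y=\frac{1}{1-x_2y_1}\,(x_1-x_3y_1,\ y_2-x_2y_3,\ x_1y_2-x_3y_3).$$ Each $\upsilon\in\operatorname{Aut}\mathbb{D}$ can be written $\upsilon=\Psi(\cdot,\tau(\upsilon))$ for a point $\tau(\upsilon)\in\overline{\mathbb{E}}$; explicitly, if $\upsilon(z)=\omega\dfrac{z-\alpha}{\bar\alpha z-1}$ with $|\omega|=1$, $\alpha\in\mathbb{D}$, then $\tau(\upsilon)=(\omega\alpha,\bar\alpha,\omega)$. For $\upsilon,\chi\in\operatorname{Aut}\mathbb{D}$ the maps $L_\upsilon,R_\chi:\mathbb{E}\to\mathbb{E}$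 are given by $L_\upsilon(x)=\upsilon\cdot x=\tau(\upsilon)\diamond x$ and $R_\chi(x)=x\cdot\chi=x\diamond\tau(\chi)$. $F:\mathbb{E}\to\mathbb{E}$ is the flip $F(x_1,x_2,x_3)=(x_2,x_1,x_3)$. Products in $G$ denote composition of maps. *)

theory Defs
  imports "HOL-Analysis.Analysis" "HOL-Algebra.Bij"
begin

section \<open>Holomorphic maps and automorphism groups\<close>

text \<open>Holomorphy in several complex variables is complex Frechet differentiability: the real
  derivative exists and is linear over the complex numbers (\<open>*s\<close> is scaling of vectors in
  complex coordinate space by complex numbers).\<close>

definition holomorphic_map_on :: "(complex^'n \<Rightarrow> complex^'m) \<Rightarrow> (complex^'n) set \<Rightarrow> bool"
    (infixl \<open>(holomorphic'_map'_on)\<close> 50) where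
  "f holomorphic_map_on S \<longleftrightarrow>
     (\<forall>x\<in>S. \<exists>D. (f has_derivative D) (at x within S) \<and> Vector_Spaces.linear (*s) (*s) D)"

text \<open>Self-maps of \<open>\<Omega>\<close> are represented by extensional functions (equal to \<^term>\<open>undefined\<close> outside
  \<open>\<Omega>\<close>; this is built into \<^const>\<open>Bij\<close>), so that equality of functions is equality of maps on
  \<open>\<Omega>\<close>, and composition is \<^term>\<open>compose \<Omega>\<close>, as in \<^term>\<open>BijGroup \<Omega>\<close>;
  the automorphisms form a subgroup of the latter (lemma \<open>subgroup_Aut\<close>).\<close>

definition Aut :: "(complex^'n) set \<Rightarrow> (complex^'n \<Rightarrow> complex^'n) set" where
  "Aut \<Omega> = {f \<in> Bij \<Omega>. f holomorphic_map_on \<Omega> \<and> inv_into \<Omega> f holomorphic_map_on \<Omega>}"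

abbreviation unit_disc :: "complex set" (\<open>\<DD>\<close>) where
  "\<DD> \<equiv> ball 0 1"

definition Aut_disc :: "(complex \<Rightarrow> complex) set" where
  "Aut_disc = {f \<in> Bij \<DD>. f holomorphic_on \<DD> \<and> inv_into \<DD> f holomorphic_on \<DD>}"


section \<open>The tetrablock\<close>

definition tetrablock :: "(complex^3) set" (\<open>\<E>\<close>) where
  "\<E> = {x. \<forall>z w. norm z \<le> 1 \<longrightarrow> norm w \<le> 1 \<longrightarrow> 1 - x$1 * z - x$2 * w + x$3 * z * w \<noteq> 0}"

definition Psi :: "complex \<Rightarrow> complex^3 \<Rightarrow> complex" (\<open>\<Psi>\<close>) where
  "\<Psi> z x = (x$3 * z - x$1) / (x$2 * z - 1)"

text \<open>Only meaningful when \<open>x$2 * y$1 \<noteq> 1\<close>; otherwise division by zero yields the zero vector.\<close>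

definition diamond :: "complex^3 \<Rightarrow> complex^3 \<Rightarrow> complex^3" (infixl \<open>\<diamondop>\<close> 70) where
  "x \<diamondop> y = (1 / (1 - x$2 * y$1)) *s
     vector [x$1 - x$3 * y$1, y$2 - x$2 * y$3, x$1 * y$2 - x$3 * y$3]"

text \<open>The point of the closed tetrablock representing a disc automorphism; existence, uniqueness
  and the explicit formula are lemma \<open>tau_eq\<close> below.\<close>

definition tau :: "(complex \<Rightarrow> complex) \<Rightarrow> complex^3" (\<open>\<tau>\<close>) where
  "\<tau> \<upsilon> = (THE x. x \<in> closure \<E> \<and> (\<forall>z\<in>\<DD>. \<upsilon> z = \<Psi> z x))"

definition left_act :: "(complex \<Rightarrow> complex) \<Rightarrow> complex^3 \<Rightarrow> complex^3" where
  "left_act \<upsilon> = (\<lambda>x\<in>\<E>. \<tau> \<upsilon> \<diamondop> x)"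

definition right_act :: "(complex \<Rightarrow> complex) \<Rightarrow> complex^3 \<Rightarrow> complex^3" where
  "right_act \<xi> = (\<lambda>x\<in>\<E>. x \<diamondop> \<tau> \<xi>)"

definition flip :: "complex^3 \<Rightarrow> complex^3" where
  "flip = (\<lambda>x\<in>\<E>. vector [x$2, x$1, x$3])"


section \<open>Consistency of the definitions\<close>

lemma holomorphic_map_on_compose:
  assumes f: "f holomorphic_map_on S" and g: "g holomorphic_map_on T" and "f ` S \<subseteq> T"
  shows "compose S g f holomorphic_map_on S"
  unfolding holomorphic_map_on_def
proof
  fix x assume x: "x \<in> S"
  obtain D where D: "(f has_derivative D) (at x within S)" "Vector_Spaces.linear (*s) (*s) D"
    using f x unfolding holomorphic_map_on_def by blast
  obtain D' where D': "(g has_derivative D') (at (f x) within T)" "Vector_Spaces.linear (*s) (*s) D'"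
    using g x assms(3) unfolding holomorphic_map_on_def by blast
  have "((\<lambda>x. g (f x)) has_derivative (\<lambda>x. D' (D x))) (at x within S)"
    using has_derivative_in_compose[OF D(1) has_derivative_subset[OF D'(1) assms(3)]] .
  then have "(compose S g f has_derivative D' \<circ> D) (at x within S)"
    using x by (auto simp: compose_def comp_def intro: has_derivative_transform)
  moreover have "Vector_Spaces.linear (*s) (*s) (D' \<circ> D)"
    using D(2) D'(2) by (rule Vector_Spaces.linear_compose)
  ultimately show "\<exists>D. (compose S g f has_derivative D) (at x within S) \<and>
      Vector_Spaces.linear (*s) (*s) D" by blast
qed

lemma holomorphic_map_on_cong:
  assumes "f holomorphic_map_on S" "\<And>x. x \<in> S \<Longrightarrow> g x = f x"
  shows "g holomorphic_map_on S"
  unfolding holomorphic_map_on_def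
proof
  fix x assume x: "x \<in> S"
  then obtain D where "(f has_derivative D) (at x within S)" and lin: "Vector_Spaces.linear (*s) (*s) D"
    using assms(1) unfolding holomorphic_map_on_def by blast
  then have "(g has_derivative D) (at x within S)"
    using x assms(2) by (intro has_derivative_transform[of x S g f])
  then show "\<exists>D. (g has_derivative D) (at x within S) \<and> Vector_Spaces.linear (*s) (*s) D"
    using lin by blast
qed

lemma subgroup_Aut: "subgroup (Aut \<Omega>) (BijGroup \<Omega>)"
proof (rule group.subgroupI[OF group_BijGroup])
  show "Aut \<Omega> \<subseteq> carrier (BijGroup \<Omega>)"
    by (auto simp: Aut_def BijGroup_def)
  have id: "(\<lambda>x. x) holomorphic_map_on \<Omega>"
    unfolding holomorphic_map_on_def using has_derivative_ident vec.linear_ident by blast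
  have "inv_into \<Omega> (\<lambda>x\<in>\<Omega>. x) x = x" if "x \<in> \<Omega>" for x
    using that by (intro inv_into_f_eq) (auto simp: inj_on_def)
  then have "(\<lambda>x\<in>\<Omega>. x) \<in> Aut \<Omega>"
    by (simp add: Aut_def id_Bij holomorphic_map_on_cong[OF id])
  then show "Aut \<Omega> \<noteq> {}" by blast
next
  fix f assume f: "f \<in> Aut \<Omega>"
  then have fB: "f \<in> Bij \<Omega>" and bij: "bij_betw f \<Omega> \<Omega>" by (auto simp: Aut_def Bij_def)
  define g where "g = restrict (inv_into \<Omega> f) \<Omega>"
  have gB: "g \<in> Bij \<Omega>" unfolding g_def by (rule restrict_inv_into_Bij[OF fB])
  have "inv_into \<Omega> g x = f x" if "x \<in> \<Omega>" for x
    using gB bij that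
    by (intro inv_into_f_eq) (auto simp: g_def Bij_def bij_betw_def)
  then have "inv_into \<Omega> g holomorphic_map_on \<Omega>"
    using f holomorphic_map_on_cong[of f \<Omega> "inv_into \<Omega> g"] by (simp add: Aut_def)
  moreover have "g holomorphic_map_on \<Omega>"
    using f holomorphic_map_on_cong[of "inv_into \<Omega> f" \<Omega> g] by (simp add: Aut_def g_def)
  ultimately have "g \<in> Aut \<Omega>"
    using gB by (simp add: Aut_def)
  then show "inv\<^bsub>BijGroup \<Omega>\<^esub> f \<in> Aut \<Omega>"
    using inv_BijGroup[OF fB] by (simp add: g_def)
next
  fix f g assume fg: "f \<in> Aut \<Omega>" "g \<in> Aut \<Omega>"
  then have B: "f \<in> Bij \<Omega>" "g \<in> Bij \<Omega>" and bij: "bij_betw f \<Omega> \<Omega>" "bij_betw g \<Omega> \<Omega>"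
    by (auto simp: Aut_def Bij_def)
  have cB: "compose \<Omega> f g \<in> Bij \<Omega>" by (rule compose_Bij[OF B])
  have eq: "inv_into \<Omega> (compose \<Omega> f g) x = compose \<Omega> (inv_into \<Omega> g) (inv_into \<Omega> f) x"
    if x: "x \<in> \<Omega>" for x
  proof (rule inv_into_f_eq)
    show "inj_on (compose \<Omega> f g) \<Omega>" using cB by (simp add: Bij_def bij_betw_def)
    have y: "inv_into \<Omega> f x \<in> \<Omega>" using Bij_inv_into_mem[OF B(1) x] .
    show "compose \<Omega> (inv_into \<Omega> g) (inv_into \<Omega> f) x \<in> \<Omega>"
      using x Bij_inv_into_mem[OF B(2) y] by (simp add: compose_def)
    show "compose \<Omega> f g (compose \<Omega> (inv_into \<Omega> g) (inv_into \<Omega> f) x) = x"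
      using x y Bij_inv_into_mem[OF B(2) y] bij
      by (simp add: compose_def bij_betw_inv_into_right)
  qed
  moreover have inv: "compose \<Omega> (inv_into \<Omega> g) (inv_into \<Omega> f) holomorphic_map_on \<Omega>"
    using fg B by (intro holomorphic_map_on_compose[where T = \<Omega>]) (auto simp: Aut_def Bij_inv_into_mem)
  moreover have "compose \<Omega> f g holomorphic_map_on \<Omega>"
    using fg bij by (intro holomorphic_map_on_compose[where T = \<Omega>]) (auto simp: Aut_def bij_betw_def)
  ultimately have "compose \<Omega> f g \<in> Aut \<Omega>"
    using cB holomorphic_map_on_cong[OF inv eq] by (simp add: Aut_def)
  then show "f \<otimes>\<^bsub>BijGroup \<Omega>\<^esub> g \<in> Aut \<Omega>"
    using B by (simp add: BijGroup_def)
qed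

lemma blaschke_le:
  fixes a z :: complex
  assumes "norm a < 1" "norm z \<le> 1"
  shows "norm (cnj a - z) \<le> norm (1 - a * z)"
proof -
  have "(norm (1 - a * z))\<^sup>2 - (norm (cnj a - z))\<^sup>2 = (1 - (norm a)\<^sup>2) * (1 - (norm z)\<^sup>2)"
    unfolding cmod_power2 by (simp add: power2_eq_square algebra_simps)
  moreover have "(1 - (norm a)\<^sup>2) * (1 - (norm z)\<^sup>2) \<ge> 0"
    using assms by (intro mult_nonneg_nonneg) (auto simp: power_le_one)
  ultimately have "(norm (cnj a - z))\<^sup>2 \<le> (norm (1 - a * z))\<^sup>2"
    by linarith
  then show ?thesis
    by (rule power2_le_imp_le) (rule norm_ge_zero)
qed

lemma tau_point_in_closure:
  fixes \<omega> \<alpha> :: complex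
  assumes w: "norm \<omega> = 1" and a: "norm \<alpha> < 1"
  shows "vector [\<omega> * \<alpha>, cnj \<alpha>, \<omega>] \<in> closure \<E>"
proof -
  define p where "p r = (vector [of_real r * (\<omega> * \<alpha>), of_real r * cnj \<alpha>, of_real (r\<^sup>2) * \<omega>] :: complex^3)"
    for r :: real
  have mem: "p r \<in> \<E>" if r: "0 < r" "r < 1" for r
    unfolding tetrablock_def
  proof (intro CollectI allI impI notI)
    fix z v :: complex
    assume z: "norm z \<le> 1" and v: "norm v \<le> 1"
      and 0: "1 - p r $ 1 * z - p r $ 2 * v + p r $ 3 * z * v = 0"
    define s where "s = \<omega> * of_real r * z"
    define t where "t = of_real r * v"
    have rn: "r * n < 1" if "n \<le> 1" for n
    proof -
      have "r * n \<le> r * 1" using that r(1) by (intro mult_left_mono) auto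
      then show ?thesis using r(2) by simp
    qed
    have "norm s = r * norm z" "norm t = r * norm v"
      using r(1) w by (simp_all add: s_def t_def norm_mult)
    then have s: "norm s < 1" and t: "norm t < 1"
      using rn[OF z] rn[OF v] by (simp_all only:)
    have "1 - \<alpha> * s = t * (cnj \<alpha> - s)"
      using 0 by (simp add: p_def s_def t_def power2_eq_square algebra_simps)
    then have eq: "norm (1 - \<alpha> * s) = norm t * norm (cnj \<alpha> - s)"
      by (simp add: norm_mult)
    have "norm (\<alpha> * s) < 1"
      using a s mult_strict_mono'[of "norm \<alpha>" 1 "norm s" 1] by (simp add: norm_mult)
    then have pos: "norm (1 - \<alpha> * s) > 0"
      by auto
    have "norm t * norm (cnj \<alpha> - s) \<le> norm t * norm (1 - \<alpha> * s)"
      using blaschke_le[OF a, of s] s by (intro mult_left_mono) auto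
    also have "\<dots> < 1 * norm (1 - \<alpha> * s)"
      using t pos by (intro mult_strict_right_mono)
    finally show False using eq by simp
  qed
  have "p \<midarrow>1\<rightarrow> vector [\<omega> * \<alpha>, cnj \<alpha>, \<omega>]"
  proof (rule vec_tendstoI)
    fix i :: 3
    have c: "isCont (\<lambda>r. of_real r * a :: complex) 1" "isCont (\<lambda>r. of_real (r\<^sup>2) * a :: complex) 1"
      for a by (intro continuous_intros)+
    show "((\<lambda>r. p r $ i) \<longlongrightarrow> vector [\<omega> * \<alpha>, cnj \<alpha>, \<omega>] $ i) (at 1)"
      using exhaust_3[of i] c(1)[of "\<omega> * \<alpha>"] c(1)[of "cnj \<alpha>"] c(2)[of \<omega>]
      unfolding isCont_def by (auto simp: p_def)
  qed
  then have lim: "(p \<longlongrightarrow> vector [\<omega> * \<alpha>, cnj \<alpha>, \<omega>]) (at_left 1)"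
    by (rule tendsto_within_subset) auto
  have ev: "eventually (\<lambda>r. p r \<in> closure \<E>) (at_left 1)"
    using eventually_at_left_real[of 0 1] closure_subset mem by (auto elim!: eventually_mono)
  show ?thesis
    by (rule Lim_in_closed_set[OF closed_closure ev _ lim]) simp
qed

lemma Psi_unique:
  fixes x y :: "complex^3"
  assumes eq: "\<And>z. z \<in> \<DD> \<Longrightarrow> \<Psi> z x = \<Psi> z y"
    and nd: "y$3 \<noteq> y$1 * y$2"
  shows "x = y"
proof -
  define d where "d = 2 + norm (x$2) + norm (y$2)"
  define t :: real where "t = 1 / d"
  have d: "1 < d" "norm (x$2) < d" "norm (y$2) < d"
    using norm_ge_zero[of "x$2"] norm_ge_zero[of "y$2"] unfolding d_def by linarith+
  have t: "0 < t" "t < 1" "norm (x$2) * t < 1" "norm (y$2) * t < 1"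
    using d by (simp_all add: t_def)
  have x1: "x$1 = y$1"
    using eq[of 0] by (simp add: Psi_def)
  have nz: "a * z - 1 \<noteq> 0" if "norm z = t" "norm a * t < 1" for a z :: complex
  proof
    assume "a * z - 1 = 0"
    then have "norm (a * z) = 1" by simp
    then show False using that by (simp add: norm_mult)
  qed
  have cross: "(x$3 * z - y$1) * (y$2 * z - 1) = (y$3 * z - y$1) * (x$2 * z - 1)"
    if "norm z = t" for z
  proof -
    have "(x$3 * z - y$1) / (x$2 * z - 1) = (y$3 * z - y$1) / (y$2 * z - 1)"
      using eq[of z] that t(2) unfolding Psi_def x1 by (simp only: dist_0_norm mem_ball)
    then show ?thesis
      using frac_eq_eq[OF nz[OF that t(3)] nz[OF that t(4)]] by blast
  qed
  define T :: complex where "T = of_real t"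
  have T: "T \<noteq> 0" "norm T = t" "norm (- T) = t"
    using t(1) by (auto simp: T_def)
  define A where "A = y$3 - x$3 - y$1 * (y$2 - x$2)"
  define B where "B = x$3 * y$2 - y$3 * x$2"
  have *: "z * (A + B * z) =
      (x$3 * z - y$1) * (y$2 * z - 1) - (y$3 * z - y$1) * (x$2 * z - 1)" for z
    unfolding A_def B_def by (simp add: algebra_simps)
  have 1: "T * (A + B * T) = 0"
    by (simp only: *[of T] cross[OF T(2)] diff_self)
  have 2: "- T * (A + B * - T) = 0"
    by (simp only: *[of "- T"] cross[OF T(3)] diff_self)
  have AB: "A + B * T = 0" "A + B * - T = 0"
    using 1 2 T(1) by (simp_all only: mult_eq_0_iff neg_equal_0_iff_equal simp_thms)
  have "2 * A = (A + B * T) + (A + B * - T)" by simp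
  then have A0: "A = 0" by (simp only: AB) simp
  then have B0: "B = 0" using AB(1) T(1) by simp
  have "(y$2 - x$2) * (y$3 - y$1 * y$2) = A * y$2 + B"
    by (simp add: A_def B_def algebra_simps)
  then have x2: "x$2 = y$2" using A0 B0 nd by auto
  then have "x$3 = y$3" using A0 by (simp add: A_def)
  then show ?thesis using x1 x2 by (simp add: vec_eq_iff forall_3)
qed

lemma tau_eq:
  fixes \<omega> \<alpha> :: complex
  assumes w: "norm \<omega> = 1" and a: "norm \<alpha> < 1"
    and u: "\<And>z. z \<in> \<DD> \<Longrightarrow> \<upsilon> z = \<omega> * ((z - \<alpha>) / (cnj \<alpha> * z - 1))"
  shows "\<tau> \<upsilon> = vector [\<omega> * \<alpha>, cnj \<alpha>, \<omega>]"
proof -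
  define y :: "complex^3" where "y = vector [\<omega> * \<alpha>, cnj \<alpha>, \<omega>]"
  have uy: "\<upsilon> z = \<Psi> z y" if "z \<in> \<DD>" for z
    using u[OF that] by (simp add: y_def Psi_def algebra_simps)
  have "norm (\<alpha> * cnj \<alpha>) < 1"
    using a mult_strict_mono'[of "norm \<alpha>" 1 "norm \<alpha>" 1] by (simp add: norm_mult)
  then have "\<alpha> * cnj \<alpha> \<noteq> 1" by auto
  moreover have "\<omega> \<noteq> 0" using w by auto
  ultimately have nd: "y$3 \<noteq> y$1 * y$2" by (auto simp: y_def)
  show ?thesis unfolding tau_def y_def[symmetric]
  proof (rule the_equality)
    show "y \<in> closure \<E> \<and> (\<forall>z\<in>\<DD>. \<upsilon> z = \<Psi> z y)"
      using tau_point_in_closure[OF w a] uy by (simp add: y_def)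
    show "x = y" if "x \<in> closure \<E> \<and> (\<forall>z\<in>\<DD>. \<upsilon> z = \<Psi> z x)" for x
      using that uy by (intro Psi_unique[OF _ nd]) force
  qed
qed

end

theory Submission
  imports Defs "HOL-Complex_Analysis.Conformal_Mappings"
begin

text \<open>The maps \<open>L R F\<^sup>\<nu>\<close> are automorphisms because each factor is an explicit holomorphic bijection, so the
  content is that there are no others. Call the set of points of \<open>\<E>\<close> with \<open>x\<^sub>3 = x\<^sub>1 x\<^sub>2\<close> the royal variety; it
  is the orbit of the origin under the group \<open>G\<close> generated by the left and right actions and the flip. The argument needs
  only one-variable function theory along analytic discs in \<open>\<E>\<close>.

  Isotropy group of the origin. For \<open>|\<zeta>| = 1\<close> the function \<open>\<Psi> \<zeta>\<close> maps \<open>\<E>\<close> into the disc, so the Schwarz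
  lemma shows that the tangent \<open>v\<close> at \<open>0\<close> of any analytic disc in \<open>\<E>\<close> centred at the origin satisfies
  \<open>max |v\<^sub>1| |v\<^sub>2| + |v\<^sub>3| \<le> 1\<close> (\<open>tnorm_le_1\<close>). The discs \<open>(za, zb, z\<^sup>2ab)\<close> with \<open>|a| = |b| = 1\<close> and
  \<open>(0, 0, z)\<close> attain this bound, and the unimodular multiples of their tangents have the whole unit
  ball as convex hull. Hence the derivative at \<open>0\<close> of an automorphism fixing \<open>0\<close> is an isometry of this norm, and such an isometry is a monomial matrix that keeps
  the third axis (\<open>tnorm_isometry_monomial\<close>). Up to a rotation and the flip, the derivative
  therefore fixes the first two basis vectors; the equality case of the Schwarz lemma then shows that the
  automorphism is the identity on the royal variety (\<open>fixes_royalI\<close>). Such an automorphism turns each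
  fibre \<open>\<phi> {(0, 0, z)}\<close>, where \<open>\<phi> \<in> G\<close>, by some unimodular factor. These fibres do not vary
  holomorphically with their base point, and this is incompatible with the map being holomorphic unless all
  factors are \<open>1\<close> (\<open>fixes_royal_wedge\<close> and the lemmas after it). The fibres cover \<open>\<E>\<close>
  (\<open>tetrablock_orbit\<close>), so the automorphism is the identity (\<open>fixes_royal_imp_id\<close>).

  Orbit of the origin. It remains to see that an automorphism \<open>f\<close> sends \<open>0\<close> to the royal variety. Modulo
  \<open>G\<close> we have \<open>f 0 = (0, 0, r)\<close> with \<open>0 \<le> r < 1\<close>. Suppose \<open>r > 0\<close>. The rotation
  \<open>(\<eta> x\<^sub>1, \<eta>\<^sup>-\<^sup>1 x\<^sub>2, x\<^sub>3)\<close> with \<open>\<eta>\<close> a primitive cube root of unity fixes this point, and its conjugate by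
  \<open>f\<close> fixes \<open>0\<close>, hence is known by the first part. Comparing eigenvectors, the derivative of \<open>f\<close> at \<open>0\<close>
  is monomial and keeps the third axis. The Schwarz-Pick lemma for \<open>\<Psi> \<zeta>\<close> at \<open>(0, 0, r)\<close> makes one of
  its first two entries at most \<open>1 - r\<close> in modulus. But there are discs in \<open>\<E>\<close> centred at \<open>(0, 0, r)\<close> with tangent
  \<open>(\<alpha>, 0, -2\<alpha>\<beta>)\<close>, where \<open>\<alpha>\<close> falls short of \<open>1 - r\<close> only to second order in \<open>\<beta>\<close> (\<open>probe_disc\<close>). Pulled
  back by \<open>f\<close> they violate the bound at the origin for small \<open>\<beta>\<close>, because the third entry contributes to
  first order (\<open>no_aut_to_axis\<close>).\<close>

section \<open>Holomorphic maps along discs\<close>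

lemma has_derivative_vecI:
  fixes f :: "'a::real_normed_vector \<Rightarrow> complex^'n"
  assumes "\<And>i. ((\<lambda>x. f x $ i) has_derivative (\<lambda>h. f' h $ i)) F"
  shows "(f has_derivative f') F"
proof -
  have axis: "bounded_linear (axis i :: complex \<Rightarrow> complex^'n)" for i
    by (intro linear_conv_bounded_linear[THEN iffD1] linearI)
       (auto simp: vec_eq_iff axis_def)
  have "((\<lambda>x. \<Sum>i\<in>UNIV. axis i (f x $ i)) has_derivative (\<lambda>h. \<Sum>i\<in>UNIV. axis i (f' h $ i))) F"
    by (intro has_derivative_sum bounded_linear.has_derivative[OF axis] assms)
  moreover have "(\<Sum>i\<in>UNIV. axis i (y $ i)) = y" for y :: "complex^'n"
    by (simp add: vec_eq_iff axis_def if_distrib cong: if_cong)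
  ultimately show ?thesis by simp
qed

text \<open>The scalar counterpart of \<open>holomorphic_map_on\<close>, under which rational expressions in the
  coordinates can be treated term by term.\<close>

definition holomorphic_fun_on :: "(complex^'n \<Rightarrow> complex) \<Rightarrow> (complex^'n) set \<Rightarrow> bool" where
  "holomorphic_fun_on g S \<longleftrightarrow>
     (\<forall>x\<in>S. \<exists>D. (g has_derivative D) (at x within S) \<and> (\<forall>c v. D (c *s v) = c * D v))"

lemma holomorphic_map_onI:
  assumes "\<And>i. holomorphic_fun_on (\<lambda>x. f x $ i) S"
  shows "f holomorphic_map_on S"
  unfolding holomorphic_map_on_def
proof
  fix x assume "x \<in> S"
  then have "\<forall>i. \<exists>D. ((\<lambda>x. f x $ i) has_derivative D) (at x within S) \<and> (\<forall>c v. D (c *s v) = c * D v)"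
    using assms unfolding holomorphic_fun_on_def by blast
  then obtain D where D: "\<And>i. ((\<lambda>x. f x $ i) has_derivative D i) (at x within S)"
      "\<And>i c v. D i (c *s v) = c * D i v"
    by metis
  define D' where "D' h = (\<chi> i. D i h)" for h
  have "(f has_derivative D') (at x within S)"
    by (rule has_derivative_vecI) (simp add: D'_def D(1))
  moreover have "Vector_Spaces.linear (*s) (*s) D'"
    using has_derivative_linear[OF D(1)] D(2)
    by (intro Vector_Spaces.linear_iff[THEN iffD2])
       (auto simp: D'_def vec_eq_iff linear_add vec.vector_space_axioms)
  ultimately show "\<exists>D. (f has_derivative D) (at x within S) \<and> Vector_Spaces.linear (*s) (*s) D"
    by blast
qed

lemma holomorphic_fun_on_const: "holomorphic_fun_on (\<lambda>x. c) S"
  unfolding holomorphic_fun_on_def by (auto intro!: exI[of _ "\<lambda>_. 0"])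

lemma holomorphic_fun_on_nth: "holomorphic_fun_on (\<lambda>x. x $ i) S"
  unfolding holomorphic_fun_on_def
  by (auto intro!: exI[of _ "\<lambda>x. x $ i"] bounded_linear.has_derivative[OF bounded_linear_vec_nth])

lemma holomorphic_fun_on_diff:
  assumes "holomorphic_fun_on f S" "holomorphic_fun_on g S"
  shows "holomorphic_fun_on (\<lambda>x. f x - g x) S"
  unfolding holomorphic_fun_on_def
proof
  fix x assume "x \<in> S"
  then obtain A B where "(f has_derivative A) (at x within S)" "\<And>c v. A (c *s v) = c * A v"
      "(g has_derivative B) (at x within S)" "\<And>c v. B (c *s v) = c * B v"
    using assms unfolding holomorphic_fun_on_def by metis
  then show "\<exists>D. ((\<lambda>x. f x - g x) has_derivative D) (at x within S) \<and> (\<forall>c v. D (c *s v) = c * D v)"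
    by (intro exI[of _ "\<lambda>h. A h - B h"]) (auto intro!: derivative_intros simp: algebra_simps)
qed

lemma holomorphic_fun_on_mult:
  assumes "holomorphic_fun_on f S" "holomorphic_fun_on g S"
  shows "holomorphic_fun_on (\<lambda>x. f x * g x) S"
  unfolding holomorphic_fun_on_def
proof
  fix x assume "x \<in> S"
  then obtain A B where "(f has_derivative A) (at x within S)" "\<And>c v. A (c *s v) = c * A v"
      "(g has_derivative B) (at x within S)" "\<And>c v. B (c *s v) = c * B v"
    using assms unfolding holomorphic_fun_on_def by metis
  then show "\<exists>D. ((\<lambda>x. f x * g x) has_derivative D) (at x within S) \<and> (\<forall>c v. D (c *s v) = c * D v)"
    by (intro exI[of _ "\<lambda>h. f x * B h + A h * g x"] conjI has_derivative_mult) (auto simp: algebra_simps)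
qed

lemma holomorphic_fun_on_divide:
  assumes "holomorphic_fun_on f S" "holomorphic_fun_on g S" "\<And>x. x \<in> S \<Longrightarrow> g x \<noteq> 0"
  shows "holomorphic_fun_on (\<lambda>x. f x / g x) S"
  unfolding holomorphic_fun_on_def
proof
  fix x assume x: "x \<in> S"
  then obtain A B where "(f has_derivative A) (at x within S)" "\<And>c v. A (c *s v) = c * A v"
      "(g has_derivative B) (at x within S)" "\<And>c v. B (c *s v) = c * B v"
    using assms unfolding holomorphic_fun_on_def by metis
  then show "\<exists>D. ((\<lambda>x. f x / g x) has_derivative D) (at x within S) \<and> (\<forall>c v. D (c *s v) = c * D v)"
    using assms(3)[OF x]
    by (intro exI[of _ "\<lambda>h. (A h * g x - f x * B h) / (g x * g x)"] conjI has_derivative_divide')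
       (auto simp: algebra_simps diff_divide_distrib)
qed

lemmas holomorphic_fun_on_intros =
  holomorphic_fun_on_const holomorphic_fun_on_nth holomorphic_fun_on_diff
  holomorphic_fun_on_mult holomorphic_fun_on_divide

lemma holomorphic_map_on_imp_continuous_on:
  assumes "f holomorphic_map_on S"
  shows "continuous_on S f"
  using assms has_derivative_continuous
  unfolding holomorphic_map_on_def continuous_on_eq_continuous_within by blast

text \<open>Several-variable holomorphy is used mainly through this chain rule and the next lemma: they turn
  statements about maps of \<open>\<E>\<close> into statements about functions of one complex variable.\<close>

lemma has_field_derivative_along_disc:
  fixes f :: "complex^'n \<Rightarrow> complex^'m" and \<phi> :: "complex \<Rightarrow> complex^'n"
  assumes f: "(f has_derivative D) (at (\<phi> z) within S)" and lin: "Vector_Spaces.linear (*s) (*s) D"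
    and \<phi>: "\<And>j. ((\<lambda>z. \<phi> z $ j) has_field_derivative v $ j) (at z)"
    and U: "open U" "z \<in> U" "\<And>z. z \<in> U \<Longrightarrow> \<phi> z \<in> S"
  shows "((\<lambda>z. f (\<phi> z) $ i) has_field_derivative D v $ i) (at z)"
proof -
  have "(\<phi> has_derivative (\<lambda>h. h *s v)) (at z)"
    using \<phi>[unfolded has_field_derivative_def]
    by (intro has_derivative_vecI) (simp add: mult.commute[of _ "v $ _"])
  then have "(\<phi> has_derivative (\<lambda>h. h *s v)) (at z within U)"
    by (rule has_derivative_at_withinI)
  then have "((\<lambda>z. f (\<phi> z)) has_derivative (\<lambda>h. D (h *s v))) (at z within U)"
    using U(3) has_derivative_subset[OF f, of "\<phi> ` U"]
    by (intro has_derivative_in_compose[where f = \<phi> and g = f and x = z]) blast+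
  then have "((\<lambda>z. f (\<phi> z) $ i) has_derivative (\<lambda>h. D (h *s v) $ i)) (at z)"
    unfolding at_within_open[OF U(2,1)]
    by (rule bounded_linear.has_derivative[OF bounded_linear_vec_nth])
  moreover have "(\<lambda>h. D (h *s v) $ i) = (*) (D v $ i)"
    using lin by (auto simp: Vector_Spaces.linear_iff)
  ultimately show ?thesis
    by (simp add: has_field_derivative_def)
qed

lemma holomorphic_on_along_disc:
  fixes f :: "complex^'n \<Rightarrow> complex^'m" and \<phi> :: "complex \<Rightarrow> complex^'n"
  assumes f: "f holomorphic_map_on S" and \<phi>: "\<And>j. (\<lambda>z. \<phi> z $ j) holomorphic_on U"
    and U: "open U" "\<And>z. z \<in> U \<Longrightarrow> \<phi> z \<in> S"
  shows "(\<lambda>z. f (\<phi> z) $ i) holomorphic_on U"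
  unfolding holomorphic_on_def
proof
  fix z assume z: "z \<in> U"
  obtain D where D: "(f has_derivative D) (at (\<phi> z) within S)" "Vector_Spaces.linear (*s) (*s) D"
    using f U(2)[OF z] unfolding holomorphic_map_on_def by blast
  define v where "v = (\<chi> j. deriv (\<lambda>z. \<phi> z $ j) z)"
  have "((\<lambda>z. f (\<phi> z) $ i) has_field_derivative D v $ i) (at z)"
    using U z
    by (intro has_field_derivative_along_disc[where \<phi> = \<phi> and U = U, OF D])
       (auto simp: v_def intro!: holomorphic_derivI[OF \<phi>])
  then show "(\<lambda>z. f (\<phi> z) $ i) field_differentiable at z within U"
    using field_differentiable_at_within field_differentiable_def by blast
qed

section \<open>The tetrablock\<close>

abbreviation tri :: "complex \<Rightarrow> complex \<Rightarrow> complex \<Rightarrow> complex^3" where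
  "tri a b c \<equiv> vector [a, b, c]"

text \<open>For fixed \<open>w\<close> the defining expression is affine in the first variable, and \<open>P - z Q\<close> has no
  zero in the closed disc exactly when \<open>|Q| < |P|\<close>.\<close>

lemma tetrablock_iff:
  "x \<in> \<E> \<longleftrightarrow> (\<forall>w. norm w \<le> 1 \<longrightarrow> norm (x$1 - x$3 * w) < norm (1 - x$2 * w))"
proof (intro iffI allI impI)
  fix w :: complex assume x: "x \<in> \<E>" and w: "norm w \<le> 1"
  show "norm (x$1 - x$3 * w) < norm (1 - x$2 * w)"
  proof (rule ccontr)
    assume *: "\<not> ?thesis"
    define z where "z = (1 - x$2 * w) / (x$1 - x$3 * w)"
    have n0: "x$1 - x$3 * w \<noteq> 0"
    proof
      assume "x$1 - x$3 * w = 0"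
      with * have "1 - x$2 * w = 0" by simp
      then have "1 - x$1 * 0 - x$2 * w + x$3 * 0 * w = 0" by simp
      moreover have "1 - x$1 * 0 - x$2 * w + x$3 * 0 * w \<noteq> 0"
        using x[unfolded tetrablock_def mem_Collect_eq, THEN spec[of _ 0], THEN spec[of _ w]] w by simp
      ultimately show False by blast
    qed
    have z: "norm z \<le> 1" using * n0 by (simp add: z_def norm_divide)
    have "1 - x$1 * z - x$2 * w + x$3 * z * w = (1 - x$2 * w) - z * (x$1 - x$3 * w)"
      by (simp add: algebra_simps)
    also have "\<dots> = 0" using n0 by (simp add: z_def)
    finally show False
      using x[unfolded tetrablock_def mem_Collect_eq, THEN spec[of _ z], THEN spec[of _ w]] z w by simp
  qed
next
  assume *: "\<forall>w. norm w \<le> 1 \<longrightarrow> norm (x$1 - x$3 * w) < norm (1 - x$2 * w)"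
  show "x \<in> \<E>" unfolding tetrablock_def
  proof (intro CollectI allI impI notI)
    fix z w :: complex
    assume z: "norm z \<le> 1" and w: "norm w \<le> 1"
      and "1 - x$1 * z - x$2 * w + x$3 * z * w = 0"
    then have "1 - x$2 * w = z * (x$1 - x$3 * w)" by (simp add: algebra_simps)
    then have "norm (1 - x$2 * w) = norm z * norm (x$1 - x$3 * w)" by (simp add: norm_mult)
    also have "\<dots> \<le> norm (x$1 - x$3 * w)" using z by (simp add: mult_left_le_one_le)
    finally show False using * w by force
  qed
qed

lemma tetrablock_swap: "tri (x$2) (x$1) (x$3) \<in> \<E> \<longleftrightarrow> x \<in> \<E>"
proof -
  have "1 - x$2 * z - x$1 * w + x$3 * z * w = 1 - x$1 * w - x$2 * z + x$3 * w * z" for z w :: complex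
    by (simp add: algebra_simps)
  then show ?thesis unfolding tetrablock_def mem_Collect_eq vector_3 by metis
qed

lemma tetrablock_iff_swapped:
  "x \<in> \<E> \<longleftrightarrow> (\<forall>w. norm w \<le> 1 \<longrightarrow> norm (x$2 - x$3 * w) < norm (1 - x$1 * w))"
  using tetrablock_iff[of "tri (x$2) (x$1) (x$3)"] by (simp add: tetrablock_swap)

lemma zero_in_tetrablock: "0 \<in> \<E>"
  by (simp add: tetrablock_iff)

lemma norm_diff_square:
  fixes u v :: complex
  shows "(norm (u - v))\<^sup>2 = (norm u)\<^sup>2 + (norm v)\<^sup>2 - 2 * Re (u * cnj v)"
  unfolding cmod_power2 by (simp add: power2_eq_square algebra_simps)

text \<open>This is \<open>tetrablock_iff\<close> squared, at the point \<open>w\<close> of the unit circle where the mixed term is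
  worst.\<close>

lemma tetrablock_inequality:
  assumes "x \<in> \<E>"
  shows "2 * norm (x$2 - cnj (x$1) * x$3) < 1 + (norm (x$2))\<^sup>2 - (norm (x$1))\<^sup>2 - (norm (x$3))\<^sup>2"
proof -
  define k where "k = x$2 - cnj (x$1) * x$3"
  \<comment> \<open>The point of the circle at which \<open>Re (k * w)\<close> is as large as possible.\<close>
  define w where "w = (if k = 0 then 1 else cnj (sgn k))"
  have w: "norm w = 1" by (simp add: w_def norm_sgn)
  have kw: "k * w = of_real (norm k)"
  proof (cases "k = 0")
    case False
    then have "k * cnj (sgn k) = of_real ((norm k)\<^sup>2) / of_real (norm k)"
      by (simp add: sgn_eq) (simp only: complex_norm_square flip: of_real_power)
    also have "\<dots> = of_real (norm k)"
      using False by (simp add: power2_eq_square)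
    finally show ?thesis using False by (simp add: w_def)
  qed simp
  have "norm (x$1 - x$3 * w) < norm (1 - x$2 * w)"
    using assms w by (simp add: tetrablock_iff)
  then have "(norm (x$1 - x$3 * w))\<^sup>2 < (norm (1 - x$2 * w))\<^sup>2"
    by (intro power_strict_mono) auto
  then have "(norm (x$1))\<^sup>2 + (norm (x$3))\<^sup>2 - 2 * Re (x$1 * cnj (x$3 * w))
      < 1 + (norm (x$2))\<^sup>2 - 2 * Re (cnj (x$2 * w))"
    unfolding norm_diff_square using w by (simp add: norm_mult power_mult_distrib)
  moreover have "Re (x$1 * cnj (x$3 * w)) = Re (cnj (x$1) * x$3 * w)"
    by (simp add: algebra_simps)
  moreover have "Re (x$2 * w) - Re (cnj (x$1) * x$3 * w) = Re (k * w)"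
    by (simp add: k_def algebra_simps)
  ultimately show ?thesis
    unfolding kw by (simp add: k_def)
qed

lemma tetrablock_inequality_swapped:
  assumes "x \<in> \<E>"
  shows "2 * norm (x$1 - cnj (x$2) * x$3) < 1 + (norm (x$1))\<^sup>2 - (norm (x$2))\<^sup>2 - (norm (x$3))\<^sup>2"
  using tetrablock_inequality[of "tri (x$2) (x$1) (x$3)"] assms by (simp add: tetrablock_swap)

lemma tetrablock_norm_less:
  assumes x: "x \<in> \<E>"
  shows "norm (x$1) < 1" "norm (x$2) < 1" "norm (x$3) < 1"
proof -
  show "norm (x$1) < 1" "norm (x$2) < 1"
    using x tetrablock_iff[of x] tetrablock_iff_swapped[of x] by (auto dest: spec[of _ 0])
  have "(norm (x$3))\<^sup>2 < 1"
    using tetrablock_inequality[OF x] tetrablock_inequality_swapped[OF x]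
      norm_ge_zero[of "x$2 - cnj (x$1) * x$3"] norm_ge_zero[of "x$1 - cnj (x$2) * x$3"] by linarith
  then show "norm (x$3) < 1"
    by (simp add: power2_less_1_iff abs_square_less_1)
qed

lemma one_minus_mult_nonzero:
  fixes a b :: complex
  assumes "norm a \<le> 1" "norm b < 1"
  shows "1 - a * b \<noteq> 0"
proof
  assume "1 - a * b = 0"
  then have "norm a * norm b = 1" by (simp flip: norm_mult)
  moreover have "norm a * norm b \<le> norm b" using assms by (simp add: mult_left_le_one_le)
  ultimately show False using assms by simp
qed

text \<open>A disc automorphism, written homogeneously: \<open>|Q/P| < 1\<close> implies that the Moebius image of
  \<open>Q/P\<close> has modulus less than \<open>1\<close>.\<close>

lemma norm_blaschke_less:
  fixes P Q a :: complex
  assumes "norm Q < norm P" "norm a < 1"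
  shows "norm (a * P - Q) < norm (P - cnj a * Q)"
proof -
  have "(norm (P - cnj a * Q))\<^sup>2 - (norm (a * P - Q))\<^sup>2
      = (1 - (norm a)\<^sup>2) * ((norm P)\<^sup>2 - (norm Q)\<^sup>2)"
    unfolding cmod_power2 by (simp add: power2_eq_square algebra_simps)
  moreover have "(1 - (norm a)\<^sup>2) * ((norm P)\<^sup>2 - (norm Q)\<^sup>2) > 0"
    using assms by (intro mult_pos_pos) (auto simp: power_strict_mono abs_square_less_1)
  ultimately have "(norm (a * P - Q))\<^sup>2 < (norm (P - cnj a * Q))\<^sup>2" by linarith
  then show ?thesis by (rule power2_less_imp_less) simp
qed

lemma royal_in_tetrablock:
  assumes "norm a < 1" "norm b < 1"
  shows "tri a b (a * b) \<in> \<E>"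
  unfolding tetrablock_iff
proof (intro allI impI)
  fix w :: complex assume w: "norm w \<le> 1"
  have "norm (1 - b * w) > 0"
    using one_minus_mult_nonzero[OF w assms(2)] by (simp add: mult.commute)
  then have "norm a * norm (1 - b * w) < 1 * norm (1 - b * w)"
    using assms(1) by (intro mult_strict_right_mono)
  then show "norm (tri a b (a * b) $ 1 - tri a b (a * b) $ 3 * w) < norm (1 - tri a b (a * b) $ 2 * w)"
    by (simp flip: norm_mult add: algebra_simps)
qed

lemma axis_in_tetrablock:
  assumes "norm a + norm c < 1"
  shows "tri a 0 c \<in> \<E>"
  unfolding tetrablock_iff
proof (intro allI impI)
  fix w :: complex assume w: "norm w \<le> 1"
  have "norm (a - c * w) \<le> norm a + norm c * norm w"
    by (metis norm_mult norm_triangle_ineq4)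
  also have "\<dots> \<le> norm a + norm c" using w by (simp add: mult_left_le)
  finally show "norm (tri a 0 c $ 1 - tri a 0 c $ 3 * w) < norm (1 - tri a 0 c $ 2 * w)"
    using assms by simp
qed

section \<open>Automorphisms of the tetrablock\<close>

text \<open>A pair of mutually inverse automorphisms. Values outside \<open>\<E>\<close> are left free, in contrast
  to \<open>Aut\<close>, so that products are plain compositions.\<close>

definition tetra_aut :: "(complex^3 \<Rightarrow> complex^3) \<Rightarrow> (complex^3 \<Rightarrow> complex^3) \<Rightarrow> bool" where
  "tetra_aut f g \<longleftrightarrow> f holomorphic_map_on \<E> \<and> g holomorphic_map_on \<E> \<and>
     (\<forall>x\<in>\<E>. f x \<in> \<E> \<and> g x \<in> \<E> \<and> g (f x) = x \<and> f (g x) = x)"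

lemma tetra_autD:
  assumes "tetra_aut f g"
  shows "f holomorphic_map_on \<E>" "g holomorphic_map_on \<E>"
    "x \<in> \<E> \<Longrightarrow> f x \<in> \<E>" "x \<in> \<E> \<Longrightarrow> g x \<in> \<E>"
    "x \<in> \<E> \<Longrightarrow> g (f x) = x" "x \<in> \<E> \<Longrightarrow> f (g x) = x"
  using assms unfolding tetra_aut_def by auto

lemma tetra_aut_sym: "tetra_aut f g \<Longrightarrow> tetra_aut g f"
  unfolding tetra_aut_def by auto

lemma holomorphic_map_on_comp:
  assumes "f holomorphic_map_on S" "g holomorphic_map_on T" "f ` S \<subseteq> T"
  shows "(g \<circ> f) holomorphic_map_on S"
  by (rule holomorphic_map_on_cong[OF holomorphic_map_on_compose[OF assms]])
     (simp add: compose_def)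

lemma tetra_aut_comp:
  assumes f: "tetra_aut f f'" and g: "tetra_aut g g'"
  shows "tetra_aut (f \<circ> g) (g' \<circ> f')"
proof -
  have "(f \<circ> g) holomorphic_map_on \<E>" "(g' \<circ> f') holomorphic_map_on \<E>"
    using tetra_autD[OF f] tetra_autD[OF g]
    by (auto intro!: holomorphic_map_on_comp[where T = \<E>])
  then show ?thesis
    using tetra_autD[OF f] tetra_autD[OF g] by (simp add: tetra_aut_def)
qed

lemma tetra_aut_involution:
  assumes "f holomorphic_map_on \<E>" "\<And>x. x \<in> \<E> \<Longrightarrow> f x \<in> \<E>" "\<And>x. x \<in> \<E> \<Longrightarrow> f (f x) = x"
  shows "tetra_aut f f"
  using assms by (simp add: tetra_aut_def)

definition swap12 :: "complex^3 \<Rightarrow> complex^3" where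
  "swap12 x = tri (x$2) (x$1) (x$3)"

definition rot :: "complex \<Rightarrow> complex \<Rightarrow> complex^3 \<Rightarrow> complex^3" where
  "rot u v x = tri (u * x$1) (v * x$2) (u * v * x$3)"

text \<open>The left action of the disc involution \<open>z \<mapsto> (a - z) / (1 - cnj a * z)\<close>; every left action is
  some \<open>mob a\<close> followed by a rotation. Choosing the involution makes \<open>mob a\<close> its own inverse.\<close>

definition mob :: "complex \<Rightarrow> complex^3 \<Rightarrow> complex^3" where
  "mob a x = tri ((a - x$1) / (1 - cnj a * x$1)) ((x$2 - cnj a * x$3) / (1 - cnj a * x$1))
     ((a * x$2 - x$3) / (1 - cnj a * x$1))"

text \<open>The right action corresponds to the left one under the flip.\<close>

definition mob2 :: "complex \<Rightarrow> complex^3 \<Rightarrow> complex^3" where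
  "mob2 b = swap12 \<circ> mob b \<circ> swap12"

lemma holomorphic_map_on_tri:
  assumes "holomorphic_fun_on f S" "holomorphic_fun_on g S" "holomorphic_fun_on h S"
  shows "(\<lambda>x. tri (f x) (g x) (h x)) holomorphic_map_on S"
proof (rule holomorphic_map_onI)
  fix i :: 3
  show "holomorphic_fun_on (\<lambda>x. tri (f x) (g x) (h x) $ i) S"
    using exhaust_3[of i] assms by auto
qed

lemma tri_eq_iff: "x = tri a b c \<longleftrightarrow> x$1 = a \<and> x$2 = b \<and> x$3 = c"
  by (auto simp: vec_eq_iff forall_3)

lemma tetra_aut_swap12: "tetra_aut swap12 swap12"
  unfolding swap12_def
  by (rule tetra_aut_involution)
     (auto simp: tetrablock_swap vec_eq_iff forall_3 intro!: holomorphic_map_on_tri holomorphic_fun_on_intros)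

lemma rot_in_tetrablock:
  assumes "norm u = 1" "norm v = 1" "x \<in> \<E>"
  shows "rot u v x \<in> \<E>"
  unfolding tetrablock_iff
proof (intro allI impI)
  fix w :: complex assume "norm w \<le> 1"
  then have "norm (x$1 - x$3 * (v * w)) < norm (1 - x$2 * (v * w))"
    using assms unfolding tetrablock_iff by (simp add: norm_mult)
  moreover have "norm (x$1 - x$3 * (v * w)) = norm (u * (x$1 - x$3 * (v * w)))"
    using assms by (simp add: norm_mult)
  ultimately show "norm (rot u v x $ 1 - rot u v x $ 3 * w) < norm (1 - rot u v x $ 2 * w)"
    by (simp add: rot_def algebra_simps)
qed

lemma rot_cancel:
  assumes "norm u = 1" "norm v = 1"
  shows "rot u v (rot (cnj u) (cnj v) x) = x" "rot (cnj u) (cnj v) (rot u v x) = x"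
proof -
  have 1: "u * cnj u = 1" "v * cnj v = 1"
    using assms complex_norm_square[of u] complex_norm_square[of v] by auto
  have "rot (cnj u) (cnj v) (rot u v x) = tri (u * cnj u * x$1) (v * cnj v * x$2) ((u * cnj u) * (v * cnj v) * x$3)"
    "rot u v (rot (cnj u) (cnj v) x) = tri (u * cnj u * x$1) (v * cnj v * x$2) ((u * cnj u) * (v * cnj v) * x$3)"
    by (simp_all add: rot_def ac_simps)
  then show "rot u v (rot (cnj u) (cnj v) x) = x" "rot (cnj u) (cnj v) (rot u v x) = x"
    unfolding 1 by (simp_all add: vec_eq_iff forall_3)
qed

lemma tetra_aut_rot:
  assumes "norm u = 1" "norm v = 1"
  shows "tetra_aut (rot u v) (rot (cnj u) (cnj v))"
proof -
  have "rot a b holomorphic_map_on \<E>" for a b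
    unfolding rot_def by (intro holomorphic_map_on_tri holomorphic_fun_on_intros)
  then show ?thesis
    using assms by (simp add: tetra_aut_def rot_in_tetrablock rot_cancel)
qed

lemma mob_denom: "norm a < 1 \<Longrightarrow> x \<in> \<E> \<Longrightarrow> 1 - cnj a * x$1 \<noteq> 0"
  using one_minus_mult_nonzero[of "cnj a" "x$1"] tetrablock_norm_less(1)[of x] by simp

text \<open>In the form \<open>|Q| < |P|\<close> of \<open>tetrablock_iff\<close>, the map \<open>mob a\<close> applies a disc automorphism to
  \<open>Q/P\<close>.\<close>

lemma mob_in_tetrablock:
  assumes a: "norm a < 1" and x: "x \<in> \<E>"
  shows "mob a x \<in> \<E>"
  unfolding tetrablock_iff
proof (intro allI impI)
  fix w :: complex assume w: "norm w \<le> 1"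
  define P Q d where "P = 1 - x$2 * w" and "Q = x$1 - x$3 * w" and "d = 1 - cnj a * x$1"
  have d: "d \<noteq> 0" using mob_denom[OF a x] by (simp add: d_def)
  have "norm Q < norm P" using x w unfolding tetrablock_iff P_def Q_def by blast
  then have "norm (a * P - Q) < norm (P - cnj a * Q)" by (rule norm_blaschke_less[OF _ a])
  then have "norm ((a * P - Q) / d) < norm ((P - cnj a * Q) / d)"
    using d by (simp add: norm_divide divide_strict_right_mono)
  moreover have "(a * P - Q) / d = (a - x$1) / d - (a * x$2 - x$3) / d * w"
    using d by (simp add: P_def Q_def field_simps)
  moreover have "(P - cnj a * Q) / d = 1 - (x$2 - cnj a * x$3) / d * w"
    using d by (simp add: field_simps) (simp add: P_def Q_def d_def algebra_simps)
  ultimately show "norm (mob a x $ 1 - mob a x $ 3 * w) < norm (1 - mob a x $ 2 * w)"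
    by (simp add: mob_def d_def)
qed

lemma mob_mob:
  assumes a: "norm a < 1" and x: "x \<in> \<E>"
  shows "mob a (mob a x) = x"
proof -
  define d where "d = 1 - cnj a * x$1"
  define e where "e = 1 - cnj a * a"
  have d: "d \<noteq> 0" using mob_denom[OF a x] by (simp add: d_def)
  have e: "e \<noteq> 0" unfolding e_def using a by (intro one_minus_mult_nonzero) auto
  define y where "y = mob a x"
  have y: "y$1 = (a - x$1) / d" "y$2 = (x$2 - cnj a * x$3) / d" "y$3 = (a * x$2 - x$3) / d"
    by (simp_all add: y_def mob_def d_def)
  have 0: "1 - cnj a * y$1 = e / d"
    using d by (simp add: y field_simps) (simp add: d_def e_def algebra_simps)
  have 1: "a - y$1 = e * x$1 / d"
    using d by (simp add: y field_simps) (simp add: d_def e_def algebra_simps)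
  have 2: "y$2 - cnj a * y$3 = e * x$2 / d"
    using d by (simp add: y field_simps) (simp add: d_def e_def algebra_simps)
  have 3: "a * y$2 - y$3 = e * x$3 / d"
    using d by (simp add: y field_simps) (simp add: d_def e_def algebra_simps)
  have "mob a y = x"
    unfolding mob_def 0 1 2 3 using d e by (simp add: vec_eq_iff forall_3)
  then show ?thesis by (simp add: y_def)
qed

lemma tetra_aut_mob:
  assumes "norm a < 1"
  shows "tetra_aut (mob a) (mob a)"
proof (rule tetra_aut_involution)
  show "mob a holomorphic_map_on \<E>"
    unfolding mob_def using mob_denom[OF assms]
    by (intro holomorphic_map_on_tri holomorphic_fun_on_intros)
qed (use assms mob_in_tetrablock mob_mob in auto)

lemma tetra_aut_mob2:
  assumes "norm b < 1"
  shows "tetra_aut (mob2 b) (mob2 b)"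
  using tetra_aut_comp[OF tetra_aut_comp[OF tetra_aut_swap12 tetra_aut_mob[OF assms]] tetra_aut_swap12]
  by (simp add: mob2_def comp_assoc)

lemma mob2_eq:
  "mob2 b x = tri ((x$1 - cnj b * x$3) / (1 - cnj b * x$2)) ((b - x$2) / (1 - cnj b * x$2))
     ((b * x$1 - x$3) / (1 - cnj b * x$2))"
  by (simp add: mob2_def mob_def swap12_def)

lemma mob_royal:
  assumes "norm a < 1" "norm p < 1"
  shows "mob a (tri p q (p * q)) = tri ((a - p) / (1 - cnj a * p)) q ((a - p) / (1 - cnj a * p) * q)"
  using one_minus_mult_nonzero[of "cnj a" p] assms
  by (simp add: mob_def field_simps tri_eq_iff)

lemma quadratic_root:
  fixes s t :: real
  assumes "0 < t" "2 * t < s"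
  obtains \<rho> where "0 < \<rho>" "\<rho> < 1" "t * \<rho>\<^sup>2 + t = s * \<rho>"
proof -
  define h where "h \<rho> = t * \<rho>\<^sup>2 - s * \<rho> + t" for \<rho>
  have "\<exists>\<rho>\<ge>0. \<rho> \<le> 1 \<and> h \<rho> = 0"
    using assms by (intro IVT2) (auto simp: h_def intro!: continuous_intros isCont_diff isCont_add)
  then obtain \<rho> where \<rho>: "0 \<le> \<rho>" "\<rho> \<le> 1" "h \<rho> = 0" by blast
  moreover have "\<rho> \<noteq> 0" "\<rho> \<noteq> 1" using \<rho>(3) assms by (auto simp: h_def)
  ultimately show ?thesis using that[of \<rho>] by (auto simp: h_def)
qed

text \<open>The points \<open>mob2 b (0, 0, w)\<close> are exactly those with \<open>y\<^sub>1 = cnj y\<^sub>2 * y\<^sub>3\<close>. For \<open>y = mob a x\<close> this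
  condition is a quadratic equation in \<open>a\<close> whose two roots have product of modulus \<open>1\<close>, and
  \<open>tetrablock_inequality_swapped\<close> says that one of them lies inside the disc.\<close>

lemma tetrablock_orbit:
  assumes x: "x \<in> \<E>"
  obtains a b w where "norm a < 1" "norm b < 1" "norm w < 1" "x = mob a (mob2 b (tri 0 0 w))"
proof -
  define k where "k = x$1 - cnj (x$2) * x$3"
  define s where "s = 1 + (norm (x$1))\<^sup>2 - (norm (x$2))\<^sup>2 - (norm (x$3))\<^sup>2"
  have s: "2 * norm k < s"
    using tetrablock_inequality_swapped[OF x] by (simp add: k_def s_def)
  obtain a where a: "norm a < 1" "cnj k * a\<^sup>2 + k = of_real s * a"
  proof (cases "k = 0")
    case True then show ?thesis using that[of 0] by simp
  next
    case False
    then obtain \<rho> where \<rho>: "0 < \<rho>" "\<rho> < 1" "norm k * \<rho>\<^sup>2 + norm k = s * \<rho>"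
      using quadratic_root[OF _ s] by auto
    have "cnj k * k = (of_real (norm k))\<^sup>2"
      by (simp only: complex_norm_square mult.commute flip: of_real_power)
    then have "cnj k * (k / of_real (norm k) * of_real \<rho>)\<^sup>2 + k
        = k / of_real (norm k) * of_real (norm k * \<rho>\<^sup>2 + norm k)"
      using False by (simp add: field_simps power2_eq_square)
    also have "\<dots> = of_real s * (k / of_real (norm k) * of_real \<rho>)"
      unfolding \<rho>(3) by simp
    finally show ?thesis
      using that[of "k / of_real (norm k) * of_real \<rho>"] \<rho> False by (simp add: norm_mult norm_divide)
  qed
  define y where "y = mob a x"
  have yE: "y \<in> \<E>" using mob_in_tetrablock[OF a(1) x] by (simp add: y_def)
  define d where "d = 1 - cnj a * x$1"
  have d: "d \<noteq> 0" using mob_denom[OF a(1) x] by (simp add: d_def)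
  have sc: "of_real s = 1 + x$1 * cnj (x$1) - x$2 * cnj (x$2) - x$3 * cnj (x$3)"
    unfolding s_def by (simp only: of_real_add of_real_diff of_real_1 complex_norm_square)
  have "(a - x$1) * cnj d = cnj (x$2 - cnj a * x$3) * (a * x$2 - x$3)"
    using a(2) unfolding sc by (simp add: k_def d_def power2_eq_square algebra_simps)
  then have "(a - x$1) * cnj d / (d * cnj d) = cnj (x$2 - cnj a * x$3) * (a * x$2 - x$3) / (d * cnj d)"
    by (simp only:)
  then have "(a - x$1) / d = cnj ((x$2 - cnj a * x$3) / d) * ((a * x$2 - x$3) / d)"
    using d by (simp only: complex_cnj_divide times_divide_times_eq) (simp add: mult.commute)
  then have "y$1 = cnj (y$2) * y$3"
    by (simp only: y_def mob_def vector_3 d_def)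
  define b w where "b = y$2" and "w = - y$3"
  have b: "norm b < 1" and w: "norm w < 1"
    using tetrablock_norm_less[OF yE] by (simp_all add: b_def w_def)
  have "mob2 b (tri 0 0 w) = y"
    using \<open>y$1 = cnj (y$2) * y$3\<close> by (simp add: mob2_eq b_def w_def vec_eq_iff forall_3)
  then have "x = mob a (mob2 b (tri 0 0 w))"
    using mob_mob[OF a(1) x] by (simp add: y_def)
  then show ?thesis using that a(1) b w by blast
qed

section \<open>Schwarz lemma for discs in the tetrablock\<close>

definition analytic_disc :: "(complex \<Rightarrow> complex^3) \<Rightarrow> bool" where
  "analytic_disc \<phi> \<longleftrightarrow> (\<forall>j. (\<lambda>z. \<phi> z $ j) holomorphic_on \<DD>) \<and> (\<forall>z\<in>\<DD>. \<phi> z \<in> \<E>)"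

definition disc_tangent :: "(complex \<Rightarrow> complex^3) \<Rightarrow> complex^3 \<Rightarrow> bool" where
  "disc_tangent \<phi> v \<longleftrightarrow> (\<forall>j. ((\<lambda>z. \<phi> z $ j) has_field_derivative v $ j) (at 0))"

lemma analytic_disc_map:
  assumes "analytic_disc \<phi>" "f holomorphic_map_on \<E>" "\<And>x. x \<in> \<E> \<Longrightarrow> f x \<in> \<E>"
  shows "analytic_disc (\<lambda>z. f (\<phi> z))"
  unfolding analytic_disc_def
proof (intro conjI allI ballI)
  fix j
  show "(\<lambda>z. f (\<phi> z) $ j) holomorphic_on \<DD>"
    by (rule holomorphic_on_along_disc[where S = \<E> and \<phi> = \<phi> and U = \<DD> and f = f])
       (use assms in \<open>auto simp: analytic_disc_def\<close>)
qed (use assms in \<open>auto simp: analytic_disc_def\<close>)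

lemma disc_tangent_map:
  assumes \<phi>: "analytic_disc \<phi>" "disc_tangent \<phi> v"
    and D: "(f has_derivative D) (at (\<phi> 0) within \<E>)" "Vector_Spaces.linear (*s) (*s) D"
  shows "disc_tangent (\<lambda>z. f (\<phi> z)) (D v)"
  unfolding disc_tangent_def
proof
  fix i
  show "((\<lambda>z. f (\<phi> z) $ i) has_field_derivative D v $ i) (at 0)"
  proof (rule has_field_derivative_along_disc[where f = f and S = \<E> and \<phi> = \<phi> and U = \<DD> and z = 0 and D = D])
    show "((\<lambda>z. \<phi> z $ j) has_field_derivative v $ j) (at 0)" for j
      using \<phi>(2) by (simp add: disc_tangent_def)
    show "\<phi> z \<in> \<E>" if "z \<in> \<DD>" for z
      using \<phi>(1) that by (simp add: analytic_disc_def)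
  qed (use D in auto)
qed

lemma disc_tangent_unique:
  assumes "disc_tangent \<phi> v" "disc_tangent \<psi> w" "\<And>z. z \<in> \<DD> \<Longrightarrow> \<phi> z = \<psi> z"
  shows "v = w"
proof -
  have "v $ j = w $ j" for j
  proof (rule DERIV_unique)
    show "((\<lambda>z. \<phi> z $ j) has_field_derivative v $ j) (at 0)"
      using assms(1) by (simp add: disc_tangent_def)
    have "((\<lambda>z. \<psi> z $ j) has_field_derivative w $ j) (at 0)"
      using assms(2) by (simp add: disc_tangent_def)
    then show "((\<lambda>z. \<phi> z $ j) has_field_derivative w $ j) (at 0)"
      by (rule has_field_derivative_transform_within_open[where S = \<DD>]) (use assms(3) in auto)
  qed
  then show ?thesis by (simp add: vec_eq_iff)
qed

lemma Psi_norm_less: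
  assumes "x \<in> \<E>" "norm \<zeta> \<le> 1"
  shows "norm (\<Psi> \<zeta> x) < 1" "x$2 * \<zeta> - 1 \<noteq> 0"
proof -
  have *: "norm (x$1 - x$3 * \<zeta>) < norm (1 - x$2 * \<zeta>)"
    using assms tetrablock_iff by blast
  then show "x$2 * \<zeta> - 1 \<noteq> 0" by auto
  then show "norm (\<Psi> \<zeta> x) < 1"
    using * by (simp add: Psi_def norm_divide norm_minus_commute)
qed

lemma Psi_along_disc:
  assumes "analytic_disc \<phi>" "norm \<zeta> \<le> 1"
  shows "(\<lambda>z. \<Psi> \<zeta> (\<phi> z)) holomorphic_on \<DD>"
  using assms Psi_norm_less(2)[OF _ assms(2)] unfolding analytic_disc_def Psi_def
  by (auto intro!: holomorphic_intros)

text \<open>Computed at a point of the axis, where all discs to be tested are centred.\<close>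

lemma Psi_derivative:
  assumes "disc_tangent \<phi> v" "\<phi> 0 = tri 0 0 r"
  shows "((\<lambda>z. \<Psi> \<zeta> (\<phi> z)) has_field_derivative (v$1 - \<zeta> * v$3 - r * \<zeta>\<^sup>2 * v$2)) (at 0)"
  using assms unfolding disc_tangent_def Psi_def
  by (auto intro!: derivative_eq_intros simp: power2_eq_square algebra_simps)

text \<open>Composing with the involution that sends \<open>h 0\<close> to \<open>0\<close> reduces this to the Schwarz lemma.\<close>

lemma Schwarz_Pick_derivative:
  assumes h: "h holomorphic_on \<DD>" "\<And>z. z \<in> \<DD> \<Longrightarrow> norm (h z) < 1"
    and d: "(h has_field_derivative d) (at 0)"
  shows "norm d \<le> 1 - (norm (h 0))\<^sup>2"
proof -
  define c where "c = h 0"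
  define g where "g z = (c - h z) / (1 - cnj c * h z)" for z
  have c: "norm c < 1" using h(2)[of 0] by (simp add: c_def)
  have den: "1 - cnj c * h z \<noteq> 0" if "z \<in> \<DD>" for z
    using one_minus_mult_nonzero[of "cnj c" "h z"] c h(2)[OF that] by simp
  have g: "g holomorphic_on \<DD>" "norm (g z) < 1" if "norm z < 1" for z
  proof -
    show "g holomorphic_on \<DD>"
      unfolding g_def using den by (intro holomorphic_intros h)
    show "norm (g z) < 1"
      using norm_blaschke_less[of "h z" 1 c] c h(2)[of z] that den[of z]
      by (simp add: g_def norm_divide)
  qed
  have cc: "1 - cnj c * c = of_real (1 - (norm c)\<^sup>2)"
    by (simp only: of_real_diff of_real_1 complex_norm_square mult.commute)
  have pos: "1 - (norm c)\<^sup>2 > 0" using c by (simp add: abs_square_less_1)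
  have "(g has_field_derivative - d / (1 - cnj c * c)) (at 0)"
    unfolding g_def using d den[of 0]
    by (auto intro!: derivative_eq_intros simp: c_def divide_simps)
  then have "deriv g 0 = - d / (1 - cnj c * c)" by (rule DERIV_imp_deriv)
  moreover have "norm (deriv g 0) \<le> 1"
    using g(1)[of 0] g(2) by (intro Schwarz_Lemma(2)[of g 0]) (auto simp: g_def c_def)
  ultimately have "norm d / norm (1 - cnj c * c) \<le> 1"
    by (simp only: norm_divide norm_minus_cancel)
  moreover have "norm (1 - cnj c * c) = 1 - (norm c)\<^sup>2"
    unfolding cc norm_of_real using pos by simp
  ultimately have "norm d / (1 - (norm c)\<^sup>2) \<le> 1" by simp
  then show ?thesis using pos by (simp add: c_def)
qed

lemma disc_tangent_bound:
  assumes "analytic_disc \<phi>" "disc_tangent \<phi> v" "\<phi> 0 = tri 0 0 r" "norm \<zeta> = 1"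
  shows "norm (v$1 - \<zeta> * v$3 - r * \<zeta>\<^sup>2 * v$2) \<le> 1 - (norm r)\<^sup>2"
proof -
  have "norm (\<Psi> \<zeta> (\<phi> 0)) = norm r"
    using assms by (simp add: Psi_def norm_mult)
  moreover have "norm (\<Psi> \<zeta> (\<phi> z)) < 1" if "z \<in> \<DD>" for z
    using assms that by (intro Psi_norm_less) (auto simp: analytic_disc_def)
  ultimately show ?thesis
    using Schwarz_Pick_derivative[OF Psi_along_disc[OF assms(1)] _ Psi_derivative[OF assms(2,3)], of \<zeta>] assms(4)
    by simp
qed

lemma analytic_disc_swap:
  assumes "analytic_disc \<phi>"
  shows "analytic_disc (\<lambda>z. swap12 (\<phi> z))"
  using assms tetra_autD[OF tetra_aut_swap12] by (intro analytic_disc_map[of \<phi> swap12])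

lemma disc_tangent_swap:
  assumes "disc_tangent \<phi> v"
  shows "disc_tangent (\<lambda>z. swap12 (\<phi> z)) (swap12 v)"
  using assms by (auto simp: disc_tangent_def swap12_def forall_3)

lemma disc_tangent_bound_swapped:
  assumes "analytic_disc \<phi>" "disc_tangent \<phi> v" "\<phi> 0 = tri 0 0 r" "norm \<zeta> = 1"
  shows "norm (v$2 - \<zeta> * v$3 - r * \<zeta>\<^sup>2 * v$1) \<le> 1 - (norm r)\<^sup>2"
  using disc_tangent_bound[OF analytic_disc_swap[OF assms(1)] disc_tangent_swap[OF assms(2)], of r \<zeta>] assms
  by (simp add: swap12_def)

lemma aligned_phase:
  fixes a b :: complex
  obtains \<zeta> where "norm \<zeta> = 1" "norm (a - \<zeta> * b) = norm a + norm b"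
proof -
  define s where "s c = (if c = 0 then 1 else sgn c)" for c :: complex
  have s: "norm (s c) = 1" "of_real (norm c) * s c = c" for c
    by (simp add: s_def norm_sgn) (simp add: s_def sgn_eq)
  have t: "cnj (s b) * s b = 1"
    using s(1)[of b] complex_norm_square[of "s b"] by (simp add: mult.commute)
  have "a - (- s a * cnj (s b)) * b
      = of_real (norm a) * s a + s a * (cnj (s b) * (of_real (norm b) * s b))"
    unfolding s(2) by simp
  also have "\<dots> = of_real (norm a) * s a + s a * (of_real (norm b) * (cnj (s b) * s b))"
    by (simp only: mult.left_commute)
  also have "\<dots> = of_real (norm a + norm b) * s a"
    unfolding t by (simp add: algebra_simps)
  finally have "norm (a - (- s a * cnj (s b)) * b) = norm (of_real (norm a + norm b) * s a)"
    by (rule arg_cong)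
  then have "norm (a - (- s a * cnj (s b)) * b) = norm a + norm b"
    unfolding norm_mult norm_of_real s(1) by simp
  then show ?thesis using that[of "- s a * cnj (s b)"] s(1) by (simp add: norm_mult)
qed

text \<open>The infinitesimal Caratheodory metric of the tetrablock at the origin.\<close>

definition tnorm :: "complex^3 \<Rightarrow> real" where
  "tnorm v = max (norm (v$1)) (norm (v$2)) + norm (v$3)"

text \<open>The bound \<open>|v\<^sub>1 - \<zeta> v\<^sub>3| \<le> 1\<close> holds for all unimodular \<open>\<zeta>\<close>, in particular for the one that aligns
  the two terms.\<close>

lemma tnorm_le_1:
  assumes "analytic_disc \<phi>" "disc_tangent \<phi> v" "\<phi> 0 = 0"
  shows "tnorm v \<le> 1"
proof -
  have 0: "\<phi> 0 = tri 0 0 0" using assms(3) by (simp add: vec_eq_iff forall_3)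
  obtain \<zeta> where "norm \<zeta> = 1" "norm (v$1 - \<zeta> * v$3) = norm (v$1) + norm (v$3)"
    by (rule aligned_phase)
  then have "norm (v$1) + norm (v$3) \<le> 1"
    using disc_tangent_bound[OF assms(1,2) 0, of \<zeta>] by simp
  moreover obtain \<zeta> where "norm \<zeta> = 1" "norm (v$2 - \<zeta> * v$3) = norm (v$2) + norm (v$3)"
    by (rule aligned_phase)
  then have "norm (v$2) + norm (v$3) \<le> 1"
    using disc_tangent_bound_swapped[OF assms(1,2) 0, of \<zeta>] by simp
  ultimately show ?thesis by (simp add: tnorm_def)
qed

lemma tnorm_scale: "tnorm (c *s v) = norm c * tnorm v"
  by (simp add: tnorm_def norm_mult max_mult_distrib_left distrib_left)

lemma tnorm_add: "tnorm (u + v) \<le> tnorm u + tnorm v"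
proof -
  have "norm (u$i + v$i) \<le> norm (u$i) + norm (v$i)" for i by (rule norm_triangle_ineq)
  from this[of 1] this[of 2] this[of 3] show ?thesis
    unfolding tnorm_def vector_add_component by linarith
qed

text \<open>Together with the vertical disc, these show that the bound \<open>tnorm_le_1\<close> is attained.\<close>

lemma royal_disc:
  assumes "norm a \<le> 1" "norm b \<le> 1"
  shows "analytic_disc (\<lambda>z. tri (z * a) (z * b) (z * a * (z * b)))"
    "disc_tangent (\<lambda>z. tri (z * a) (z * b) (z * a * (z * b))) (tri a b 0)"
proof -
  have *: "norm (z * c) < 1" if "norm c \<le> 1" "norm z < 1" for z c :: complex
    using that mult_left_le[of "norm c" "norm z"] by (simp add: norm_mult)
  show "analytic_disc (\<lambda>z. tri (z * a) (z * b) (z * a * (z * b)))"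
    unfolding analytic_disc_def
    using assms * by (auto simp: forall_3 intro!: holomorphic_intros royal_in_tetrablock)
  show "disc_tangent (\<lambda>z. tri (z * a) (z * b) (z * a * (z * b))) (tri a b 0)"
    by (auto simp: disc_tangent_def forall_3 intro!: derivative_eq_intros)
qed

lemma vertical_disc:
  shows "analytic_disc (\<lambda>z. tri 0 0 z)" "disc_tangent (\<lambda>z. tri 0 0 z) (tri 0 0 1)"
  by (auto simp: analytic_disc_def disc_tangent_def forall_3
      intro!: holomorphic_intros derivative_eq_intros axis_in_tetrablock)

lemma tri_decomp: "v = v$1 *s tri 1 0 0 + v$2 *s tri 0 1 0 + v$3 *s tri 0 0 1"
  by (simp add: vec_eq_iff forall_3)

lemma linear_vec:
  assumes "Vector_Spaces.linear (*s) (*s) (D :: complex^3 \<Rightarrow> complex^3)"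
  shows "D (c *s v) = c *s D v" "D (u + v) = D u + D v" "D (u - v) = D u - D v" "D 0 = 0"
proof -
  interpret Vector_Spaces.linear "(*s)" "(*s)" D by (rule assms)
  show "D (c *s v) = c *s D v" "D (u + v) = D u + D v" "D (u - v) = D u - D v" "D 0 = 0"
    by (rule scale add diff zero)+
qed

lemma linear_tri:
  assumes "Vector_Spaces.linear (*s) (*s) (D :: complex^3 \<Rightarrow> complex^3)"
  shows "D (tri a b c) = a *s D (tri 1 0 0) + b *s D (tri 0 1 0) + c *s D (tri 0 0 1)"
  using tri_decomp[of "tri a b c"] linear_vec[OF assms] by (simp only: vector_3)

lemma tetra_aut_derivative:
  assumes "tetra_aut f g" "x \<in> \<E>"
  obtains D where "(f has_derivative D) (at x within \<E>)" "Vector_Spaces.linear (*s) (*s) D"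
  using assms unfolding tetra_aut_def holomorphic_map_on_def by blast

text \<open>The derivatives of discs in \<open>\<E>\<close> centred at the origin already span, so uniqueness of one-variable
  derivatives suffices.\<close>

lemma derivative_inverse_at_0:
  assumes fg: "tetra_aut f g"
    and D: "(f has_derivative D) (at 0 within \<E>)" "Vector_Spaces.linear (*s) (*s) D"
    and D': "(g has_derivative D') (at (f 0) within \<E>)" "Vector_Spaces.linear (*s) (*s) D'"
  shows "D' (D v) = v"
proof -
  have *: "D' (D v) = v" if \<phi>: "analytic_disc \<phi>" "disc_tangent \<phi> v" "\<phi> 0 = 0" for \<phi> v
  proof (rule disc_tangent_unique)
    note fD = tetra_autD[OF fg]
    have "disc_tangent (\<lambda>z. f (\<phi> z)) (D v)"
      using \<phi> D by (intro disc_tangent_map[of \<phi> v f D]) auto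
    then show "disc_tangent (\<lambda>z. g (f (\<phi> z))) (D' (D v))"
      using \<phi>(3) D' by (intro disc_tangent_map[of "\<lambda>z. f (\<phi> z)" "D v" g D']
        analytic_disc_map[of \<phi> f, OF \<phi>(1) fD(1,3)]) auto
    show "g (f (\<phi> z)) = \<phi> z" if "z \<in> \<DD>" for z
      using \<phi>(1) that fD by (auto simp: analytic_disc_def)
  qed fact
  have 0: "tri 0 0 0 = 0" by (simp add: vec_eq_iff forall_3)
  have e: "D' (D (tri 1 0 0)) = tri 1 0 0" "D' (D (tri 0 1 0)) = tri 0 1 0" "D' (D (tri 0 0 1)) = tri 0 0 1"
    using *[OF royal_disc[of 1 0]] *[OF royal_disc[of 0 1]] *[OF vertical_disc] 0 by auto
  have "D' (D (v$1 *s tri 1 0 0 + v$2 *s tri 0 1 0 + v$3 *s tri 0 0 1))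
      = v$1 *s tri 1 0 0 + v$2 *s tri 0 1 0 + v$3 *s tri 0 0 1"
    by (simp only: linear_vec[OF D(2)] linear_vec[OF D'(2)] e)
  then show ?thesis unfolding tri_decomp[of v, symmetric] .
qed

text \<open>The vectors \<open>(a, b, 0)\<close> and \<open>(0, 0, c)\<close> are realised by royal and vertical discs, and \<open>tnorm\<close> is
  additive on their sum.\<close>

lemma tnorm_derivative_le:
  assumes fg: "tetra_aut f g" "f 0 = 0"
    and D: "(f has_derivative D) (at 0 within \<E>)" "Vector_Spaces.linear (*s) (*s) D"
  shows "tnorm (D v) \<le> tnorm v"
proof -
  note fD = tetra_autD[OF fg(1)]
  have *: "tnorm (D v) \<le> 1" if \<phi>: "analytic_disc \<phi>" "disc_tangent \<phi> v" "\<phi> 0 = 0" for \<phi> v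
    using \<phi> D fg(2)
    by (intro tnorm_le_1[of "\<lambda>z. f (\<phi> z)"] analytic_disc_map[of \<phi> f, OF \<phi>(1) fD(1,3)]
        disc_tangent_map[of \<phi> v f D]) auto
  have 0: "tri 0 0 0 = 0" by (simp add: vec_eq_iff forall_3)
  have 1: "tnorm (D (tri a b 0)) \<le> max (norm a) (norm b)" for a b
  proof (cases "max (norm a) (norm b) = 0")
    case True
    then have "norm a = 0" "norm b = 0" using norm_ge_zero[of a] norm_ge_zero[of b] by linarith+
    then show ?thesis using linear_vec(4)[OF D(2)] by (simp add: 0 tnorm_def)
  next
    case False
    define m where "m = max (norm a) (norm b)"
    have m: "m > 0" using False norm_ge_zero[of a] unfolding m_def by linarith
    have "tnorm (D (tri (a / m) (b / m) 0)) \<le> 1"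
      using m by (intro *[OF royal_disc]) (auto simp: 0 norm_divide m_def)
    moreover have "tri a b 0 = of_real m *s tri (a / m) (b / m) 0"
      using m by (simp add: vec_eq_iff forall_3)
    then have "tnorm (D (tri a b 0)) = m * tnorm (D (tri (a / m) (b / m) 0))"
      using m by (simp add: linear_vec[OF D(2)] tnorm_scale)
    ultimately show ?thesis using m by (simp add: m_def)
  qed
  have 2: "tnorm (D (tri 0 0 1)) \<le> 1" using *[OF vertical_disc] 0 by simp
  have "v = tri (v$1) (v$2) 0 + v$3 *s tri 0 0 1" by (simp add: vec_eq_iff forall_3)
  then have "D v = D (tri (v$1) (v$2) 0) + v$3 *s D (tri 0 0 1)"
    by (metis linear_vec(1,2)[OF D(2)])
  then have "tnorm (D v) \<le> tnorm (D (tri (v$1) (v$2) 0)) + norm (v$3) * tnorm (D (tri 0 0 1))"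
    using tnorm_add tnorm_scale by metis
  also have "\<dots> \<le> max (norm (v$1)) (norm (v$2)) + norm (v$3) * 1"
    using 1 2 by (intro add_mono mult_left_mono) auto
  finally show ?thesis by (simp add: tnorm_def)
qed

text \<open>Neither the derivative nor its inverse increases \<open>tnorm\<close>.\<close>

lemma tnorm_derivative:
  assumes fg: "tetra_aut f g" "f 0 = 0"
    and D: "(f has_derivative D) (at 0 within \<E>)" "Vector_Spaces.linear (*s) (*s) D"
  shows "tnorm (D v) = tnorm v"
proof -
  have g0: "g 0 = 0" using tetra_autD(5)[OF fg(1) zero_in_tetrablock] fg(2) by simp
  obtain D' where D': "(g has_derivative D') (at 0 within \<E>)" "Vector_Spaces.linear (*s) (*s) D'"
    using tetra_aut_derivative[OF tetra_aut_sym[OF fg(1)] zero_in_tetrablock] by blast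
  have "D' (D v) = v"
    by (rule derivative_inverse_at_0[OF fg(1) D _ D'(2)]) (use D' fg(2) in simp)
  then have "tnorm v = tnorm (D' (D v))" by simp
  also have "\<dots> \<le> tnorm (D v)"
    using tnorm_derivative_le[OF tetra_aut_sym[OF fg(1)] g0 D'] .
  finally show ?thesis using tnorm_derivative_le[OF fg D, of v] by simp
qed

section \<open>Linear isometries\<close>

text \<open>Equality in the triangle inequality between nonzero terms determines the phase \<open>\<zeta>\<close>.\<close>

lemma equality_phase:
  fixes a b \<zeta> :: complex
  assumes "norm (a + \<zeta> * b) = M + N" "norm a \<le> M" "norm b \<le> N" "norm \<zeta> = 1" "M > 0" "N > 0"
  shows "b \<noteq> 0" "\<zeta> = of_real N * a / (of_real M * b)"
proof -
  have n: "norm (\<zeta> * b) = norm b" using assms by (simp add: norm_mult)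
  have "norm (a + \<zeta> * b) \<le> norm a + norm b" using norm_triangle_ineq[of a "\<zeta> * b"] n by simp
  then have eq: "norm a = M" "norm b = N" "norm (a + \<zeta> * b) = norm a + norm (\<zeta> * b)"
    using assms n by linarith+
  then show b: "b \<noteq> 0" using assms by auto
  have "norm a *\<^sub>R (\<zeta> * b) = norm (\<zeta> * b) *\<^sub>R a"
    using norm_triangle_eq[THEN iffD1, OF eq(3)] .
  then show "\<zeta> = of_real N * a / (of_real M * b)"
    using b assms(5) eq n by (simp add: field_simps scaleR_conv_of_real)
qed

text \<open>If both vectors had a nonzero entry in the third place, or both a nonzero part in the first two
  places, then additivity would pin \<open>\<zeta>\<close> down to at most two values.\<close>

lemma tnorm_additive_disjoint:
  assumes eq: "\<And>\<zeta>. norm \<zeta> = 1 \<Longrightarrow> tnorm (p + \<zeta> *s w) = tnorm p + tnorm w"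
  shows "p$3 = 0 \<or> w$3 = 0" "(p$1 = 0 \<and> p$2 = 0) \<or> (w$1 = 0 \<and> w$2 = 0)"
proof -
  define M where "M = max (norm (p$1)) (norm (p$2))"
  define N where "N = max (norm (w$1)) (norm (w$2))"
  have tri: "norm (p$i + \<zeta> * w$i) \<le> norm (p$i) + norm (w$i)" if "norm \<zeta> = 1" for i \<zeta>
    using norm_triangle_ineq[of "p$i" "\<zeta> * w$i"] that by (simp add: norm_mult)
  have both: "max (norm (p$1 + \<zeta> * w$1)) (norm (p$2 + \<zeta> * w$2)) = M + N \<and>
      norm (p$3 + \<zeta> * w$3) = norm (p$3) + norm (w$3)" if "norm \<zeta> = 1" for \<zeta>
    using eq[OF that] tri[OF that, of 1] tri[OF that, of 2] tri[OF that, of 3]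
    unfolding tnorm_def M_def N_def by auto
  show "p$3 = 0 \<or> w$3 = 0"
  proof (rule ccontr)
    assume "\<not> ?thesis"
    then have pos: "norm (p$3) > 0" "norm (w$3) > 0" by auto
    have "(1::complex) = -1"
      using equality_phase(2)[OF both[of 1, THEN conjunct2] order_refl order_refl _ pos]
        equality_phase(2)[OF both[of "-1", THEN conjunct2] order_refl order_refl _ pos] by simp
    then show False by simp
  qed
  show "(p$1 = 0 \<and> p$2 = 0) \<or> (w$1 = 0 \<and> w$2 = 0)"
  proof (rule ccontr)
    assume *: "\<not> ?thesis"
    have M: "M > 0" and N: "N > 0"
      using * unfolding M_def N_def by (auto simp: less_max_iff_disj)
    define \<zeta>1 \<zeta>2 where "\<zeta>1 = of_real N * p$1 / (of_real M * w$1)" and "\<zeta>2 = of_real N * p$2 / (of_real M * w$2)"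
    have "\<zeta> = \<zeta>1 \<or> \<zeta> = \<zeta>2" if z: "norm \<zeta> = 1" for \<zeta>
    proof -
      have "norm (p$1 + \<zeta> * w$1) = M + N \<or> norm (p$2 + \<zeta> * w$2) = M + N"
        using both[OF z] by (auto simp: max_def split: if_splits)
      then show ?thesis
        using equality_phase(2)[OF _ _ _ z M N, of "p$1" "w$1"] equality_phase(2)[OF _ _ _ z M N, of "p$2" "w$2"]
        unfolding \<zeta>1_def \<zeta>2_def M_def N_def by fastforce
    qed
    \<comment> \<open>Three distinct phases cannot all be one of two values.\<close>
    from this[of 1] this[of "-1"] this[of \<i>] show False by (auto simp: complex_eq_iff)
  qed
qed

text \<open>The third basis vector \<open>e\<^sub>3\<close> is additive, in the sense of \<open>tnorm_additive_disjoint\<close>, with every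
  vector of the plane of \<open>e\<^sub>1\<close> and \<open>e\<^sub>2\<close>. Its image has the same property, which forces it onto the third axis
  and the image of the plane into the plane. There the norm is the maximum norm of two coordinates,
  whose isometries are monomial.\<close>

lemma tnorm_isometry_monomial:
  assumes lin: "Vector_Spaces.linear (*s) (*s) D" and iso: "\<And>v. tnorm (D v) = tnorm v"
  obtains u v w where "norm u = 1" "norm v = 1" "norm w = 1" "D (tri 0 0 1) = tri 0 0 w"
    "D (tri 1 0 0) = tri u 0 0 \<and> D (tri 0 1 0) = tri 0 v 0 \<or>
     D (tri 1 0 0) = tri 0 u 0 \<and> D (tri 0 1 0) = tri v 0 0"
proof -
  define A B p where "A = D (tri 1 0 0)" and "B = D (tri 0 1 0)" and "p = D (tri 0 0 1)"
  have n: "tnorm (D (tri a b c)) = max (norm a) (norm b) + norm c" for a b c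
    unfolding iso by (simp add: tnorm_def)
  have comb: "D (tri a b c) = a *s A + b *s B + c *s p" for a b c
    unfolding A_def B_def p_def by (rule linear_tri[OF lin])
  have nA: "tnorm A = 1" and nB: "tnorm B = 1" and np: "tnorm p = 1"
    unfolding A_def B_def p_def n by simp_all
  have pA: "tnorm (p + \<zeta> *s A) = tnorm p + tnorm A" if "norm \<zeta> = 1" for \<zeta>
    using n[of \<zeta> 0 1] that nA np by (simp add: comb add.commute)
  have pB: "tnorm (p + \<zeta> *s B) = tnorm p + tnorm B" if "norm \<zeta> = 1" for \<zeta>
    using n[of 0 \<zeta> 1] that nB np by (simp add: comb add.commute)
  note disj = tnorm_additive_disjoint[OF pA] tnorm_additive_disjoint[OF pB]
  have p3: "p$3 \<noteq> 0"
  proof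
    assume "p$3 = 0"
    then have "\<not> (p$1 = 0 \<and> p$2 = 0)" using np by (auto simp: tnorm_def)
    then have 0: "A$1 = 0" "A$2 = 0" "B$1 = 0" "B$2 = 0" using disj by auto
    have "D (tri (B$3) (- A$3) 0) = 0" using 0 by (simp add: comb vec_eq_iff forall_3)
    then have "max (norm (B$3)) (norm (A$3)) = 0" using n[of "B$3" "- A$3" 0] by (simp add: tnorm_def)
    then show False using nA norm_ge_zero[of "A$3"] norm_ge_zero[of "B$3"] unfolding tnorm_def 0 by auto
  qed
  then have A3: "A$3 = 0" and B3: "B$3 = 0" using disj by auto
  then have "\<not> (A$1 = 0 \<and> A$2 = 0)" using nA by (auto simp: tnorm_def)
  then have p12: "p$1 = 0" "p$2 = 0" using disj by auto
  have p: "p = tri 0 0 (p$3)" "norm (p$3) = 1"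
    using p12 np by (auto simp: vec_eq_iff forall_3 tnorm_def)
  have le: "norm (A$i) + norm (B$i) \<le> 1" if "i = 1 \<or> i = 2" for i
  proof -
    obtain \<zeta> where z: "norm \<zeta> = 1" "norm (A$i - \<zeta> * B$i) = norm (A$i) + norm (B$i)"
      by (rule aligned_phase)
    have "max (norm (A$1 - \<zeta> * B$1)) (norm (A$2 - \<zeta> * B$2)) = 1"
      using n[of 1 "-\<zeta>" 0] z(1) A3 B3 by (simp add: comb tnorm_def)
    then show ?thesis using z(2) that by auto
  qed
  have mA: "max (norm (A$1)) (norm (A$2)) = 1" and mB: "max (norm (B$1)) (norm (B$2)) = 1"
    using nA nB A3 B3 by (simp_all add: tnorm_def)
  have "norm (A$1) = 1 \<and> norm (B$2) = 1 \<and> B$1 = 0 \<and> A$2 = 0 \<or>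
      norm (A$2) = 1 \<and> norm (B$1) = 1 \<and> B$2 = 0 \<and> A$1 = 0"
  proof (cases "norm (A$1) = 1")
    case True
    then have B1: "B$1 = 0" using le[of 1] by simp
    then have "norm (B$2) = 1" using mB by (auto simp: max_def split: if_splits)
    then show ?thesis using True B1 le[of 2] by simp
  next
    case False
    then have A2: "norm (A$2) = 1" using mA by (auto simp: max_def split: if_splits)
    then have B2: "B$2 = 0" using le[of 2] by simp
    then have "norm (B$1) = 1" using mB by (auto simp: max_def split: if_splits)
    then show ?thesis using A2 B2 le[of 1] by simp
  qed
  then show ?thesis
  proof
    assume "norm (A$1) = 1 \<and> norm (B$2) = 1 \<and> B$1 = 0 \<and> A$2 = 0"
    then show ?thesis
      using that[of "A$1" "B$2" "p$3"] p A3 B3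
      by (auto simp: vec_eq_iff forall_3 simp flip: A_def B_def p_def)
  next
    assume "norm (A$2) = 1 \<and> norm (B$1) = 1 \<and> B$2 = 0 \<and> A$1 = 0"
    then show ?thesis
      using that[of "A$2" "B$1" "p$3"] p A3 B3
      by (auto simp: vec_eq_iff forall_3 simp flip: A_def B_def p_def)
  qed
qed

section \<open>Rigidity of automorphisms fixing the royal variety\<close>

lemma holomorphic_zero_on_circle:
  assumes "u holomorphic_on \<DD>" "0 < \<rho>" "\<rho> < 1" "\<And>z. norm z = \<rho> \<Longrightarrow> u z = 0" "z \<in> \<DD>"
  shows "u z = 0"
proof (rule analytic_continuation[where S = \<DD> and U = "sphere 0 \<rho>" and \<xi> = "of_real \<rho>" and f = u])
  have "connected (sphere (0::complex) \<rho>)" by (rule connected_sphere) simp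
  moreover have "of_real \<rho> \<in> sphere (0::complex) \<rho>" "- of_real \<rho> \<in> sphere (0::complex) \<rho>"
    using assms by auto
  moreover have "(of_real \<rho> :: complex) \<noteq> - of_real \<rho>" using assms by (simp add: complex_eq_iff)
  ultimately have "\<nexists>x. sphere 0 \<rho> = {x :: complex}"
    by (metis singletonD)
  then show "(of_real \<rho> :: complex) islimpt sphere 0 \<rho>"
    using \<open>connected _\<close> \<open>of_real \<rho> \<in> _\<close> by (intro connected_imp_perfect) blast+
qed (use assms in auto)

text \<open>The maximum principle on the discs of radius \<open>\<rho> < 1\<close>, as \<open>\<rho>\<close> tends to \<open>1\<close>.\<close>

lemma holomorphic_zero_of_boundary_decay:
  assumes u: "u holomorphic_on \<DD>" "\<And>z. z \<in> \<DD> \<Longrightarrow> norm (u z) \<le> C * (1 - norm z)" and z: "z \<in> \<DD>"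
  shows "u z = 0"
proof -
  have le: "norm (u z) \<le> C * (1 - \<rho>)" if "norm z < \<rho>" "\<rho> < 1" for \<rho>
  proof (rule maximum_modulus_frontier[where S = "cball 0 \<rho>" and f = u])
    have sub: "cball 0 \<rho> \<subseteq> \<DD>" using that by auto
    then show "u holomorphic_on interior (cball 0 \<rho>)"
      using u(1) interior_subset by (meson holomorphic_on_subset order_trans)
    show "continuous_on (closure (cball 0 \<rho>)) u"
      using continuous_on_subset[OF holomorphic_on_imp_continuous_on[OF u(1)] sub] by simp
    show "norm (u w) \<le> C * (1 - \<rho>)" if w: "w \<in> frontier (cball 0 \<rho>)" for w
    proof -
      have "norm w = \<rho>" using w by (simp add: frontier_cball)
      then show ?thesis using u(2)[of w] \<open>\<rho> < 1\<close> by simp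
    qed
  qed (use that in auto)
  have "norm (u z) \<le> 0"
  proof (rule tendsto_lowerbound)
    have "((\<lambda>\<rho>. C * (1 - \<rho>)) \<longlongrightarrow> C * (1 - 1)) (at_left (1::real))"
      by (intro tendsto_intros)
    then show "((\<lambda>\<rho>. C * (1 - \<rho>)) \<longlongrightarrow> 0) (at_left (1::real))" by simp
    show "\<forall>\<^sub>F \<rho> in at_left 1. norm (u z) \<le> C * (1 - \<rho>)"
      using eventually_at_left_real[of "norm z" 1] z le by (auto elim!: eventually_mono)
  qed simp
  then show ?thesis by simp
qed

lemma Schwarz_rigid:
  assumes h: "h holomorphic_on \<DD>" "\<And>z. z \<in> \<DD> \<Longrightarrow> norm (h z) < 1" "h 0 = 0"
    and d: "(h has_field_derivative d) (at 0)" "norm d = 1" and z: "z \<in> \<DD>"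
  shows "h z = d * z"
proof -
  have der: "deriv h 0 = d" using d(1) by (rule DERIV_imp_deriv)
  obtain \<alpha> where \<alpha>: "\<And>z. norm z < 1 \<Longrightarrow> h z = \<alpha> * z"
    using Schwarz_Lemma(3)[OF h(1,3), of 0] h(2) der d(2) by auto
  have "((\<lambda>z. \<alpha> * z) has_field_derivative \<alpha>) (at 0)" by (auto intro!: derivative_eq_intros)
  then have "(h has_field_derivative \<alpha>) (at 0)"
    by (rule has_field_derivative_transform_within_open[where S = \<DD>]) (auto simp: \<alpha>)
  then have "\<alpha> = d" using d(1) DERIV_unique by blast
  then show ?thesis using \<alpha> z by simp
qed

text \<open>Points of \<open>\<E>\<close> whose first two coordinates approach the torus \<open>|x\<^sub>1| = |x\<^sub>2| = 1\<close> are
  squeezed onto the royal variety.\<close>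

lemma tetrablock_near_royal_torus:
  assumes x: "x \<in> \<E>" and t: "norm (x$1) = t" "norm (x$2) = t"
  shows "norm (x$1 * x$2 - x$3) \<le> 4 * (1 - t)"
proof -
  define m c where "m = x$1 * x$2" and "c = norm (x$3)"
  have t0: "0 \<le> t" "t < 1" and c: "0 \<le> c" "c < 1"
    using t tetrablock_norm_less[OF x] by (auto simp: c_def)
  have m: "norm m = t * t" using t by (simp add: m_def norm_mult)
  have x2: "x$2 * cnj (x$2) = of_real (t * t)"
    using complex_norm_square[of "x$2"] t by (simp add: power2_eq_square)
  have "norm (m - of_real (t * t) * x$3) = norm (x$2 * (x$1 - cnj (x$2) * x$3))"
    unfolding x2[symmetric] m_def by (simp add: algebra_simps)
  also have "\<dots> = t * norm (x$1 - cnj (x$2) * x$3)" using t by (simp add: norm_mult)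
  finally have e: "norm (m - of_real (t * t) * x$3) = t * norm (x$1 - cnj (x$2) * x$3)" .
  have "2 * norm (x$1 - cnj (x$2) * x$3) \<le> 1 - c\<^sup>2"
    using tetrablock_inequality_swapped[OF x] t by (simp add: c_def)
  then have "t * (2 * norm (x$1 - cnj (x$2) * x$3)) \<le> t * (1 - c\<^sup>2)"
    using t0 by (intro mult_left_mono)
  then have 1: "2 * norm (m - of_real (t * t) * x$3) \<le> t * ((1 - c) * (1 + c))"
    unfolding e by (simp add: algebra_simps power2_eq_square)
  have "norm m - norm (of_real (t * t) * x$3) \<le> norm (m - of_real (t * t) * x$3)"
    by (rule norm_triangle_ineq2)
  then have 2: "t * t * (1 - c) \<le> norm (m - of_real (t * t) * x$3)"
    by (simp add: m norm_mult c_def algebra_simps)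
  have 3: "t * (1 - c) \<le> t * (2 * (1 - t))"
  proof (cases "t = 0")
    case False
    have "t * (1 - c) * (2 * t) \<le> t * (1 - c) * (1 + c)" using 1 2 by (simp add: algebra_simps)
    then have "2 * t \<le> 1 + c" using False t0 c by (simp add: mult_le_cancel_left)
    then show ?thesis using t0 by (intro mult_left_mono) auto
  qed simp
  have "norm (m - x$3) \<le> norm (m - of_real (t * t) * x$3) + norm (of_real (1 - t * t) * x$3)"
    using norm_triangle_ineq4[of "m - of_real (t * t) * x$3" "of_real (1 - t * t) * x$3"]
    by (simp add: algebra_simps)
  also have "norm (of_real (1 - t * t) * x$3) = (1 - t * t) * c"
    using t0 mult_le_one[of t t] by (simp only: norm_mult norm_of_real c_def) simp
  also have "(1 - t * t) * c \<le> (1 - t * t) * 1"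
    using t0 mult_le_one[of t t] c by (intro mult_left_mono) auto
  also have "1 - t * t = (1 - t) * (1 + t)" by (simp add: algebra_simps)
  also have "norm (m - of_real (t * t) * x$3) \<le> t * (1 - c)"
  proof -
    have "t * ((1 - c) * (1 + c)) \<le> t * ((1 - c) * 2)"
      using t0 c by (intro mult_left_mono) auto
    moreover have "t * ((1 - c) * 2) = 2 * (t * (1 - c))" by simp
    ultimately show ?thesis using 1 by linarith
  qed
  also have "t * (1 - c) + (1 - t) * (1 + t) * 1 \<le> 2 * (1 - t) + (1 - t) * 2"
  proof (intro add_mono)
    have "t * (2 * (1 - t)) \<le> 1 * (2 * (1 - t))" using t0 by (intro mult_right_mono) auto
    then show "t * (1 - c) \<le> 2 * (1 - t)" using 3 by simp
    show "(1 - t) * (1 + t) * 1 \<le> (1 - t) * 2"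
      using t0 mult_left_mono[of "1 + t" 2 "1 - t"] by simp
  qed
  finally show ?thesis by (simp add: m_def)
qed

definition fixes_royal :: "(complex^3 \<Rightarrow> complex^3) \<Rightarrow> bool" where
  "fixes_royal f \<longleftrightarrow> (\<forall>p q. norm p < 1 \<longrightarrow> norm q < 1 \<longrightarrow> f (tri p q (p * q)) = tri p q (p * q))"

lemma fixes_royalD: "fixes_royal f \<Longrightarrow> norm p < 1 \<Longrightarrow> norm q < 1 \<Longrightarrow> f (tri p q (p * q)) = tri p q (p * q)"
  by (simp add: fixes_royal_def)

lemma tri_0: "tri 0 0 0 = 0"
  by (simp add: vec_eq_iff forall_3)

lemma fixes_royal_0: "fixes_royal f \<Longrightarrow> f 0 = 0"
  using fixes_royalD[of f 0 0] by (simp add: tri_0)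

lemma analytic_disc_norm_less:
  assumes "analytic_disc \<psi>" "z \<in> \<DD>"
  shows "norm (\<psi> z $ 1) < 1" "norm (\<psi> z $ 2) < 1" "norm (\<psi> z $ 3) < 1"
  using assms tetrablock_norm_less[of "\<psi> z"] by (auto simp: analytic_disc_def)

text \<open>Since \<open>|a| = |b| = 1\<close>, the first two coordinates of the image disc are extremal for the Schwarz lemma
  and therefore linear; the third coordinate is then determined by \<open>tetrablock_near_royal_torus\<close>.\<close>

lemma fixes_royal_torus:
  assumes f: "tetra_aut f g" "f 0 = 0"
    and D: "(f has_derivative D) (at 0 within \<E>)" "Vector_Spaces.linear (*s) (*s) D"
      "D (tri 1 0 0) = tri 1 0 0" "D (tri 0 1 0) = tri 0 1 0"
    and a: "norm a = 1" and b: "norm b = 1" and z: "z \<in> \<DD>"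
  shows "f (tri (z * a) (z * b) (z * a * (z * b))) = tri (z * a) (z * b) (z * a * (z * b))"
proof -
  define \<phi> where "\<phi> z = tri (z * a) (z * b) (z * a * (z * b))" for z
  have \<phi>: "analytic_disc \<phi>" "disc_tangent \<phi> (tri a b 0)" "\<phi> 0 = 0"
    using royal_disc[of a b] a b by (simp_all add: \<phi>_def[abs_def] tri_0)
  define \<psi> where "\<psi> z = f (\<phi> z)" for z
  have "D (tri a b 0) = tri a b 0"
    using linear_tri[OF D(2), of a b 0] unfolding D(3,4) by (simp add: vec_eq_iff forall_3)
  then have t: "disc_tangent \<psi> (tri a b 0)"
    using disc_tangent_map[of \<phi> "tri a b 0" f D, OF \<phi>(1,2)] D(1,2) \<phi>(3)
    unfolding \<psi>_def[abs_def] by simp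
  have \<psi>: "analytic_disc \<psi>"
    unfolding \<psi>_def[abs_def] by (rule analytic_disc_map[OF \<phi>(1) tetra_autD(1,3)[OF f(1)]])
  have \<psi>0: "\<psi> 0 = 0" using f(2) \<phi>(3) by (simp add: \<psi>_def)
  have hol: "(\<lambda>z. \<psi> z $ j) holomorphic_on \<DD>" for j using \<psi> by (simp add: analytic_disc_def)
  have der: "((\<lambda>z. \<psi> z $ j) has_field_derivative tri a b 0 $ j) (at 0)" for j
    using t by (simp add: disc_tangent_def)
  have 1: "\<psi> z $ 1 = a * z" if "z \<in> \<DD>" for z
    using Schwarz_rigid[OF hol[of 1] _ _ der[of 1] _ that] analytic_disc_norm_less[OF \<psi>] \<psi>0 a by simp
  have 2: "\<psi> z $ 2 = b * z" if "z \<in> \<DD>" for z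
    using Schwarz_rigid[OF hol[of 2] _ _ der[of 2] _ that] analytic_disc_norm_less[OF \<psi>] \<psi>0 b by simp
  have "z * a * (z * b) - \<psi> z $ 3 = 0"
  proof (rule holomorphic_zero_of_boundary_decay[OF _ _ z, of "\<lambda>z. z * a * (z * b) - \<psi> z $ 3" 4])
    show "(\<lambda>z. z * a * (z * b) - \<psi> z $ 3) holomorphic_on \<DD>"
      by (intro holomorphic_intros hol)
    fix w assume w: "w \<in> \<DD>"
    have "\<psi> w \<in> \<E>" using \<psi> w by (simp add: analytic_disc_def)
    then show "norm (w * a * (w * b) - \<psi> w $ 3) \<le> 4 * (1 - norm w)"
      using tetrablock_near_royal_torus[of "\<psi> w" "norm w"] 1[OF w] 2[OF w] a b
      by (simp add: norm_mult mult.commute)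
  qed
  then have "\<psi> z = \<phi> z"
    using 1[OF z] 2[OF z] by (simp add: \<phi>_def vec_eq_iff forall_3 mult.commute)
  then show ?thesis by (simp add: \<psi>_def \<phi>_def)
qed

lemma royal_section_disc:
  assumes "norm p < 1"
  shows "analytic_disc (\<lambda>z. tri p z (p * z))" "analytic_disc (\<lambda>z. tri z p (z * p))"
  using assms unfolding analytic_disc_def
  by (auto simp: forall_3 intro!: holomorphic_intros royal_in_tetrablock)

text \<open>By \<open>fixes_royal_torus\<close> the map is the identity where \<open>|p| = |q|\<close>. For a fixed nonzero value of one of the
  two variables this is a circle in the other, and the identity theorem gives the rest.\<close>

lemma fixes_royalI:
  assumes f: "tetra_aut f g" "f 0 = 0"
    and D: "(f has_derivative D) (at 0 within \<E>)" "Vector_Spaces.linear (*s) (*s) D"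
      "D (tri 1 0 0) = tri 1 0 0" "D (tri 0 1 0) = tri 0 1 0"
  shows "fixes_royal f"
  unfolding fixes_royal_def
proof (intro allI impI)
  fix p q :: complex
  assume p: "norm p < 1" and q: "norm q < 1"
  have torus: "f (tri p q (p * q)) = tri p q (p * q)" if "norm p = norm q" "p \<noteq> 0" "norm p < 1" for p q
  proof -
    define r where "r = of_real (norm p) * (1::complex)"
    have r: "r \<noteq> 0" "norm r = norm p" using that by (auto simp: r_def)
    have "f (tri (r * (p / r)) (r * (q / r)) (r * (p / r) * (r * (q / r))))
        = tri (r * (p / r)) (r * (q / r)) (r * (p / r) * (r * (q / r)))"
      using that r by (intro fixes_royal_torus[OF f D]) (auto simp: norm_divide)
    then show ?thesis using r by simp
  qed
  show "f (tri p q (p * q)) = tri p q (p * q)"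
  proof (cases "p = 0")
    case False
    define \<phi> where "\<phi> z = tri p z (p * z)" for z
    have "analytic_disc \<phi>"
      unfolding \<phi>_def[abs_def] by (rule royal_section_disc(1)[OF p])
    note \<phi> = this analytic_disc_map[of \<phi> f, OF this tetra_autD(1,3)[OF f(1)]]
    have "f (\<phi> q) $ j - \<phi> q $ j = 0" for j
    proof (rule holomorphic_zero_on_circle[where \<rho> = "norm p" and z = q
          and u = "\<lambda>z. f (\<phi> z) $ j - \<phi> z $ j"])
      show "(\<lambda>z. f (\<phi> z) $ j - \<phi> z $ j) holomorphic_on \<DD>"
        using \<phi> by (auto simp: analytic_disc_def intro!: holomorphic_intros)
      show "f (\<phi> z) $ j - \<phi> z $ j = 0" if "norm z = norm p" for z
        using torus[of p z] that False p by (simp add: \<phi>_def)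
    qed (use p q False in auto)
    then show ?thesis by (simp add: vec_eq_iff \<phi>_def)
  next
    case p0: True
    show ?thesis
    proof (cases "q = 0")
      case False
      define \<phi> where "\<phi> z = tri z q (z * q)" for z
      have "analytic_disc \<phi>"
        unfolding \<phi>_def[abs_def] by (rule royal_section_disc(2)[OF q])
      note \<phi> = this analytic_disc_map[of \<phi> f, OF this tetra_autD(1,3)[OF f(1)]]
      have "f (\<phi> p) $ j - \<phi> p $ j = 0" for j
      proof (rule holomorphic_zero_on_circle[where \<rho> = "norm q" and z = p
            and u = "\<lambda>z. f (\<phi> z) $ j - \<phi> z $ j"])
        show "(\<lambda>z. f (\<phi> z) $ j - \<phi> z $ j) holomorphic_on \<DD>"
          using \<phi> by (auto simp: analytic_disc_def intro!: holomorphic_intros)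
        show "f (\<phi> z) $ j - \<phi> z $ j = 0" if "norm z = norm q" for z
        proof -
          have "z \<noteq> 0" using that False by auto
          then show ?thesis using torus[of z q] that q by (simp add: \<phi>_def)
        qed
      qed (use p q False in auto)
      then show ?thesis by (simp add: vec_eq_iff \<phi>_def)
    qed (use p0 f(2) in \<open>simp add: tri_0\<close>)
  qed
qed

text \<open>On the image of the vertical disc every \<open>\<Psi> \<zeta>\<close> with \<open>|\<zeta>| = 1\<close> is extremal for the Schwarz lemma. The
  resulting equations for three values of \<open>\<zeta>\<close> determine the three coordinates.\<close>

lemma fixes_royal_vertical:
  assumes f: "tetra_aut f g" "fixes_royal f"
  shows "\<exists>\<omega>. \<forall>z. norm z < 1 \<longrightarrow> f (tri 0 0 z) = tri 0 0 (\<omega> * z)"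
proof -
  have f0: "f 0 = 0" using fixes_royal_0[OF f(2)] .
  obtain D where D: "(f has_derivative D) (at 0 within \<E>)" "Vector_Spaces.linear (*s) (*s) D"
    using tetra_aut_derivative[OF f(1) zero_in_tetrablock] by blast
  obtain w where w: "norm w = 1" "D (tri 0 0 1) = tri 0 0 w"
    using tnorm_isometry_monomial[OF D(2) tnorm_derivative[OF f(1) f0 D]] by metis
  define \<psi> where "\<psi> z = f (tri 0 0 z)" for z
  have \<psi>: "analytic_disc \<psi>"
    unfolding \<psi>_def[abs_def] by (rule analytic_disc_map[OF vertical_disc(1) tetra_autD(1,3)[OF f(1)]])
  have t: "disc_tangent \<psi> (tri 0 0 w)"
    using disc_tangent_map[of "\<lambda>z. tri 0 0 z" "tri 0 0 1" f D, OF vertical_disc] D w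
    unfolding \<psi>_def[abs_def] by (simp add: tri_0)
  have \<psi>0: "\<psi> 0 = tri 0 0 0" using f0 by (simp add: \<psi>_def tri_0)
  have "f (tri 0 0 z) = tri 0 0 (w * z)" if "norm z < 1" for z
  proof (cases "z = 0")
    case True then show ?thesis using f0 by (simp add: tri_0)
  next
    case False
    have z: "z \<in> \<DD>" using that by simp
    have \<psi>E: "\<psi> z \<in> \<E>" if "z \<in> \<DD>" for z using \<psi> that by (simp add: analytic_disc_def)
    have eq: "\<psi> z $ 3 * \<zeta> - \<psi> z $ 1 = - \<zeta> * w * z * (\<psi> z $ 2 * \<zeta> - 1)" if \<zeta>: "norm \<zeta> = 1" for \<zeta>
    proof -
      have "\<Psi> \<zeta> (\<psi> z) = (tri 0 0 w $ 1 - \<zeta> * tri 0 0 w $ 3 - 0 * \<zeta>\<^sup>2 * tri 0 0 w $ 2) * z"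
      proof (rule Schwarz_rigid[of "\<lambda>z. \<Psi> \<zeta> (\<psi> z)"])
        show "(\<lambda>z. \<Psi> \<zeta> (\<psi> z)) holomorphic_on \<DD>"
          using Psi_along_disc[OF \<psi>] \<zeta> by simp
        show "norm (\<Psi> \<zeta> (\<psi> z)) < 1" if "z \<in> \<DD>" for z
          using Psi_norm_less[OF \<psi>E[OF that]] \<zeta> by simp
        show "\<Psi> \<zeta> (\<psi> 0) = 0" by (simp add: Psi_def \<psi>0)
        show "((\<lambda>z. \<Psi> \<zeta> (\<psi> z)) has_field_derivative
            tri 0 0 w $ 1 - \<zeta> * tri 0 0 w $ 3 - 0 * \<zeta>\<^sup>2 * tri 0 0 w $ 2) (at 0)"
          by (rule Psi_derivative[OF t \<psi>0])
      qed (use z w \<zeta> in \<open>auto simp: norm_mult\<close>)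
      then have "(\<psi> z $ 3 * \<zeta> - \<psi> z $ 1) / (\<psi> z $ 2 * \<zeta> - 1) = - \<zeta> * w * z"
        by (simp add: Psi_def)
      then show ?thesis
        using Psi_norm_less(2)[OF \<psi>E[OF z], of \<zeta>] \<zeta> by (simp only: divide_eq_eq) simp
    qed
    define a b c where "a = \<psi> z $ 1" and "b = \<psi> z $ 2" and "c = \<psi> z $ 3"
    have e1: "c - a = w * z - w * z * b" using eq[of 1] by (simp add: a_def b_def c_def algebra_simps)
    have e2: "- c - a = - (w * z) - w * z * b" using eq[of "-1"] by (simp add: a_def b_def c_def algebra_simps)
    have e3: "c * \<i> - a = w * z * \<i> + w * z * b" using eq[of \<i>] by (simp add: a_def b_def c_def algebra_simps)
    have "2 * c = (c - a) - (- c - a)" by simp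
    also have "\<dots> = 2 * (w * z)" unfolding e1 e2 by simp
    finally have c: "c = w * z" by simp
    have a: "a = w * z * b" using e1 c by simp
    have "- a = w * z * b" using e3 c by simp
    then have "- a = a" unfolding a[symmetric] .
    then have "a = 0" by simp
    then have "w * z * b = 0" by (rule trans[OF a[symmetric]])
    then have "b = 0" using w(1) False by auto
    then show ?thesis
      using \<open>a = 0\<close> c by (simp add: vec_eq_iff forall_3 a_def b_def c_def \<psi>_def)
  qed
  then show ?thesis by blast
qed

lemma moebius_norm_less:
  fixes a p :: complex
  assumes "norm a < 1" "norm p < 1"
  shows "norm ((a - p) / (1 - cnj a * p)) < 1"
  using norm_blaschke_less[of p 1 a] assms one_minus_mult_nonzero[of "cnj a" p]
  by (simp add: norm_divide)

lemma fixes_royal_conj_mob: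
  assumes f: "fixes_royal f" and a: "norm a < 1"
  shows "fixes_royal (mob a \<circ> f \<circ> mob a)"
  unfolding fixes_royal_def
proof (intro allI impI)
  fix p q :: complex assume pq: "norm p < 1" "norm q < 1"
  have "f (mob a (tri p q (p * q))) = mob a (tri p q (p * q))"
    unfolding mob_royal[OF a pq(1)]
    by (rule fixes_royalD[OF f moebius_norm_less[OF a pq(1)] pq(2)])
  then have "(mob a \<circ> f \<circ> mob a) (tri p q (p * q)) = mob a (mob a (tri p q (p * q)))"
    by simp
  then show "(mob a \<circ> f \<circ> mob a) (tri p q (p * q)) = tri p q (p * q)"
    using mob_mob[OF a royal_in_tetrablock[OF pq]] by simp
qed

lemma fixes_royal_conj_swap:
  assumes "fixes_royal f"
  shows "fixes_royal (swap12 \<circ> f \<circ> swap12)"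
  unfolding fixes_royal_def
proof (intro allI impI)
  fix p q :: complex assume "norm p < 1" "norm q < 1"
  then have "f (tri q p (q * p)) = tri q p (q * p)"
    by (intro fixes_royalD[OF assms])
  then show "(swap12 \<circ> f \<circ> swap12) (tri p q (p * q)) = tri p q (p * q)"
    by (simp add: swap12_def mult.commute[of p q])
qed

lemma fixes_royal_conj_mob2:
  assumes f: "fixes_royal f" and b: "norm b < 1"
  shows "fixes_royal (mob2 b \<circ> f \<circ> mob2 b)"
  using fixes_royal_conj_swap[OF fixes_royal_conj_mob[OF fixes_royal_conj_swap[OF f] b]]
  by (simp add: mob2_def comp_assoc)

lemma mob2_vertical: "mob2 b (tri 0 0 (- z)) = tri (cnj b * z) b z"
  by (simp add: mob2_eq)

text \<open>The statement of \<open>fixes_royal_vertical\<close> transported to another base point by \<open>mob2 b\<close>, whose image of the vertical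
  disc is \<open>{(cnj b * z, b, z)}\<close>.\<close>

lemma fixes_royal_fibre:
  assumes f: "tetra_aut f g" "fixes_royal f" and b: "norm b < 1"
  shows "\<exists>\<omega>. \<forall>z. norm z < 1 \<longrightarrow> tri (cnj b * z) b z \<in> \<E> \<and>
    f (tri (cnj b * z) b z) = tri (\<omega> * (cnj b * z)) b (\<omega> * z)"
proof -
  let ?h = "mob2 b \<circ> f \<circ> mob2 b"
  have h: "tetra_aut ?h (mob2 b \<circ> (g \<circ> mob2 b))"
    by (intro tetra_aut_comp tetra_aut_mob2 b f)
  obtain \<omega> where \<omega>: "\<And>z. norm z < 1 \<Longrightarrow> ?h (tri 0 0 z) = tri 0 0 (\<omega> * z)"
    using fixes_royal_vertical[OF h fixes_royal_conj_mob2[OF f(2) b]] by blast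
  note mE = tetra_autD(3)[OF tetra_aut_mob2[OF b]]
  have E: "tri (cnj b * z) b z \<in> \<E>" if "norm z < 1" for z
    using mE[of "tri 0 0 (- z)"] that axis_in_tetrablock[of 0 "- z"] by (simp add: mob2_vertical)
  moreover have "f (tri (cnj b * z) b z) = tri (\<omega> * (cnj b * z)) b (\<omega> * z)" if z: "norm z < 1" for z
  proof -
    have "mob2 b (f (tri (cnj b * z) b z)) = tri 0 0 (\<omega> * (- z))"
      using \<omega>[of "- z"] z by (simp add: mob2_vertical)
    then have "mob2 b (mob2 b (f (tri (cnj b * z) b z))) = mob2 b (tri 0 0 (- (\<omega> * z)))"
      by simp
    moreover have "mob2 b (mob2 b (f (tri (cnj b * z) b z))) = f (tri (cnj b * z) b z)"
      using tetra_autD(5)[OF tetra_aut_mob2[OF b]] tetra_autD(3)[OF f(1)] E[OF z] by blast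
    ultimately show ?thesis by (simp add: mob2_vertical mult.left_commute)
  qed
  ultimately show ?thesis by blast
qed

lemma continuous_on_tri:
  assumes "continuous_on S f" "continuous_on S g" "continuous_on S h"
  shows "continuous_on S (\<lambda>x. tri (f x) (g x) (h x))"
proof -
  have "continuous_on S (\<lambda>x. \<chi> i. tri (f x) (g x) (h x) $ i)"
  proof (rule continuous_on_vec_lambda)
    fix i :: 3
    show "continuous_on S (\<lambda>x. tri (f x) (g x) (h x) $ i)"
      using exhaust_3[of i] assms by auto
  qed
  then show ?thesis by simp
qed

text \<open>This disc in the variable \<open>\<beta>\<close> is chosen so that on the circle \<open>|\<beta>| = 1/2\<close>, where
  \<open>cnj \<beta> = 1 / (4 * \<beta>)\<close>, it runs through the fibres \<open>(cnj \<beta> * z, \<beta>, z)\<close> with \<open>z = \<mu> * \<beta>\<close>.\<close>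

lemma wedge_in_tetrablock:
  assumes \<mu>: "norm \<mu> < 1" and \<beta>: "norm \<beta> \<le> 1/2"
  shows "tri (\<mu>/4) \<beta> (\<mu> * \<beta>) \<in> \<E>"
  unfolding tetrablock_iff_swapped
proof (intro allI impI)
  fix w :: complex assume w: "norm w \<le> 1"
  define y where "y = \<mu> * w"
  have y: "norm y < 1"
    using \<mu> w mult_left_le[of "norm w" "norm \<mu>"] by (simp add: y_def norm_mult)
  then have y2: "(norm y)\<^sup>2 < 1" by (simp add: abs_square_less_1)
  have "(norm (1 - y/4))\<^sup>2 - (norm (1 - y) / 2)\<^sup>2 = (3/4) * (1 - (norm y)\<^sup>2 / 4)"
    unfolding power_divide norm_diff_square
    by (simp add: norm_divide power_divide field_simps)
  also have "\<dots> > 0" using y2 by simp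
  finally have "(norm (1 - y) / 2)\<^sup>2 < (norm (1 - y/4))\<^sup>2" by simp
  then have "norm (1 - y) / 2 < norm (1 - y/4)" by (rule power2_less_imp_less) simp
  moreover have "norm \<beta> * norm (1 - y) \<le> 1/2 * norm (1 - y)"
    using \<beta> by (intro mult_right_mono) auto
  ultimately have "norm (\<beta> * (1 - y)) < norm (1 - y/4)" by (simp add: norm_mult)
  then show "norm (tri (\<mu>/4) \<beta> (\<mu> * \<beta>) $ 2 - tri (\<mu>/4) \<beta> (\<mu> * \<beta>) $ 3 * w)
      < norm (1 - tri (\<mu>/4) \<beta> (\<mu> * \<beta>) $ 1 * w)"
    by (simp add: y_def algebra_simps)
qed

text \<open>On the circle \<open>|\<beta>| = 1/2\<close> the map multiplies both \<open>x\<^sub>1\<close> and \<open>x\<^sub>3\<close> by the same factor, which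
  keeps the relation \<open>x\<^sub>1 = cnj \<beta> * x\<^sub>3\<close>. In the form \<open>x\<^sub>1 * \<beta> = x\<^sub>3 / 4\<close> the relation is holomorphic and so
  extends to the whole disc, where it is no longer a statement about the fibres.\<close>

lemma fixes_royal_wedge:
  assumes f: "tetra_aut f g" "fixes_royal f" and \<mu>: "norm \<mu> < 1" and \<beta>: "norm \<beta> \<le> 1/2"
  shows "f (tri (\<mu>/4) \<beta> (\<mu> * \<beta>)) $ 1 * \<beta> - f (tri (\<mu>/4) \<beta> (\<mu> * \<beta>)) $ 3 / 4 = 0"
proof -
  define \<phi> where "\<phi> \<beta> = tri (\<mu>/4) \<beta> (\<mu> * \<beta>)" for \<beta>
  define u where "u \<beta> = f (\<phi> \<beta>) $ 1 * \<beta> - f (\<phi> \<beta>) $ 3 / 4" for \<beta>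
  have \<phi>E: "\<phi> b \<in> \<E>" if "norm b \<le> 1/2" for b
    unfolding \<phi>_def using wedge_in_tetrablock[OF \<mu> that] .
  have hol: "(\<lambda>b. f (\<phi> b) $ j) holomorphic_on ball 0 (1/2)" for j
  proof (rule holomorphic_on_along_disc[where S = \<E> and f = f and \<phi> = \<phi>])
    show "(\<lambda>z. \<phi> z $ i) holomorphic_on ball 0 (1/2)" for i
      using exhaust_3[of i] by (auto simp: \<phi>_def intro!: holomorphic_intros)
  qed (use tetra_autD(1)[OF f(1)] \<phi>E in auto)
  note fcont = holomorphic_map_on_imp_continuous_on[OF tetra_autD(1)[OF f(1)]]
  have \<phi>cont: "continuous_on (cball 0 (1/2)) \<phi>"
    unfolding \<phi>_def[abs_def] by (intro continuous_on_tri continuous_intros)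
  have cont: "continuous_on (cball 0 (1/2)) (\<lambda>b. f (\<phi> b) $ j)" for j
    by (intro continuous_intros continuous_on_compose2[OF fcont \<phi>cont]) (use \<phi>E in auto)
  have "norm (u \<beta>) \<le> 0"
  proof (rule maximum_modulus_frontier[where S = "cball 0 (1/2)" and f = u])
    show "u holomorphic_on interior (cball 0 (1/2))"
      unfolding u_def interior_cball by (intro holomorphic_intros hol) auto
    show "continuous_on (closure (cball 0 (1/2))) u"
      unfolding u_def closure_closed[OF closed_cball] by (intro continuous_intros cont) auto
    fix b :: complex assume "b \<in> frontier (cball 0 (1/2))"
    then have b: "norm b = 1/2" by (simp add: frontier_cball)
    have "cnj b * b = of_real ((norm b)\<^sup>2)" by (simp only: complex_norm_square mult.commute)
    then have bb: "cnj b * b = 1/4" unfolding b by (simp add: power2_eq_square)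
    have b1: "norm b < 1" using b by simp
    obtain \<omega> where \<omega>: "\<And>z. norm z < 1 \<Longrightarrow> f (tri (cnj b * z) b z) = tri (\<omega> * (cnj b * z)) b (\<omega> * z)"
      using fixes_royal_fibre[OF f b1] by blast
    have m: "norm (\<mu> * b) < 1" unfolding norm_mult b using \<mu> by simp
    have "cnj b * (\<mu> * b) = \<mu> * (cnj b * b)" by (simp only: ac_simps)
    then have e: "cnj b * (\<mu> * b) = \<mu>/4" unfolding bb by simp
    have "f (\<phi> b) = tri (\<omega> * (\<mu>/4)) b (\<omega> * (\<mu> * b))"
      using \<omega>[OF m] unfolding e \<phi>_def .
    then have "u b = 0" by (simp add: u_def)
    then show "norm (u b) \<le> 0" by simp
  qed (use \<beta> in auto)
  then show ?thesis by (simp add: u_def \<phi>_def)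
qed

text \<open>At the centre of the disc of \<open>fixes_royal_wedge\<close>, the relation found there and the identity on the royal
  variety give two linear equations for the third row of the derivative.\<close>

lemma fixes_royal_normal_derivative:
  assumes f: "tetra_aut f g" "fixes_royal f" and \<mu>: "norm \<mu> < 1" "\<mu> \<noteq> 0"
    and D: "(f has_derivative D) (at (tri (\<mu>/4) 0 0) within \<E>)" "Vector_Spaces.linear (*s) (*s) D"
  shows "D (tri 0 0 1) $ 3 = 1" "D (tri 0 1 0) $ 3 = 0"
proof -
  define \<phi> where "\<phi> \<beta> = tri (\<mu>/4) \<beta> (\<mu> * \<beta>)" for \<beta>
  define \<theta> where "\<theta> \<beta> = tri (\<mu>/4) \<beta> (\<mu>/4 * \<beta>)" for \<beta>
  have m4: "norm (\<mu>/4) < 1" using \<mu> by (simp add: norm_divide)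
  have f0: "f (tri (\<mu>/4) 0 0) = tri (\<mu>/4) 0 0"
    using fixes_royalD[OF f(2) m4, of 0] by simp
  have d\<phi>: "((\<lambda>b. f (\<phi> b) $ 3) has_field_derivative D (tri 0 1 \<mu>) $ 3) (at 0)"
    "((\<lambda>b. f (\<phi> b) $ 1) has_field_derivative D (tri 0 1 \<mu>) $ 1) (at 0)"
  proof -
    have *: "((\<lambda>b. f (\<phi> b) $ i) has_field_derivative D (tri 0 1 \<mu>) $ i) (at 0)" for i
    proof (rule has_field_derivative_along_disc[where f = f and \<phi> = \<phi> and z = 0 and S = \<E>
          and U = "ball 0 (1/2)" and D = D])
      show "((\<lambda>z. \<phi> z $ j) has_field_derivative tri 0 1 \<mu> $ j) (at 0)" for j
        using exhaust_3[of j] by (auto simp: \<phi>_def intro!: derivative_eq_intros)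
      show "\<phi> z \<in> \<E>" if "z \<in> ball 0 (1/2)" for z
        using wedge_in_tetrablock[OF \<mu>(1), of z] that by (simp add: \<phi>_def)
    qed (use D in \<open>auto simp: \<phi>_def\<close>)
    show "((\<lambda>b. f (\<phi> b) $ 3) has_field_derivative D (tri 0 1 \<mu>) $ 3) (at 0)"
      "((\<lambda>b. f (\<phi> b) $ 1) has_field_derivative D (tri 0 1 \<mu>) $ 1) (at 0)"
      by (rule *)+
  qed
  have "((\<lambda>b. f (\<phi> b) $ 1 * b - f (\<phi> b) $ 3 / 4) has_field_derivative
      \<mu>/4 - D (tri 0 1 \<mu>) $ 3 / 4) (at 0)"
  proof -
    have "f (\<phi> 0) $ 1 = \<mu>/4" using f0 by (simp add: \<phi>_def)
    then show ?thesis by (auto intro!: derivative_eq_intros d\<phi>)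
  qed
  moreover have "((\<lambda>b. f (\<phi> b) $ 1 * b - f (\<phi> b) $ 3 / 4) has_field_derivative 0) (at 0)"
  proof (rule has_field_derivative_transform_within_open[where S = "ball 0 (1/2)" and f = "\<lambda>_. 0"])
    show "0 = f (\<phi> b) $ 1 * b - f (\<phi> b) $ 3 / 4" if "b \<in> ball 0 (1/2)" for b
      using fixes_royal_wedge[OF f \<mu>(1), of b] that by (simp add: \<phi>_def)
  qed auto
  ultimately have "\<mu>/4 - D (tri 0 1 \<mu>) $ 3 / 4 = 0" by (rule DERIV_unique)
  then have 1: "D (tri 0 1 \<mu>) $ 3 = \<mu>" by simp
  have "disc_tangent (\<lambda>b. f (\<theta> b)) (D (tri 0 1 (\<mu>/4)))"
  proof (rule disc_tangent_map[of \<theta> "tri 0 1 (\<mu>/4)" f D])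
    show "analytic_disc \<theta>"
      unfolding \<theta>_def[abs_def] by (rule royal_section_disc(1)[OF m4])
    show "disc_tangent \<theta> (tri 0 1 (\<mu>/4))"
      by (auto simp: disc_tangent_def \<theta>_def forall_3 intro!: derivative_eq_intros)
    show "(f has_derivative D) (at (\<theta> 0) within \<E>)" using D(1) by (simp add: \<theta>_def)
  qed (rule D(2))
  moreover have "disc_tangent \<theta> (tri 0 1 (\<mu>/4))"
    by (auto simp: disc_tangent_def \<theta>_def forall_3 intro!: derivative_eq_intros)
  ultimately have "D (tri 0 1 (\<mu>/4)) = tri 0 1 (\<mu>/4)"
    by (rule disc_tangent_unique) (use fixes_royalD[OF f(2) m4] in \<open>auto simp: \<theta>_def\<close>)
  then have 2: "D (tri 0 1 (\<mu>/4)) $ 3 = \<mu>/4" by simp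
  define c d where "c = D (tri 0 1 0) $ 3" and "d = D (tri 0 0 1) $ 3"
  have "c + \<mu> * d = \<mu>" "c + \<mu>/4 * d = \<mu>/4"
    using 1 2 linear_tri[OF D(2), of 0 1 \<mu>] linear_tri[OF D(2), of 0 1 "\<mu>/4"]
    by (simp_all add: c_def d_def)
  then have "\<mu> * d - \<mu>/4 * d = \<mu> - \<mu>/4" by (metis add_diff_cancel_left)
  then have "\<mu> * (3/4) * d = \<mu> * (3/4) * 1" by (simp add: algebra_simps)
  then have "d = 1" using \<mu>(2) by simp
  then show "D (tri 0 0 1) $ 3 = 1" "D (tri 0 1 0) $ 3 = 0"
    using \<open>c + \<mu> * d = \<mu>\<close> by (simp_all add: c_def d_def)
qed

text \<open>The flipped fibre over \<open>(\<alpha>, 0, 0)\<close> is turned by some factor \<open>\<omega>\<close>, and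
  \<open>fixes_royal_normal_derivative\<close> shows that the derivative in \<open>z\<close> of the third coordinate along this
  fibre is \<open>1\<close>; this derivative is \<open>\<omega>\<close>.\<close>

lemma fixes_royal_transverse:
  assumes f: "tetra_aut f g" "fixes_royal f" and \<alpha>: "norm \<alpha> < 1/4" "\<alpha> \<noteq> 0" and z: "norm z < 1"
  shows "tri \<alpha> (cnj \<alpha> * z) z \<in> \<E>" "f (tri \<alpha> (cnj \<alpha> * z) z) = tri \<alpha> (cnj \<alpha> * z) z"
proof -
  let ?h = "swap12 \<circ> f \<circ> swap12"
  have h: "tetra_aut ?h (swap12 \<circ> (g \<circ> swap12))"
    by (intro tetra_aut_comp tetra_aut_swap12 f)
  have \<alpha>1: "norm \<alpha> < 1" using \<alpha> by simp
  obtain \<omega> where \<omega>: "\<And>z. norm z < 1 \<Longrightarrow> tri (cnj \<alpha> * z) \<alpha> z \<in> \<E>"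
      "\<And>z. norm z < 1 \<Longrightarrow> ?h (tri (cnj \<alpha> * z) \<alpha> z) = tri (\<omega> * (cnj \<alpha> * z)) \<alpha> (\<omega> * z)"
    using fixes_royal_fibre[OF h fixes_royal_conj_swap[OF f(2)] \<alpha>1] by blast
  define \<phi> where "\<phi> z = tri \<alpha> (cnj \<alpha> * z) z" for z
  have E: "\<phi> z \<in> \<E>" if "norm z < 1" for z
    using \<omega>(1)[OF that] tetrablock_swap[of "\<phi> z"] by (simp add: \<phi>_def)
  have eq: "f (\<phi> z) = tri \<alpha> (\<omega> * (cnj \<alpha> * z)) (\<omega> * z)" if "norm z < 1" for z
    using \<omega>(2)[OF that] by (simp add: swap12_def \<phi>_def vec_eq_iff forall_3)
  have \<phi>: "analytic_disc \<phi>" "disc_tangent \<phi> (tri 0 (cnj \<alpha>) 1)"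
    using E by (auto simp: analytic_disc_def disc_tangent_def \<phi>_def forall_3
        intro!: holomorphic_intros derivative_eq_intros)
  have \<phi>0: "\<phi> 0 = tri (4 * \<alpha> / 4) 0 0" by (simp add: \<phi>_def)
  obtain D where D: "(f has_derivative D) (at (\<phi> 0) within \<E>)" "Vector_Spaces.linear (*s) (*s) D"
    using tetra_aut_derivative[OF f(1), of "\<phi> 0"] E by auto
  have m: "norm (4 * \<alpha>) < 1" "4 * \<alpha> \<noteq> 0" using \<alpha> by (simp_all add: norm_mult)
  note nd = fixes_royal_normal_derivative[OF f m D[unfolded \<phi>0]]
  have "D (tri 0 (cnj \<alpha>) 1) $ 3 = 1"
    using linear_tri[OF D(2), of 0 "cnj \<alpha>" 1] nd by simp
  moreover have "disc_tangent (\<lambda>z. f (\<phi> z)) (D (tri 0 (cnj \<alpha>) 1))"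
    by (rule disc_tangent_map[OF \<phi> D])
  moreover have "disc_tangent (\<lambda>z. tri \<alpha> (\<omega> * (cnj \<alpha> * z)) (\<omega> * z)) (tri 0 (\<omega> * cnj \<alpha>) \<omega>)"
    by (auto simp: disc_tangent_def forall_3 intro!: derivative_eq_intros)
  ultimately have "\<omega> = 1"
    using disc_tangent_unique[of "\<lambda>z. f (\<phi> z)" "D (tri 0 (cnj \<alpha>) 1)"
        "\<lambda>z. tri \<alpha> (\<omega> * (cnj \<alpha> * z)) (\<omega> * z)" "tri 0 (\<omega> * cnj \<alpha>) \<omega>"] eq
    by auto
  then show "tri \<alpha> (cnj \<alpha> * z) z \<in> \<E>" "f (tri \<alpha> (cnj \<alpha> * z) z) = tri \<alpha> (cnj \<alpha> * z) z"
    using eq[OF z] E[OF z] by (simp_all add: \<phi>_def)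
qed

text \<open>The vertical disc is the limit of the fibres over \<open>(\<alpha>, 0, 0)\<close> as \<open>\<alpha>\<close> tends to \<open>0\<close>.\<close>

lemma fixes_royal_vertical_id:
  assumes f: "tetra_aut f g" "fixes_royal f" and z: "norm z < 1"
  shows "f (tri 0 0 z) = tri 0 0 z"
proof -
  define \<phi> where "\<phi> \<alpha> = tri \<alpha> (cnj \<alpha> * z) z" for \<alpha>
  have E: "\<phi> \<alpha> \<in> \<E>" if "\<alpha> \<in> ball 0 (1/4)" for \<alpha>
    using fixes_royal_transverse(1)[OF f _ _ z, of \<alpha>] that axis_in_tetrablock[of 0 z] z
    by (cases "\<alpha> = 0") (auto simp: \<phi>_def)
  note fcont = holomorphic_map_on_imp_continuous_on[OF tetra_autD(1)[OF f(1)]]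
  have \<phi>cont: "continuous_on (ball 0 (1/4)) \<phi>"
    unfolding \<phi>_def[abs_def] by (intro continuous_on_tri continuous_intros)
  have "continuous_on (ball 0 (1/4)) (\<lambda>\<alpha>. f (\<phi> \<alpha>))"
    by (intro continuous_on_compose2[OF fcont \<phi>cont]) (use E in auto)
  then have "isCont (\<lambda>\<alpha>. f (\<phi> \<alpha>)) 0" "isCont \<phi> 0"
    using \<phi>cont by (auto simp: continuous_on_eq_continuous_at)
  then have lim: "((\<lambda>\<alpha>. f (\<phi> \<alpha>)) \<longlongrightarrow> f (\<phi> 0)) (at 0)" "(\<phi> \<longlongrightarrow> \<phi> 0) (at 0)"
    by (simp_all add: isCont_def)
  have "eventually (\<lambda>\<alpha>. f (\<phi> \<alpha>) = \<phi> \<alpha>) (at 0)"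
    unfolding eventually_at
    using fixes_royal_transverse(2)[OF f _ _ z] by (intro exI[of _ "1/4"]) (auto simp: \<phi>_def)
  then have "(\<phi> \<longlongrightarrow> f (\<phi> 0)) (at 0)" by (rule Lim_transform_eventually[OF lim(1)])
  then have "f (\<phi> 0) = \<phi> 0" using lim(2) by (rule tendsto_unique[rotated]) simp
  then show ?thesis by (simp add: \<phi>_def)
qed

text \<open>Every point lies on the image of the vertical disc under a product of the involutions, and
  conjugation with these preserves the hypothesis.\<close>

theorem fixes_royal_imp_id:
  assumes f: "tetra_aut f g" "fixes_royal f" and x: "x \<in> \<E>"
  shows "f x = x"
proof -
  obtain a b w where ab: "norm a < 1" "norm b < 1" "norm w < 1" "x = mob a (mob2 b (tri 0 0 w))"
    using tetrablock_orbit[OF x] by blast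
  let ?h = "mob2 b \<circ> (mob a \<circ> f \<circ> mob a) \<circ> mob2 b"
  note aut = tetra_autD[OF tetra_aut_mob[OF ab(1)]] tetra_autD[OF tetra_aut_mob2[OF ab(2)]]
  have "tetra_aut ?h (mob2 b \<circ> ((mob a \<circ> (g \<circ> mob a)) \<circ> mob2 b))"
    by (intro tetra_aut_comp tetra_aut_mob tetra_aut_mob2 f ab)
  moreover have "fixes_royal ?h"
    by (intro fixes_royal_conj_mob2 fixes_royal_conj_mob f ab)
  ultimately have "?h (tri 0 0 w) = tri 0 0 w"
    by (rule fixes_royal_vertical_id) (rule ab)
  then have "mob2 b (mob a (f x)) = tri 0 0 w" by (simp add: ab(4))
  then have "mob a (mob2 b (mob2 b (mob a (f x)))) = x" by (simp add: ab(4))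
  then show ?thesis using aut tetra_autD(3)[OF f(1) x] by simp
qed

section \<open>The isotropy group of the origin\<close>

lemma disc_tangent_rot:
  assumes "disc_tangent \<phi> v"
  shows "disc_tangent (\<lambda>z. rot a b (\<phi> z)) (rot a b v)"
  using assms by (auto simp: disc_tangent_def rot_def forall_3 intro!: derivative_eq_intros)

lemma horizontal_discs:
  shows "analytic_disc (\<lambda>z. tri z 0 0)" "disc_tangent (\<lambda>z. tri z 0 0) (tri 1 0 0)"
    "analytic_disc (\<lambda>z. tri 0 z 0)" "disc_tangent (\<lambda>z. tri 0 z 0) (tri 0 1 0)"
  using royal_disc[of 1 0] royal_disc[of 0 1] by simp_all

text \<open>Undoing the rotation leaves a map to which \<open>fixes_royalI\<close> and \<open>fixes_royal_imp_id\<close> apply.\<close>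

lemma isotropy_diagonal:
  assumes f: "tetra_aut f g" "f 0 = 0" and u: "norm u = 1" and v: "norm v = 1"
    and t: "disc_tangent (\<lambda>z. f (tri z 0 0)) (tri u 0 0)" "disc_tangent (\<lambda>z. f (tri 0 z 0)) (tri 0 v 0)"
    and x: "x \<in> \<E>"
  shows "f x = rot u v x"
proof -
  let ?h = "rot (cnj u) (cnj v) \<circ> f"
  have h: "tetra_aut ?h (g \<circ> rot (cnj (cnj u)) (cnj (cnj v)))"
    by (intro tetra_aut_comp tetra_aut_rot f) (use u v in auto)
  have h0: "?h 0 = 0" using f by (simp add: rot_def tri_0)
  obtain D where D: "(?h has_derivative D) (at 0 within \<E>)" "Vector_Spaces.linear (*s) (*s) D"
    using tetra_aut_derivative[OF h zero_in_tetrablock] by blast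
  have uv: "cnj u * u = 1" "cnj v * v = 1"
    using u v complex_norm_square[of u] complex_norm_square[of v] by (auto simp: mult.commute)
  have "disc_tangent (\<lambda>z. ?h (tri z 0 0)) (D (tri 1 0 0))"
    using D by (intro disc_tangent_map[of "\<lambda>z. tri z 0 0" _ ?h D] horizontal_discs) (auto simp: tri_0)
  moreover have "disc_tangent (\<lambda>z. ?h (tri z 0 0)) (rot (cnj u) (cnj v) (tri u 0 0))"
    using disc_tangent_rot[OF t(1)] by simp
  ultimately have e1: "D (tri 1 0 0) = tri 1 0 0"
    using disc_tangent_unique uv by (fastforce simp: rot_def)
  have "disc_tangent (\<lambda>z. ?h (tri 0 z 0)) (D (tri 0 1 0))"
    using D by (intro disc_tangent_map[of "\<lambda>z. tri 0 z 0" _ ?h D] horizontal_discs) (auto simp: tri_0)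
  moreover have "disc_tangent (\<lambda>z. ?h (tri 0 z 0)) (rot (cnj u) (cnj v) (tri 0 v 0))"
    using disc_tangent_rot[OF t(2)] by simp
  ultimately have e2: "D (tri 0 1 0) = tri 0 1 0"
    using disc_tangent_unique uv by (fastforce simp: rot_def)
  have "?h x = x"
    by (rule fixes_royal_imp_id[OF h fixes_royalI[OF h h0 D e1 e2] x])
  then have "rot u v (rot (cnj u) (cnj v) (f x)) = rot u v x" by simp
  then show ?thesis unfolding rot_cancel(1)[OF u v] .
qed

lemma swap12_swap12 [simp]: "swap12 (swap12 x) = x"
  by (simp add: swap12_def vec_eq_iff forall_3)

theorem isotropy_group:
  assumes f: "tetra_aut f g" "f 0 = 0"
  obtains u v where "norm u = 1" "norm v = 1"
    "(\<forall>x\<in>\<E>. f x = rot u v x) \<or> (\<forall>x\<in>\<E>. f x = rot u v (swap12 x))"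
proof -
  obtain D where D: "(f has_derivative D) (at 0 within \<E>)" "Vector_Spaces.linear (*s) (*s) D"
    using tetra_aut_derivative[OF f(1) zero_in_tetrablock] by blast
  have t1: "disc_tangent (\<lambda>z. f (tri z 0 0)) (D (tri 1 0 0))"
    using D by (intro disc_tangent_map[of "\<lambda>z. tri z 0 0" _ f D] horizontal_discs) (auto simp: tri_0)
  have t2: "disc_tangent (\<lambda>z. f (tri 0 z 0)) (D (tri 0 1 0))"
    using D by (intro disc_tangent_map[of "\<lambda>z. tri 0 z 0" _ f D] horizontal_discs) (auto simp: tri_0)
  obtain u v w where uv: "norm u = 1" "norm v = 1"
    "D (tri 1 0 0) = tri u 0 0 \<and> D (tri 0 1 0) = tri 0 v 0 \<or>
     D (tri 1 0 0) = tri 0 u 0 \<and> D (tri 0 1 0) = tri v 0 0"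
    using tnorm_isometry_monomial[OF D(2) tnorm_derivative[OF f D]] by metis
  from uv(3) show ?thesis
  proof
    assume *: "D (tri 1 0 0) = tri u 0 0 \<and> D (tri 0 1 0) = tri 0 v 0"
    have "f x = rot u v x" if "x \<in> \<E>" for x
      using isotropy_diagonal[OF f uv(1,2) _ _ that] t1 t2 * by simp
    then show ?thesis using that uv by blast
  next
    assume *: "D (tri 1 0 0) = tri 0 u 0 \<and> D (tri 0 1 0) = tri v 0 0"
    let ?h = "f \<circ> swap12"
    have h: "tetra_aut ?h (swap12 \<circ> g)" by (intro tetra_aut_comp tetra_aut_swap12 f)
    have s: "swap12 (tri a b c) = tri b a c" for a b c by (simp add: swap12_def)
    have h0: "?h 0 = 0" using f(2) s[of 0 0 0] by (simp add: tri_0)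
    have "?h x = rot v u x" if "x \<in> \<E>" for x
      using t1 t2 * by (intro isotropy_diagonal[OF h h0 uv(2,1) _ _ that]) (simp_all add: s)
    then have "f x = rot v u (swap12 x)" if "x \<in> \<E>" for x
      using tetra_autD(3)[OF tetra_aut_swap12 that] by (metis comp_apply swap12_swap12)
    then show ?thesis using that uv by blast
  qed
qed

section \<open>The orbit of the origin\<close>

text \<open>In the slice \<open>x\<^sub>2 = 0\<close> the tetrablock is \<open>|x\<^sub>1| + |x\<^sub>3| < 1\<close>. Both coordinates are taken of the form
  \<open>c * (1 + d * z)\<^sup>2\<close>, up to a factor \<open>z\<close>, because then \<open>|x\<^sub>1| + |x\<^sub>3|\<close> on the unit circle contains the linear terms
  \<open>2 * c * d * Re z\<close>, and these cancel for \<open>\<delta> = \<alpha> * \<beta> / r\<close>. What remains is a loss of second order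
  in \<open>\<beta>\<close>.\<close>

lemma probe_disc:
  fixes r \<alpha> \<beta> :: real
  assumes r: "0 < r" "r < 1" and \<beta>: "0 < \<beta>" "\<beta>\<^sup>2 < r"
    and \<alpha>_def: "\<alpha> = (1 - r) * (1 - \<beta>\<^sup>2 / r)"
  shows "\<exists>\<phi>. analytic_disc \<phi> \<and> disc_tangent \<phi> (tri (of_real \<alpha>) 0 (- of_real (2 * \<alpha> * \<beta>))) \<and>
    \<phi> 0 = tri 0 0 (of_real r)"
proof (intro exI conjI)
  define \<delta> where "\<delta> = \<alpha> * \<beta> / r"
  let ?\<phi> = "\<lambda>z. tri (of_real \<alpha> * z * (1 + of_real \<beta> * z)\<^sup>2) 0 (of_real r * (1 - of_real \<delta> * z)\<^sup>2)"
  have \<alpha>: "0 < \<alpha>" unfolding \<alpha>_def using r \<beta> by (intro mult_pos_pos) auto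
  have norm_sq: "(norm (1 + of_real c * z))\<^sup>2 = 1 + 2 * c * Re z + c\<^sup>2 * (norm z)\<^sup>2" for c :: real and z :: complex
    unfolding cmod_power2 by (simp add: power2_eq_square algebra_simps)
  have r\<delta>: "r * \<delta> = \<alpha> * \<beta>" using r by (simp add: \<delta>_def)
  have le: "\<alpha> + \<alpha> * \<beta>\<^sup>2 + r * \<delta>\<^sup>2 \<le> 1 - r"
  proof -
    have "\<alpha> \<le> (1 - r) * 1" unfolding \<alpha>_def using r by (intro mult_left_mono) auto
    then have "\<alpha> * (\<alpha> * \<beta>\<^sup>2 / r) \<le> \<alpha> * ((1 - r) * \<beta>\<^sup>2 / r)"
      using r \<alpha> by (intro mult_left_mono divide_right_mono mult_right_mono) auto
    moreover have "r * \<delta>\<^sup>2 = \<alpha> * (\<alpha> * \<beta>\<^sup>2 / r)"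
      using r by (simp add: \<delta>_def power2_eq_square)
    ultimately have "\<alpha> + \<alpha> * \<beta>\<^sup>2 + r * \<delta>\<^sup>2 \<le> \<alpha> * (1 + \<beta>\<^sup>2 + (1 - r) * \<beta>\<^sup>2 / r)"
      by (simp add: algebra_simps)
    also have "1 + \<beta>\<^sup>2 + (1 - r) * \<beta>\<^sup>2 / r = 1 + \<beta>\<^sup>2 / r" using r by (simp add: field_simps)
    also have "\<alpha> * (1 + \<beta>\<^sup>2 / r) = (1 - r) * (1 - (\<beta>\<^sup>2 / r)\<^sup>2)"
    proof -
      have "(1 - r) * (1 - c) * (1 + c) = (1 - r) * (1 - c\<^sup>2)" for c :: real
        by (simp add: power2_eq_square algebra_simps)
      then show ?thesis unfolding \<alpha>_def .
    qed
    also have "\<dots> \<le> (1 - r) * 1" using r by (intro mult_left_mono) auto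
    finally show ?thesis by simp
  qed
  have E: "?\<phi> z \<in> \<E>" if z: "norm z < 1" for z
  proof (rule axis_in_tetrablock)
    define n where "n = (norm z)\<^sup>2"
    have n: "0 \<le> n" "n < 1" using z by (auto simp: n_def abs_square_less_1)
    have "norm (of_real \<alpha> * z * (1 + of_real \<beta> * z)\<^sup>2) = norm z * (\<alpha> * (norm (1 + of_real \<beta> * z))\<^sup>2)"
      using \<alpha> by (simp add: norm_mult norm_power)
    also have "\<dots> \<le> 1 * (\<alpha> * (norm (1 + of_real \<beta> * z))\<^sup>2)"
      using z \<alpha> by (intro mult_right_mono) auto
    finally have 1: "norm (of_real \<alpha> * z * (1 + of_real \<beta> * z)\<^sup>2) \<le> \<alpha> * (1 + 2 * \<beta> * Re z + \<beta>\<^sup>2 * n)"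
      unfolding norm_sq n_def by simp
    have "norm (of_real r * (1 - of_real \<delta> * z)\<^sup>2) = r * (norm (1 + of_real (-\<delta>) * z))\<^sup>2"
      using r by (simp add: norm_mult norm_power)
    then have 2: "norm (of_real r * (1 - of_real \<delta> * z)\<^sup>2) = r * (1 - 2 * \<delta> * Re z + \<delta>\<^sup>2 * n)"
      unfolding norm_sq n_def by simp
    have "\<alpha> * (1 + 2 * \<beta> * Re z + \<beta>\<^sup>2 * n) + r * (1 - 2 * \<delta> * Re z + \<delta>\<^sup>2 * n)
        = \<alpha> + r + (\<alpha> * \<beta>\<^sup>2 + r * \<delta>\<^sup>2) * n + 2 * (\<alpha> * \<beta> - r * \<delta>) * Re z"
      by (simp add: algebra_simps)
    also have "\<dots> = \<alpha> + r + (\<alpha> * \<beta>\<^sup>2 + r * \<delta>\<^sup>2) * n" unfolding r\<delta> by simp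
    also have "\<dots> < \<alpha> + r + (\<alpha> * \<beta>\<^sup>2 + r * \<delta>\<^sup>2) * 1"
      using n \<alpha> \<beta> r by (intro add_strict_left_mono mult_strict_left_mono add_pos_nonneg) auto
    also have "\<dots> \<le> 1" using le by simp
    finally show "norm (of_real \<alpha> * z * (1 + of_real \<beta> * z)\<^sup>2) + norm (of_real r * (1 - of_real \<delta> * z)\<^sup>2) < 1"
      using 1 2 by linarith
  qed
  show "analytic_disc ?\<phi>"
    unfolding analytic_disc_def
  proof (intro conjI allI ballI)
    fix j :: 3
    show "(\<lambda>z. ?\<phi> z $ j) holomorphic_on \<DD>"
      using exhaust_3[of j] by (auto intro!: holomorphic_intros)
  qed (use E in auto)
  show "disc_tangent ?\<phi> (tri (of_real \<alpha>) 0 (- of_real (2 * \<alpha> * \<beta>)))"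
    unfolding disc_tangent_def
  proof
    fix j :: 3
    have "complex_of_real r * of_real \<delta> = of_real \<alpha> * of_real \<beta>"
      using r\<delta> by (metis of_real_mult)
    moreover have "((\<lambda>z. of_real r * (1 - of_real \<delta> * z)\<^sup>2) has_field_derivative
        - (2 * (complex_of_real r * of_real \<delta>))) (at 0)"
      by (auto intro!: derivative_eq_intros)
    moreover have "((\<lambda>z. of_real \<alpha> * z * (1 + of_real \<beta> * z)\<^sup>2) has_field_derivative
        complex_of_real \<alpha>) (at 0)"
      by (auto intro!: derivative_eq_intros)
    ultimately show "((\<lambda>z. ?\<phi> z $ j) has_field_derivative tri (of_real \<alpha>) 0 (- of_real (2 * \<alpha> * \<beta>)) $ j) (at 0)"
      using exhaust_3[of j] by (auto simp: mult.assoc)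
  qed
  show "?\<phi> 0 = tri 0 0 (of_real r)" by simp
qed

text \<open>The inverse of \<open>f\<close> sends the disc of \<open>probe_disc\<close> to a disc centred at the origin. Its tangent has first entry
  \<open>\<alpha> / a\<close>, of modulus at least \<open>1 - \<beta>\<^sup>2 / r\<close>, and third entry of order \<open>\<beta>\<close>, so \<open>tnorm_le_1\<close> fails for small
  \<open>\<beta>\<close>.\<close>

lemma no_aut_to_axis_contracting_e1:
  assumes f: "tetra_aut f g" "f 0 = tri 0 0 (of_real r)" and r: "0 < r" "r < 1"
    and D: "(f has_derivative D) (at 0 within \<E>)" "Vector_Spaces.linear (*s) (*s) D"
    and De: "D (tri 1 0 0) = tri a 0 0" "D (tri 0 0 1) = tri 0 0 m"
    and a: "norm a \<le> 1 - r"
  shows False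
proof -
  have pE: "f 0 \<in> \<E>" using tetra_autD(3)[OF f(1) zero_in_tetrablock] .
  obtain D' where D': "(g has_derivative D') (at (f 0) within \<E>)" "Vector_Spaces.linear (*s) (*s) D'"
    using tetra_aut_derivative[OF tetra_aut_sym[OF f(1)] pE] by blast
  have D'D: "D' (D v) = v" for v by (rule derivative_inverse_at_0[OF f(1) D D'])
  have D'e: "D' (tri a 0 0) = tri 1 0 0" "D' (tri 0 0 m) = tri 0 0 1"
    using D'D[of "tri 1 0 0"] D'D[of "tri 0 0 1"] De by simp_all
  have ne: "tri 1 0 0 \<noteq> 0" "tri 0 0 1 \<noteq> 0" by (auto simp: vec_eq_iff forall_3)
  have a0: "a \<noteq> 0" and m0: "m \<noteq> 0"
    using D'e ne linear_vec(4)[OF D'(2)] tri_0 by metis+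
  define K where "K = 2 * (1 - r) / norm m"
  have K: "K > 0" using r m0 by (simp add: K_def)
  have bound: "(1 - \<beta>\<^sup>2 / r) * (1 + K * \<beta>) \<le> 1" if \<beta>: "0 < \<beta>" "\<beta>\<^sup>2 < r" for \<beta>
  proof -
    define \<alpha> where "\<alpha> = (1 - r) * (1 - \<beta>\<^sup>2 / r)"
    have b1: "0 < 1 - \<beta>\<^sup>2 / r" using \<beta> r by simp
    then have \<alpha>: "0 < \<alpha>" unfolding \<alpha>_def using r by simp
    obtain \<phi> where \<phi>: "analytic_disc \<phi>" "disc_tangent \<phi> (tri (of_real \<alpha>) 0 (- of_real (2 * \<alpha> * \<beta>)))"
        "\<phi> 0 = f 0"
      using probe_disc[OF r \<beta> \<alpha>_def] unfolding f(2) by blast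
    have "tnorm (D' (tri (of_real \<alpha>) 0 (- of_real (2 * \<alpha> * \<beta>)))) \<le> 1"
    proof (rule tnorm_le_1[of "\<lambda>z. g (\<phi> z)"])
      show "analytic_disc (\<lambda>z. g (\<phi> z))"
        by (rule analytic_disc_map[OF \<phi>(1) tetra_autD(2,4)[OF f(1)]])
      show "disc_tangent (\<lambda>z. g (\<phi> z)) (D' (tri (of_real \<alpha>) 0 (- of_real (2 * \<alpha> * \<beta>))))"
        using D' \<phi> by (intro disc_tangent_map[of \<phi> _ g D']) auto
      show "g (\<phi> 0) = 0"
        unfolding \<phi>(3) using tetra_autD(5)[OF f(1) zero_in_tetrablock] .
    qed
    moreover have "tri (of_real \<alpha>) 0 (- of_real (2 * \<alpha> * \<beta>))
        = (of_real \<alpha> / a) *s tri a 0 0 + (- of_real (2 * \<alpha> * \<beta>) / m) *s tri 0 0 m"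
      using a0 m0 by (simp add: vec_eq_iff forall_3)
    then have "D' (tri (of_real \<alpha>) 0 (- of_real (2 * \<alpha> * \<beta>)))
        = (of_real \<alpha> / a) *s tri 1 0 0 + (- of_real (2 * \<alpha> * \<beta>) / m) *s tri 0 0 1"
      by (simp only: linear_vec(1,2)[OF D'(2)] D'e)
    then have "D' (tri (of_real \<alpha>) 0 (- of_real (2 * \<alpha> * \<beta>)))
        = tri (of_real \<alpha> / a) 0 (- of_real (2 * \<alpha> * \<beta>) / m)"
      by (simp add: vec_eq_iff forall_3)
    moreover have "tnorm (tri (of_real \<alpha> / a) 0 (- of_real (2 * \<alpha> * \<beta>) / m))
        = \<alpha> / norm a + 2 * \<alpha> * \<beta> / norm m"
      using \<alpha> \<beta> by (simp add: tnorm_def norm_divide norm_mult)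
    ultimately have le: "\<alpha> / norm a + 2 * \<alpha> * \<beta> / norm m \<le> 1" by simp
    have "(1 - \<beta>\<^sup>2 / r) * norm a \<le> (1 - \<beta>\<^sup>2 / r) * (1 - r)"
      using a b1 by (intro mult_left_mono) auto
    then have "1 - \<beta>\<^sup>2 / r \<le> \<alpha> / norm a"
      using a0 by (simp add: \<alpha>_def pos_le_divide_eq mult.commute)
    moreover have "2 * \<alpha> * \<beta> / norm m = (1 - \<beta>\<^sup>2 / r) * (K * \<beta>)"
      by (simp add: K_def \<alpha>_def)
    moreover have "(1 - \<beta>\<^sup>2 / r) * (1 + K * \<beta>) = (1 - \<beta>\<^sup>2 / r) + (1 - \<beta>\<^sup>2 / r) * (K * \<beta>)"
      by (simp only: distrib_left mult_1_right)
    ultimately show ?thesis using le by linarith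
  qed
  \<comment> \<open>Small enough that the two error terms \<open>\<beta> / r\<close> and \<open>K * \<beta>\<^sup>2 / r\<close> are each at most \<open>K / 4\<close>.\<close>
  define \<beta> where "\<beta> = min (r/2) (K * r / 4)"
  have \<beta>: "0 < \<beta>" "\<beta> \<le> r/2" "\<beta> / r \<le> K / 4" using r K by (auto simp: \<beta>_def min_def field_simps)
  have "\<beta>\<^sup>2 \<le> (r/2) * (1/2)"
    unfolding power2_eq_square using \<beta> r by (intro mult_mono) auto
  then have \<beta>2: "\<beta>\<^sup>2 < r" "\<beta>\<^sup>2 / r \<le> 1/4" using r by (auto simp: field_simps)
  have "(1 - x) * (1 + y) = 1 - x + y - x * y" for x y :: real
    by (simp add: algebra_simps)
  then have "1 - \<beta>\<^sup>2 / r + K * \<beta> - \<beta>\<^sup>2 / r * (K * \<beta>) \<le> 1"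
    using bound[OF \<beta>(1) \<beta>2(1)] by metis
  moreover have "\<beta>\<^sup>2 / r = \<beta> * (\<beta> / r)" by (simp add: power2_eq_square)
  ultimately have "K * \<beta> \<le> \<beta> * (\<beta> / r) + \<beta>\<^sup>2 / r * (K * \<beta>)"
    by linarith
  also have "\<dots> \<le> \<beta> * (K / 4) + 1/4 * (K * \<beta>)"
    using \<beta> \<beta>2 K by (intro add_mono mult_left_mono mult_right_mono) auto
  also have "\<dots> = (K * \<beta>) / 2" by simp
  finally show False using mult_pos_pos[OF K \<beta>(1)] by linarith
qed

lemma swap12_derivative: "(swap12 has_derivative swap12) F"
  unfolding swap12_def[abs_def]
proof (rule has_derivative_vecI)
  have nth: "((\<lambda>x. x $ j) has_derivative (\<lambda>x. x $ j)) F" for j :: 3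
    by (rule bounded_linear_imp_has_derivative[OF bounded_linear_vec_nth])
  fix i :: 3
  show "((\<lambda>x. tri (x$2) (x$1) (x$3) $ i) has_derivative (\<lambda>h. tri (h$2) (h$1) (h$3) $ i)) F"
    using exhaust_3[of i] nth[of 1] nth[of 2] nth[of 3] by auto
qed

lemma swap12_linear: "Vector_Spaces.linear (*s) (*s) swap12"
  by (auto simp: Vector_Spaces.linear_iff vec.vector_space_axioms swap12_def vec_eq_iff forall_3)

lemma swap12_tri [simp]: "swap12 (tri a b c) = tri b a c"
  by (simp add: swap12_def)

lemma derivative_swap_left:
  assumes "(f has_derivative D) (at x within S)" "Vector_Spaces.linear (*s) (*s) D"
  shows "((swap12 \<circ> f) has_derivative (swap12 \<circ> D)) (at x within S)"
    "Vector_Spaces.linear (*s) (*s) (swap12 \<circ> D)"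
  using has_derivative_compose[OF assms(1) swap12_derivative]
    Vector_Spaces.linear_compose[OF assms(2) swap12_linear]
  by (simp_all add: comp_def)

lemma derivative_swap_right:
  assumes "(f has_derivative D) (at 0 within \<E>)" "Vector_Spaces.linear (*s) (*s) D"
  shows "((f \<circ> swap12) has_derivative (D \<circ> swap12)) (at 0 within \<E>)"
    "Vector_Spaces.linear (*s) (*s) (D \<circ> swap12)"
proof -
  have s: "swap12 ` \<E> \<subseteq> \<E>" using tetra_autD(3)[OF tetra_aut_swap12] by blast
  have "swap12 0 = 0" by (simp add: swap12_def tri_0)
  then have "(f has_derivative D) (at (swap12 0) within swap12 ` \<E>)"
    using has_derivative_subset[OF assms(1) s] by simp
  from has_derivative_in_compose[OF swap12_derivative this]
  show "((f \<circ> swap12) has_derivative (D \<circ> swap12)) (at 0 within \<E>)" by (simp add: comp_def)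
  show "Vector_Spaces.linear (*s) (*s) (D \<circ> swap12)"
    by (rule Vector_Spaces.linear_compose[OF swap12_linear assms(2)])
qed

text \<open>The images of the discs \<open>(z, cz, cz\<^sup>2)\<close>, \<open>|c| = 1\<close>, give \<open>|a| + r |b| \<le> 1 - r\<^sup>2\<close> and
  \<open>|b| + r |a| \<le> 1 - r\<^sup>2\<close> by Schwarz-Pick. Hence the smaller of \<open>|a|\<close> and \<open>|b|\<close> is at most \<open>1 - r\<close>, and the flip
  exchanges them.\<close>

lemma no_aut_to_axis_diagonal:
  assumes f: "tetra_aut f g" "f 0 = tri 0 0 (of_real r)" and r: "0 < r" "r < 1"
    and D: "(f has_derivative D) (at 0 within \<E>)" "Vector_Spaces.linear (*s) (*s) D"
    and De: "D (tri 1 0 0) = tri a 0 0" "D (tri 0 1 0) = tri 0 b 0" "D (tri 0 0 1) = tri 0 0 m"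
  shows False
proof -
  have 0: "f 0 = tri 0 0 (complex_of_real r)" by (rule f(2))
  have disc: "analytic_disc (\<lambda>z. f (tri (z * 1) (z * c) (z * 1 * (z * c))))"
      "disc_tangent (\<lambda>z. f (tri (z * 1) (z * c) (z * 1 * (z * c)))) (tri a (c * b) 0)"
    if c: "norm c = 1" for c
  proof -
    note d = royal_disc[of 1 c]
    show "analytic_disc (\<lambda>z. f (tri (z * 1) (z * c) (z * 1 * (z * c))))"
      by (rule analytic_disc_map[OF d(1) tetra_autD(1,3)[OF f(1)]]) (use c in auto)
    have "D (tri 1 c 0) = tri a (c * b) 0"
      using linear_tri[OF D(2), of 1 c 0] De by (simp add: vec_eq_iff forall_3)
    moreover have "disc_tangent (\<lambda>z. f (tri (z * 1) (z * c) (z * 1 * (z * c)))) (D (tri 1 c 0))"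
      using d c D by (intro disc_tangent_map[of "\<lambda>z. tri (z * 1) (z * c) (z * 1 * (z * c))" _ f D])
        (auto simp: tri_0)
    ultimately show "disc_tangent (\<lambda>z. f (tri (z * 1) (z * c) (z * 1 * (z * c)))) (tri a (c * b) 0)"
      by simp
  qed
  have nr: "1 - (norm (complex_of_real r))\<^sup>2 = (1 - r) * (1 + r)"
    by (simp add: power2_eq_square algebra_simps)
  obtain c where c: "norm c = 1" "norm (a - c * (r * b)) = norm a + norm (r * b)"
    by (rule aligned_phase)
  have 1: "norm a + r * norm b \<le> (1 - r) * (1 + r)"
    using disc_tangent_bound[OF disc[OF c(1)], of "of_real r" 1] c r 0 unfolding nr
    by (simp add: tri_0 norm_mult mult.left_commute)
  obtain c where c: "norm c = 1" "norm (r * a - c * b) = norm (r * a) + norm b"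
    by (rule aligned_phase)
  have 2: "norm b + r * norm a \<le> (1 - r) * (1 + r)"
    using disc_tangent_bound_swapped[OF disc[OF c(1)], of "of_real r" 1] c r 0 unfolding nr
    by (simp add: tri_0 norm_mult norm_minus_commute)
  show False
  proof (cases "norm a \<le> norm b")
    case True
    then have "r * norm a \<le> r * norm b" using r by simp
    then have "norm a * (1 + r) \<le> (1 - r) * (1 + r)" using 1 by (simp add: algebra_simps)
    then have "norm a \<le> 1 - r" using r by simp
    then show False using no_aut_to_axis_contracting_e1[OF f r D De(1,3)] by simp
  next
    case False
    then have "r * norm b \<le> r * norm a" using r by simp
    then have "norm b * (1 + r) \<le> (1 - r) * (1 + r)" using 2 by (simp add: algebra_simps)
    then have b: "norm b \<le> 1 - r" using r by simp
    let ?h = "swap12 \<circ> f \<circ> swap12"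
    have h: "tetra_aut ?h (swap12 \<circ> (g \<circ> swap12))"
      by (intro tetra_aut_comp tetra_aut_swap12 f)
    have "swap12 0 = 0" by (simp add: swap12_def tri_0)
    then have h0: "?h 0 = tri 0 0 (of_real r)" using f(2) by simp
    note Dl = derivative_swap_left[OF D]
    note Dh = derivative_swap_right[OF Dl]
    show False
      using no_aut_to_axis_contracting_e1[OF h h0 r Dh, of b m] De b by simp
  qed
qed

lemma eigenvector_of_diagonal:
  assumes e: "tri (p * V$1) (q * V$2) (s * V$3) = \<omega> *s V" and V: "V \<noteq> 0"
    and d: "p \<noteq> q" "p \<noteq> s" "q \<noteq> s"
  shows "\<omega> = p \<and> V$2 = 0 \<and> V$3 = 0 \<or> \<omega> = q \<and> V$1 = 0 \<and> V$3 = 0 \<or> \<omega> = s \<and> V$1 = 0 \<and> V$2 = 0"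
proof -
  have "(p - \<omega>) * V$1 = 0" "(q - \<omega>) * V$2 = 0" "(s - \<omega>) * V$3 = 0"
    using e by (simp_all add: vec_eq_iff forall_3 algebra_simps)
  then have "\<omega> = p \<or> V$1 = 0" "\<omega> = q \<or> V$2 = 0" "\<omega> = s \<or> V$3 = 0" by auto
  then show ?thesis using V d by (auto simp: vec_eq_iff forall_3)
qed

lemma rot_rot: "rot a b (rot c d x) = rot (a * c) (b * d) x"
  by (simp add: rot_def ac_simps)

text \<open>The rotation by \<open>(\<eta>, cnj \<eta>)\<close> fixes the axis pointwise, so its conjugate by \<open>f\<close> belongs to the
  isotropy group of the origin, and the square of this conjugate acts diagonally by \<open>(p, q, pq)\<close>. The derivative of \<open>f\<close> intertwines
  this with \<open>(cnj \<eta>, \<eta>, 1)\<close>, whose entries are distinct, so \<open>p\<close>, \<open>q\<close> and \<open>pq\<close> are the same three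
  numbers. That leaves only \<open>pq = 1\<close>: the third axis is kept and the first two are kept or exchanged.\<close>

lemma no_aut_to_axis:
  assumes f: "tetra_aut f g" "f 0 = tri 0 0 (of_real r)" and r: "0 < r" "r < 1"
  shows False
proof -
  define \<eta> where "\<eta> = Complex (- 1/2) (sqrt 3 / 2)"
  have sq: "\<eta> * \<eta> = cnj \<eta>" "cnj \<eta> * cnj \<eta> = \<eta>" "\<eta> * cnj \<eta> = 1" "cnj \<eta> * \<eta> = 1"
    by (simp_all add: \<eta>_def complex_eq_iff)
  have \<eta>n: "norm \<eta> = 1"
  proof -
    have "complex_of_real ((norm \<eta>)\<^sup>2) = 1" unfolding complex_norm_square by (rule sq)
    then have "(norm \<eta>)\<^sup>2 = 1" by (simp only: of_real_eq_1_iff)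
    then show ?thesis using norm_ge_zero[of \<eta>] by (auto simp: power2_eq_1_iff)
  qed
  have dist: "cnj \<eta> \<noteq> \<eta>" "cnj \<eta> \<noteq> 1" "\<eta> \<noteq> 1"
    by (simp_all add: \<eta>_def complex_eq_iff)
  let ?S = "rot \<eta> (cnj \<eta>)"
  have S: "tetra_aut ?S (rot (cnj \<eta>) \<eta>)" using tetra_aut_rot[of \<eta> "cnj \<eta>"] \<eta>n by simp
  have Sp: "?S (f 0) = f 0" using sq by (simp add: f(2) rot_def)
  let ?k = "g \<circ> (?S \<circ> f)"
  note fD = tetra_autD[OF f(1)]
  have k: "tetra_aut ?k ((g \<circ> rot (cnj \<eta>) \<eta>) \<circ> f)"
    by (intro tetra_aut_comp f S tetra_aut_sym[OF f(1)])
  have k0: "?k 0 = 0" using Sp fD(5)[OF zero_in_tetrablock] by simp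
  have fk: "f (?k x) = ?S (f x)" if "x \<in> \<E>" for x
    using that fD tetra_autD[OF S] by simp
  obtain u v where uv: "norm u = 1" "norm v = 1"
    "(\<forall>x\<in>\<E>. ?k x = rot u v x) \<or> (\<forall>x\<in>\<E>. ?k x = rot u v (swap12 x))"
    by (rule isotropy_group[OF k k0])
  have kE: "?k x \<in> \<E>" if "x \<in> \<E>" for x using tetra_autD(3)[OF k that] .
  \<comment> \<open>Squaring removes a possible flip.\<close>
  obtain p q where kk: "\<And>x. x \<in> \<E> \<Longrightarrow> ?k (?k x) = rot p q x"
  proof (cases "\<forall>x\<in>\<E>. ?k x = rot u v x")
    case True
    then have "?k (?k x) = rot (u * u) (v * v) x" if "x \<in> \<E>" for x
      using that kE[OF that] by (simp only: rot_rot)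
    then show ?thesis using that by blast
  next
    case False
    then have *: "\<forall>x\<in>\<E>. ?k x = rot u v (swap12 x)" using uv(3) by blast
    have "rot u v (swap12 (rot u v (swap12 x))) = rot (u * v) (u * v) x" for x
      by (simp add: rot_def swap12_def ac_simps)
    then have "?k (?k x) = rot (u * v) (u * v) x" if "x \<in> \<E>" for x
      using * that kE[OF that] by metis
    then show ?thesis using that by blast
  qed
  have main: "f (rot p q x) = rot (cnj \<eta>) \<eta> (f x)" if "x \<in> \<E>" for x
  proof -
    have "f (rot p q x) = f (?k (?k x))" using kk[OF that] by simp
    also have "\<dots> = ?S (?S (f x))" using fk kE that by metis
    finally show ?thesis by (simp only: rot_rot sq)
  qed
  obtain D where D: "(f has_derivative D) (at 0 within \<E>)" "Vector_Spaces.linear (*s) (*s) D"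
    using tetra_aut_derivative[OF f(1) zero_in_tetrablock] by blast
  have pE: "f 0 \<in> \<E>" using fD(3)[OF zero_in_tetrablock] .
  obtain D' where D': "(g has_derivative D') (at (f 0) within \<E>)" "Vector_Spaces.linear (*s) (*s) D'"
    using tetra_aut_derivative[OF tetra_aut_sym[OF f(1)] pE] by blast
  have D'D: "D' (D v) = v" for v by (rule derivative_inverse_at_0[OF f(1) D D'])
  have inj: "D v = 0 \<Longrightarrow> v = 0" for v using D'D[of v] linear_vec(4)[OF D'(2)] by simp
  have eig: "rot (cnj \<eta>) \<eta> (D v) = \<omega> *s D v"
    if \<phi>: "analytic_disc \<phi>" "disc_tangent \<phi> v" "\<phi> 0 = 0" and e: "rot p q v = \<omega> *s v" for \<phi> v \<omega>
  proof -
    have E: "\<phi> z \<in> \<E>" if "z \<in> \<DD>" for z using \<phi>(1) that by (simp add: analytic_disc_def)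
    have kkE: "rot p q x \<in> \<E>" if "x \<in> \<E>" for x using kk[OF that] kE[OF kE[OF that]] by simp
    have "disc_tangent (\<lambda>z. f (\<phi> z)) (D v)"
      using \<phi> D by (intro disc_tangent_map[of \<phi> v f D]) auto
    then have 1: "disc_tangent (\<lambda>z. rot (cnj \<eta>) \<eta> (f (\<phi> z))) (rot (cnj \<eta>) \<eta> (D v))"
      by (rule disc_tangent_rot)
    have "analytic_disc (\<lambda>z. rot p q (\<phi> z))"
      unfolding analytic_disc_def
    proof (intro conjI allI ballI)
      fix j :: 3
      show "(\<lambda>z. rot p q (\<phi> z) $ j) holomorphic_on \<DD>"
        using exhaust_3[of j] \<phi>(1) by (auto simp: rot_def analytic_disc_def intro!: holomorphic_intros)
    qed (use E kkE in auto)
    then have 2: "disc_tangent (\<lambda>z. f (rot p q (\<phi> z))) (D (rot p q v))"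
      using D \<phi>(3)
      by (intro disc_tangent_map[of "\<lambda>z. rot p q (\<phi> z)" "rot p q v" f D] disc_tangent_rot \<phi>(2))
         (auto simp: rot_def tri_0)
    have "rot (cnj \<eta>) \<eta> (D v) = D (rot p q v)"
      by (rule disc_tangent_unique[OF 1 2]) (use main E in auto)
    then show ?thesis by (simp add: e linear_vec(1)[OF D(2)])
  qed
  \<comment> \<open>The columns of \<open>D\<close> are eigenvectors of \<open>rot (cnj \<eta>) \<eta>\<close> with eigenvalues \<open>p\<close>, \<open>q\<close> and \<open>p * q\<close>.\<close>
  define A B P where "A = D (tri 1 0 0)" and "B = D (tri 0 1 0)" and "P = D (tri 0 0 1)"
  have nz: "A \<noteq> 0" "B \<noteq> 0" "P \<noteq> 0"
    using inj[of "tri 1 0 0"] inj[of "tri 0 1 0"] inj[of "tri 0 0 1"]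
    by (auto simp: A_def B_def P_def vec_eq_iff forall_3)
  have eA: "rot (cnj \<eta>) \<eta> A = p *s A" and eB: "rot (cnj \<eta>) \<eta> B = q *s B" and eP: "rot (cnj \<eta>) \<eta> P = (p * q) *s P"
    unfolding A_def B_def P_def
    by (intro eig[OF horizontal_discs(1,2)] eig[OF horizontal_discs(3,4)] eig[OF vertical_disc];
        simp add: rot_def vec_eq_iff forall_3)+
  have eigen: "\<omega> = cnj \<eta> \<and> V$2 = 0 \<and> V$3 = 0 \<or> \<omega> = \<eta> \<and> V$1 = 0 \<and> V$3 = 0 \<or>
      \<omega> = 1 \<and> V$1 = 0 \<and> V$2 = 0"
    if "rot (cnj \<eta>) \<eta> V = \<omega> *s V" "V \<noteq> 0" for V \<omega>
    using eigenvector_of_diagonal[of "cnj \<eta>" V \<eta> 1 \<omega>] that dist sq by (simp add: rot_def)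
  have indep: "\<not> (\<exists>c d. c *s D v = d *s D w \<and> (c \<noteq> 0 \<or> d \<noteq> 0))"
    if vw: "\<And>c d. c *s v = d *s w \<Longrightarrow> c = 0 \<and> d = 0" for v w
  proof
    assume "\<exists>c d. c *s D v = d *s D w \<and> (c \<noteq> 0 \<or> d \<noteq> 0)"
    then obtain c d where cd: "c *s D v = d *s D w" "c \<noteq> 0 \<or> d \<noteq> 0" by blast
    then have "D (c *s v - d *s w) = 0" by (simp add: linear_vec[OF D(2)])
    then show False using inj vw cd(2) by fastforce
  qed
  have distinct: "\<omega> \<noteq> \<omega>'"
    if V: "rot (cnj \<eta>) \<eta> V = \<omega> *s V" "V \<noteq> 0" and W: "rot (cnj \<eta>) \<eta> W = \<omega>' *s W" "W \<noteq> 0"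
      and VW: "\<not> (\<exists>c d. c *s V = d *s W \<and> (c \<noteq> 0 \<or> d \<noteq> 0))" for V W \<omega> \<omega>'
  proof
    assume "\<omega> = \<omega>'"
    then have "V$2 = 0 \<and> V$3 = 0 \<and> W$2 = 0 \<and> W$3 = 0 \<or> V$1 = 0 \<and> V$3 = 0 \<and> W$1 = 0 \<and> W$3 = 0 \<or>
        V$1 = 0 \<and> V$2 = 0 \<and> W$1 = 0 \<and> W$2 = 0"
      using eigen[OF V] eigen[OF W] dist by metis
    moreover have "V$1 \<noteq> 0 \<or> V$2 \<noteq> 0 \<or> V$3 \<noteq> 0"
      using V(2) by (auto simp: vec_eq_iff forall_3)
    ultimately consider "V$1 \<noteq> 0" "V$2 = 0 \<and> V$3 = 0 \<and> W$2 = 0 \<and> W$3 = 0"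
      | "V$2 \<noteq> 0" "V$1 = 0 \<and> V$3 = 0 \<and> W$1 = 0 \<and> W$3 = 0"
      | "V$3 \<noteq> 0" "V$1 = 0 \<and> V$2 = 0 \<and> W$1 = 0 \<and> W$2 = 0"
      by blast
    then have "\<exists>i. W $ i *s V = V $ i *s W \<and> V $ i \<noteq> 0"
    proof cases
      case 1 then show ?thesis by (intro exI[of _ 1]) (simp add: vec_eq_iff forall_3)
    next
      case 2 then show ?thesis by (intro exI[of _ 2]) (simp add: vec_eq_iff forall_3)
    next
      case 3 then show ?thesis by (intro exI[of _ 3]) (simp add: vec_eq_iff forall_3)
    qed
    then show False using VW by blast
  qed
  have pq: "p \<noteq> q"
    by (rule distinct[OF eA nz(1) eB nz(2)]) (unfold A_def B_def, rule indep, simp add: vec_eq_iff forall_3)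
  have "p \<noteq> p * q"
    by (rule distinct[OF eA nz(1) eP nz(3)]) (unfold A_def P_def, rule indep, simp add: vec_eq_iff forall_3)
  then have q1: "q \<noteq> 1" by auto
  have "q \<noteq> p * q"
    by (rule distinct[OF eB nz(2) eP nz(3)]) (unfold B_def P_def, rule indep, simp add: vec_eq_iff forall_3)
  then have p1: "p \<noteq> 1" by auto
  have cases: "p = cnj \<eta> \<and> q = \<eta> \<or> p = \<eta> \<and> q = cnj \<eta>"
    using eigen[OF eA nz(1)] eigen[OF eB nz(2)] pq p1 q1 by auto
  then have "p * q = 1" using sq by auto
  then have "P$1 = 0 \<and> P$2 = 0" using eigen[OF eP nz(3)] dist by metis
  then have P: "P = tri 0 0 (P$3)" by (simp add: vec_eq_iff forall_3)
  from cases show False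
  proof
    assume "p = cnj \<eta> \<and> q = \<eta>"
    then have "A$2 = 0 \<and> A$3 = 0" "B$1 = 0 \<and> B$3 = 0"
      using eigen[OF eA nz(1)] eigen[OF eB nz(2)] dist by metis+
    then have AB: "A = tri (A$1) 0 0" "B = tri 0 (B$2) 0"
      by (simp_all add: vec_eq_iff forall_3)
    then show False
      using no_aut_to_axis_diagonal[OF f r D AB[unfolded A_def B_def] P[unfolded P_def]]
      by simp
  next
    assume "p = \<eta> \<and> q = cnj \<eta>"
    then have "A$1 = 0 \<and> A$3 = 0" "B$2 = 0 \<and> B$3 = 0"
      using eigen[OF eA nz(1)] eigen[OF eB nz(2)] dist by metis+
    then have AB: "swap12 A = tri (A$2) 0 0" "swap12 B = tri 0 (B$1) 0" "swap12 P = tri 0 0 (P$3)"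
      using P by (simp_all add: swap12_def vec_eq_iff forall_3)
    let ?h = "swap12 \<circ> f"
    have h: "tetra_aut ?h (g \<circ> swap12)" by (intro tetra_aut_comp tetra_aut_swap12 f)
    have h0: "?h 0 = tri 0 0 (of_real r)" using f(2) by simp
    show False
      using no_aut_to_axis_diagonal[OF h h0 r derivative_swap_left[OF D]] AB
      unfolding A_def B_def P_def comp_apply by blast
  qed
qed

text \<open>The base point \<open>f 0\<close> is moved to the axis by two involutions, and there it is the origin by
  \<open>no_aut_to_axis\<close>; then \<open>isotropy_group\<close> applies.\<close>

theorem tetra_aut_classification:
  assumes f: "tetra_aut f g"
  obtains a b u v where "norm a < 1" "norm b < 1" "norm u = 1" "norm v = 1"
    "(\<forall>x\<in>\<E>. f x = mob a (mob2 b (rot u v x))) \<or>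
     (\<forall>x\<in>\<E>. f x = mob a (mob2 b (rot u v (swap12 x))))"
proof -
  note fD = tetra_autD[OF f]
  obtain a b w where ab: "norm a < 1" "norm b < 1" "norm w < 1" "f 0 = mob a (mob2 b (tri 0 0 w))"
    using tetrablock_orbit[OF fD(3)[OF zero_in_tetrablock]] by blast
  note mD = tetra_autD[OF tetra_aut_mob[OF ab(1)]] and m2D = tetra_autD[OF tetra_aut_mob2[OF ab(2)]]
  let ?h = "mob2 b \<circ> (mob a \<circ> f)"
  have h: "tetra_aut ?h ((g \<circ> mob a) \<circ> mob2 b)"
    by (intro tetra_aut_comp tetra_aut_mob tetra_aut_mob2 f ab)
  have wE: "tri 0 0 w \<in> \<E>" using axis_in_tetrablock[of 0 w] ab(3) by simp
  have hw: "?h 0 = tri 0 0 w" using ab(4) mD m2D wE by simp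
  have w0: "w = 0"
  proof (rule ccontr)
    assume w: "w \<noteq> 0"
    \<comment> \<open>A rotation brings \<open>w\<close> to its modulus, as \<open>no_aut_to_axis\<close> requires a positive value.\<close>
    define u where "u = cnj w / of_real (norm w)"
    have u: "norm u = 1" using w by (simp add: u_def norm_divide)
    have "w * cnj w = of_real ((norm w)\<^sup>2)" by (simp only: complex_norm_square)
    then have uw: "u * w = of_real (norm w)"
      using w by (simp add: u_def mult.commute[of "cnj w"] power2_eq_square)
    have k: "tetra_aut (rot u 1 \<circ> ?h) (((g \<circ> mob a) \<circ> mob2 b) \<circ> rot (cnj u) (cnj 1))"
      by (intro tetra_aut_comp[OF _ h] tetra_aut_rot u) simp
    have "(rot u 1 \<circ> ?h) 0 = tri 0 0 (of_real (norm w))"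
      unfolding comp_apply[of "rot u 1"] hw using uw by (simp add: rot_def)
    from no_aut_to_axis[OF k this] show False using w ab(3) by simp
  qed
  then have h0: "?h 0 = 0" using hw by (simp add: tri_0)
  have fh: "f x = mob a (mob2 b (?h x))" if "x \<in> \<E>" for x
    using that fD mD m2D by simp
  obtain u v where uv: "norm u = 1" "norm v = 1"
    "(\<forall>x\<in>\<E>. ?h x = rot u v x) \<or> (\<forall>x\<in>\<E>. ?h x = rot u v (swap12 x))"
    by (rule isotropy_group[OF h h0])
  from uv(3) have "(\<forall>x\<in>\<E>. f x = mob a (mob2 b (rot u v x))) \<or>
     (\<forall>x\<in>\<E>. f x = mob a (mob2 b (rot u v (swap12 x))))"
  proof
    assume "\<forall>x\<in>\<E>. ?h x = rot u v x"
    then show ?thesis using fh by metis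
  next
    assume "\<forall>x\<in>\<E>. ?h x = rot u v (swap12 x)"
    then show ?thesis using fh by metis
  qed
  then show ?thesis using that ab uv by blast
qed

section \<open>Automorphisms of the disc\<close>

definition disc_mob :: "complex \<Rightarrow> complex \<Rightarrow> complex" where
  "disc_mob a z = (a - z) / (1 - cnj a * z)"

lemma disc_mob_disc:
  assumes "norm a < 1" "norm z < 1"
  shows "norm (disc_mob a z) < 1" "disc_mob a (disc_mob a z) = z" "1 - cnj a * z \<noteq> 0"
proof -
  have E: "tri z 0 0 \<in> \<E>" using axis_in_tetrablock[of z 0] assms(2) by simp
  show "1 - cnj a * z \<noteq> 0" using one_minus_mult_nonzero[of "cnj a" z] assms by simp
  show "norm (disc_mob a z) < 1" unfolding disc_mob_def by (rule moebius_norm_less[OF assms])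
  have "mob a (mob a (tri z 0 0)) $ 1 = z" using mob_mob[OF assms(1) E] by simp
  then show "disc_mob a (disc_mob a z) = z" by (simp add: mob_def disc_mob_def)
qed

lemma disc_mob_holomorphic:
  assumes "norm a < 1"
  shows "disc_mob a holomorphic_on \<DD>"
  unfolding disc_mob_def using disc_mob_disc(3)[OF assms] by (intro holomorphic_intros) auto

definition disc_aut :: "complex \<Rightarrow> complex \<Rightarrow> complex \<Rightarrow> complex" where
  "disc_aut \<omega> \<alpha> = (\<lambda>z\<in>\<DD>. \<omega> * ((z - \<alpha>) / (cnj \<alpha> * z - 1)))"

lemma disc_aut_eq: "z \<in> \<DD> \<Longrightarrow> disc_aut \<omega> \<alpha> z = \<omega> * disc_mob \<alpha> z"
  using minus_divide_divide[of "\<alpha> - z" "1 - cnj \<alpha> * z"] by (simp add: disc_aut_def disc_mob_def del: times_divide_eq_right)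

lemma Aut_discI:
  assumes "f \<in> extensional \<DD>" "f holomorphic_on \<DD>" "g holomorphic_on \<DD>"
    "\<And>z. z \<in> \<DD> \<Longrightarrow> f z \<in> \<DD> \<and> g z \<in> \<DD> \<and> g (f z) = z \<and> f (g z) = z"
  shows "f \<in> Aut_disc"
proof -
  have bij: "bij_betw f \<DD> \<DD>"
    by (rule bij_betw_byWitness[where f' = g]) (use assms(4) in auto)
  have "inv_into \<DD> f z = g z" if "z \<in> \<DD>" for z
    using bij assms(4)[OF that] by (intro inv_into_f_eq) (auto simp: bij_betw_def)
  then have "inv_into \<DD> f holomorphic_on \<DD>"
    by (intro holomorphic_transform[OF assms(3)]) simp
  then show ?thesis using assms(1,2) bij by (simp add: Aut_disc_def Bij_def)
qed

lemma disc_aut_in_Aut_disc: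
  assumes w: "norm \<omega> = 1" and a: "norm \<alpha> < 1"
  shows "disc_aut \<omega> \<alpha> \<in> Aut_disc"
proof (rule Aut_discI)
  show "disc_aut \<omega> \<alpha> \<in> extensional \<DD>" by (simp add: disc_aut_def)
  show "disc_aut \<omega> \<alpha> holomorphic_on \<DD>"
    by (rule holomorphic_transform[of "\<lambda>z. \<omega> * disc_mob \<alpha> z"])
       (auto simp: disc_aut_eq intro!: holomorphic_intros disc_mob_holomorphic[OF a])
  have im: "cnj \<omega> * z \<in> \<DD>" if "z \<in> \<DD>" for z using that w by (simp add: norm_mult)
  have "(disc_mob \<alpha> \<circ> (\<lambda>z. cnj \<omega> * z)) holomorphic_on \<DD>"
    using im by (intro holomorphic_on_compose_gen[where t = \<DD>] holomorphic_intros disc_mob_holomorphic[OF a]) auto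
  then show "(\<lambda>z. disc_mob \<alpha> (cnj \<omega> * z)) holomorphic_on \<DD>" by (simp add: comp_def)
  have ww: "cnj \<omega> * (\<omega> * c) = c" "\<omega> * (cnj \<omega> * c) = c" for c
    using w complex_norm_square[of \<omega>] by (simp_all add: mult.commute flip: mult.assoc)
  fix z assume z: "z \<in> \<DD>"
  then have nz: "norm z < 1" by simp
  have n2: "norm (cnj \<omega> * z) < 1" using im[OF z] by simp
  have d: "norm (disc_mob \<alpha> z) < 1" "norm (disc_mob \<alpha> (cnj \<omega> * z)) < 1"
    using disc_mob_disc(1)[OF a nz] disc_mob_disc(1)[OF a n2] by auto
  have "disc_aut \<omega> \<alpha> z \<in> \<DD>" using z w d(1) by (simp add: disc_aut_eq norm_mult)
  moreover have "disc_mob \<alpha> (cnj \<omega> * disc_aut \<omega> \<alpha> z) = z"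
    using z nz by (simp only: disc_aut_eq ww disc_mob_disc(2)[OF a])
  moreover have "disc_aut \<omega> \<alpha> (disc_mob \<alpha> (cnj \<omega> * z)) = z"
    using disc_aut_eq[of "disc_mob \<alpha> (cnj \<omega> * z)" \<omega> \<alpha>] d(2) by (simp add: disc_mob_disc(2)[OF a n2] ww)
  ultimately show "disc_aut \<omega> \<alpha> z \<in> \<DD> \<and> disc_mob \<alpha> (cnj \<omega> * z) \<in> \<DD> \<and>
      disc_mob \<alpha> (cnj \<omega> * disc_aut \<omega> \<alpha> z) = z \<and> disc_aut \<omega> \<alpha> (disc_mob \<alpha> (cnj \<omega> * z)) = z"
    using d(2) by simp
qed

text \<open>Composing with the involution at the zero \<open>\<alpha>\<close> of \<open>f\<close> gives an automorphism fixing \<open>0\<close>. The Schwarz lemma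
  for it and for its inverse makes it a rotation.\<close>

lemma Aut_disc_form:
  assumes f: "f \<in> Aut_disc"
  obtains \<omega> \<alpha> where "norm \<omega> = 1" "norm \<alpha> < 1" "f = disc_aut \<omega> \<alpha>"
proof -
  define g where "g = inv_into \<DD> f"
  have bij: "bij_betw f \<DD> \<DD>" and ext: "f \<in> extensional \<DD>"
    and hf: "f holomorphic_on \<DD>" and hg: "g holomorphic_on \<DD>"
    using f by (auto simp: Aut_disc_def Bij_def g_def)
  have f1: "f z \<in> \<DD>" "g z \<in> \<DD>" "f (g z) = z" "g (f z) = z" if "z \<in> \<DD>" for z
    using bij that bij_betw_inv_into[OF bij]
    by (auto simp: g_def bij_betw_inv_into_right bij_betw_inv_into_left dest: bij_betwE)
  define \<alpha> where "\<alpha> = g 0"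
  have \<alpha>: "norm \<alpha> < 1" using f1(2)[of 0] by (simp add: \<alpha>_def)
  note m = disc_mob_disc[OF \<alpha>]
  define h where "h = f \<circ> disc_mob \<alpha>"
  define k where "k = disc_mob \<alpha> \<circ> g"
  have hol: "h holomorphic_on \<DD>" "k holomorphic_on \<DD>"
    unfolding h_def k_def
    using disc_mob_holomorphic[OF \<alpha>] hf hg m(1) f1(2)
    by (auto intro!: holomorphic_on_compose_gen[where t = \<DD>])
  have h0: "h 0 = 0" "k 0 = 0"
    using f1(3)[of 0] by (simp_all add: h_def k_def disc_mob_def \<alpha>_def)
  have hn: "norm (h z) < 1" "norm (k z) < 1" "k (h z) = z" if "norm z < 1" for z
  proof -
    have 1: "norm (disc_mob \<alpha> z) < 1" by (rule m(1)[OF that])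
    show "norm (h z) < 1" using f1(1)[of "disc_mob \<alpha> z"] 1 by (simp add: h_def)
    have "norm (g z) < 1" using f1(2)[of z] that by simp
    then show "norm (k z) < 1" using m(1) by (simp add: k_def)
    show "k (h z) = z" using f1(4)[of "disc_mob \<alpha> z"] 1 m(2)[OF that] by (simp add: k_def h_def)
  qed
  have half: "norm (1/2::complex) < 1" by simp
  have "norm (h (1/2)) \<le> norm (1/2::complex)"
    by (rule Schwarz_Lemma(1)[OF hol(1) h0(1) hn(1) half])
  moreover have "norm (k (h (1/2))) \<le> norm (h (1/2))"
    by (rule Schwarz_Lemma(1)[OF hol(2) h0(2) hn(2) hn(1)[OF half]])
  ultimately have "norm (h (1/2)) = norm (1/2::complex)" using hn(3)[OF half] by simp
  then have "\<exists>z. norm z < 1 \<and> z \<noteq> 0 \<and> norm (h z) = norm z" by (intro exI[of _ "1/2"]) simp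
  then obtain \<omega> where \<omega>: "\<And>z. norm z < 1 \<Longrightarrow> h z = \<omega> * z" "norm \<omega> = 1"
    using Schwarz_Lemma(3)[OF hol(1) h0(1) hn(1) half] by blast
  have "f = disc_aut \<omega> \<alpha>"
  proof
    fix z
    show "f z = disc_aut \<omega> \<alpha> z"
    proof (cases "z \<in> \<DD>")
      case True
      then have z: "norm z < 1" by simp
      have "f z = h (disc_mob \<alpha> z)" using m(2)[OF z] by (simp add: h_def)
      then show ?thesis using \<omega>(1)[OF m(1)[OF z]] disc_aut_eq[OF True] by simp
    next
      case False
      then show ?thesis using ext by (simp add: disc_aut_def extensional_def)
    qed
  qed
  then show ?thesis using that \<omega>(2) \<alpha> by blast
qed

section \<open>The left and right actions\<close>

lemma tau_disc_aut:
  assumes "norm \<omega> = 1" "norm \<alpha> < 1"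
  shows "\<tau> (disc_aut \<omega> \<alpha>) = tri (\<omega> * \<alpha>) (cnj \<alpha>) \<omega>"
  by (rule tau_eq[OF assms]) (simp add: disc_aut_def)

lemma left_act_eq:
  assumes "norm \<omega> = 1" "norm \<alpha> < 1" "x \<in> \<E>"
  shows "left_act (disc_aut \<omega> \<alpha>) x = rot \<omega> 1 (mob \<alpha> x)"
  using assms(3) unfolding left_act_def tau_disc_aut[OF assms(1,2)]
  by (simp add: diamond_def rot_def mob_def vec_eq_iff forall_3 algebra_simps diff_divide_distrib)

lemma right_act_eq:
  assumes "norm \<omega> = 1" "norm \<alpha> < 1" "x \<in> \<E>"
  shows "right_act (disc_aut \<omega> \<alpha>) x = mob2 (cnj \<alpha>) (rot 1 \<omega> x)"
  using assms(3) unfolding right_act_def tau_disc_aut[OF assms(1,2)]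
  by (simp add: diamond_def rot_def mob2_eq vec_eq_iff forall_3 algebra_simps diff_divide_distrib)

lemma flip_eq: "x \<in> \<E> \<Longrightarrow> flip x = swap12 x"
  by (simp add: flip_def swap12_def)

lemma Aut_imp_tetra_aut:
  assumes "f \<in> Aut \<E>"
  shows "tetra_aut f (inv_into \<E> f)"
proof -
  have bij: "bij_betw f \<E> \<E>" using assms by (auto simp: Aut_def Bij_def)
  have "f x \<in> \<E> \<and> inv_into \<E> f x \<in> \<E> \<and> inv_into \<E> f (f x) = x \<and> f (inv_into \<E> f x) = x" if "x \<in> \<E>" for x
    using bij that bij_betw_inv_into[OF bij]
    by (auto simp: bij_betw_inv_into_right bij_betw_inv_into_left dest: bij_betwE)
  then show ?thesis using assms by (simp add: tetra_aut_def Aut_def)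
qed

lemma tetra_aut_imp_Aut:
  assumes f: "tetra_aut f g" and h: "h \<in> extensional \<E>" "\<And>x. x \<in> \<E> \<Longrightarrow> h x = f x"
  shows "h \<in> Aut \<E>"
proof -
  note fD = tetra_autD[OF f]
  have bij: "bij_betw h \<E> \<E>"
    by (rule bij_betw_byWitness[where f' = g]) (use fD h(2) in auto)
  have "inv_into \<E> h x = g x" if "x \<in> \<E>" for x
    using bij h(2) fD(4,6)[OF that] by (intro inv_into_f_eq) (auto simp: bij_betw_def)
  then have "inv_into \<E> h holomorphic_map_on \<E>"
    by (rule holomorphic_map_on_cong[OF fD(2)])
  moreover have "h holomorphic_map_on \<E>"
    by (rule holomorphic_map_on_cong[OF fD(1) h(2)])
  ultimately show ?thesis using h(1) bij by (simp add: Aut_def Bij_def)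
qed

lemma product_eq:
  assumes \<omega>: "norm \<omega> = 1" "norm \<alpha> < 1" and \<omega>': "norm \<omega>' = 1" "norm \<alpha>' < 1"
    and \<nu>: "\<nu> \<in> {0, 1 :: nat}" and x: "x \<in> \<E>"
  shows "compose \<E> (left_act (disc_aut \<omega> \<alpha>)) (compose \<E> (right_act (disc_aut \<omega>' \<alpha>')) (flip ^^ \<nu>)) x
    = rot \<omega> 1 (mob \<alpha> (mob2 (cnj \<alpha>') (rot 1 \<omega>' ((swap12 ^^ \<nu>) x))))"
proof -
  have fl: "(flip ^^ \<nu>) x = (swap12 ^^ \<nu>) x" using \<nu> x by (auto simp: flip_eq)
  have sE: "(swap12 ^^ \<nu>) x \<in> \<E>" using \<nu> x tetra_autD(3)[OF tetra_aut_swap12 x] by auto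
  have "rot 1 \<omega>' ((swap12 ^^ \<nu>) x) \<in> \<E>" using rot_in_tetrablock[OF _ \<omega>'(1) sE, of 1] by simp
  then have "mob2 (cnj \<alpha>') (rot 1 \<omega>' ((swap12 ^^ \<nu>) x)) \<in> \<E>"
    using tetra_autD(3)[OF tetra_aut_mob2[of "cnj \<alpha>'"]] \<omega>' by simp
  then show ?thesis
    using x by (simp add: compose_def fl right_act_eq[OF \<omega>' sE] left_act_eq[OF \<omega>])
qed

text \<open>The left actions form a group that commutes with the right actions, which brings the normal form of
  \<open>tetra_aut_classification\<close> into the shape of a left times a right action.\<close>

lemma rot_mob_commute:
  assumes u: "norm u = 1" "norm v = 1" and a: "norm a < 1" "norm b < 1" and x: "x \<in> \<E>"
  shows "mob a (mob2 b (rot u v x)) = rot u 1 (mob (cnj u * a) (mob2 b (rot 1 v x)))"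
proof -
  have uu: "u * cnj u = 1" using u complex_norm_square[of u] by auto
  have uuc: "u * (cnj u * c) = c" for c using uu by (simp flip: mult.assoc)
  have 1: "mob2 b (rot u v x) = rot u 1 (mob2 b (rot 1 v x))"
    by (simp add: mob2_eq rot_def vec_eq_iff forall_3 algebra_simps diff_divide_distrib)
  have 2: "mob a (rot u 1 y) = rot u 1 (mob (cnj u * a) y)" for y
    by (simp add: mob_def rot_def vec_eq_iff forall_3 algebra_simps diff_divide_distrib uu uuc)
  show ?thesis unfolding 1 2 ..
qed

theorem theorem4p1:
  "Aut \<E> =
     {compose \<E> (left_act \<upsilon>) (compose \<E> (right_act \<xi>) (flip ^^ \<nu>)) | \<upsilon> \<xi> \<nu>.
        \<upsilon> \<in> Aut_disc \<and> \<xi> \<in> Aut_disc \<and> \<nu> \<in> {0, 1}}"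
proof (intro equalityI subsetI)
  fix f assume f: "f \<in> Aut \<E>"
  have ext: "f \<in> extensional \<E>" using f by (simp add: Aut_def Bij_def)
  obtain a b u v where ab: "norm a < 1" "norm b < 1" and uv: "norm u = 1" "norm v = 1"
    and form: "(\<forall>x\<in>\<E>. f x = mob a (mob2 b (rot u v x))) \<or>
     (\<forall>x\<in>\<E>. f x = mob a (mob2 b (rot u v (swap12 x))))"
    by (rule tetra_aut_classification[OF Aut_imp_tetra_aut[OF f]])
  have "\<exists>\<nu>\<in>{0, 1::nat}. \<forall>x\<in>\<E>. f x = mob a (mob2 b (rot u v ((swap12 ^^ \<nu>) x)))"
    using form by auto
  then obtain \<nu> :: nat where \<nu>: "\<nu> \<in> {0, 1}"
    and fx: "\<And>x. x \<in> \<E> \<Longrightarrow> f x = mob a (mob2 b (rot u v ((swap12 ^^ \<nu>) x)))"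
    by blast
  define \<upsilon> \<xi> where "\<upsilon> = disc_aut u (cnj u * a)" and "\<xi> = disc_aut v (cnj b)"
  have n: "norm (cnj u * a) < 1" "norm (cnj b) < 1" using uv ab by (simp_all add: norm_mult)
  have "f = compose \<E> (left_act \<upsilon>) (compose \<E> (right_act \<xi>) (flip ^^ \<nu>))"
  proof (rule extensionalityI[OF ext compose_extensional])
    fix x assume x: "x \<in> \<E>"
    have sE: "(swap12 ^^ \<nu>) x \<in> \<E>" using \<nu> x tetra_autD(3)[OF tetra_aut_swap12 x] by auto
    show "f x = compose \<E> (left_act \<upsilon>) (compose \<E> (right_act \<xi>) (flip ^^ \<nu>)) x"
      unfolding \<upsilon>_def \<xi>_def product_eq[OF uv(1) n(1) uv(2) n(2) \<nu> x] fx[OF x]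
      using rot_mob_commute[OF uv ab sE] by simp
  qed
  then show "f \<in> {compose \<E> (left_act \<upsilon>) (compose \<E> (right_act \<xi>) (flip ^^ \<nu>)) | \<upsilon> \<xi> \<nu>.
        \<upsilon> \<in> Aut_disc \<and> \<xi> \<in> Aut_disc \<and> \<nu> \<in> {0, 1}}"
    using disc_aut_in_Aut_disc[OF uv(1) n(1)] disc_aut_in_Aut_disc[OF uv(2) n(2)] \<nu>
    unfolding \<upsilon>_def \<xi>_def by blast
next
  fix f assume "f \<in> {compose \<E> (left_act \<upsilon>) (compose \<E> (right_act \<xi>) (flip ^^ \<nu>)) | \<upsilon> \<xi> \<nu>.
        \<upsilon> \<in> Aut_disc \<and> \<xi> \<in> Aut_disc \<and> \<nu> \<in> {0, 1}}"
  then obtain \<upsilon> \<xi> and \<nu> :: nat where f: "f = compose \<E> (left_act \<upsilon>) (compose \<E> (right_act \<xi>) (flip ^^ \<nu>))"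
    and A: "\<upsilon> \<in> Aut_disc" "\<xi> \<in> Aut_disc" and \<nu>: "\<nu> \<in> {0, 1}" by blast
  obtain \<omega> \<alpha> where \<upsilon>: "norm \<omega> = 1" "norm \<alpha> < 1" "\<upsilon> = disc_aut \<omega> \<alpha>" by (rule Aut_disc_form[OF A(1)])
  obtain \<omega>' \<alpha>' where \<xi>: "norm \<omega>' = 1" "norm \<alpha>' < 1" "\<xi> = disc_aut \<omega>' \<alpha>'" by (rule Aut_disc_form[OF A(2)])
  let ?R = "rot \<omega> 1 \<circ> (mob \<alpha> \<circ> (mob2 (cnj \<alpha>') \<circ> rot 1 \<omega>'))"
  have \<alpha>': "norm (cnj \<alpha>') < 1" using \<xi> by simp
  have one: "norm (1::complex) = 1" by simp
  have R: "\<exists>g. tetra_aut ?R g"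
    using tetra_aut_comp[OF tetra_aut_rot[OF \<upsilon>(1) one] tetra_aut_comp[OF tetra_aut_mob[OF \<upsilon>(2)]
        tetra_aut_comp[OF tetra_aut_mob2[OF \<alpha>'] tetra_aut_rot[OF one \<xi>(1)]]]] by blast
  then have "\<exists>g. tetra_aut (?R \<circ> swap12) g" using tetra_aut_comp[OF _ tetra_aut_swap12] by blast
  then have "\<exists>g. tetra_aut (?R \<circ> (swap12 ^^ \<nu>)) g" using R \<nu> by (auto simp: comp_assoc)
  then obtain g where g: "tetra_aut (?R \<circ> (swap12 ^^ \<nu>)) g" by blast
  show "f \<in> Aut \<E>"
  proof (rule tetra_aut_imp_Aut[OF g])
    show "f \<in> extensional \<E>" unfolding f by (rule compose_extensional)
    show "f x = (?R \<circ> (swap12 ^^ \<nu>)) x" if "x \<in> \<E>" for x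
      unfolding f \<upsilon>(3) \<xi>(3) product_eq[OF \<upsilon>(1,2) \<xi>(1,2) \<nu> that] by simp
  qed
qed

end
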